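(* Let $\ell\ge 6$ be an even integer. Asymptotics are for fixed $\ell$ and $n\to\infty$. (i) For every such $\ell$, $\mathrm{st}(n,C_\ell)=O\bigl(n^{1+1/\lceil \ell/4\rceil}\bigr)$. (ii) If $\ell\in\{6,8,10,12,18,20\}$, then $\mathrm{st}(n,C_\ell)=\Theta\bigl(n^{1+1/\lceil \ell/4\rceil}\bigr)$. (iii) If $\ell\in\{14,16\}$, then $c_1n^{6/5}\le \mathrm{st}(n,C_\ell)\le c_2n^{5/4}$ for some positive constants $c_1,c_2$. (iv) If $\ell>20$ with $\ell=4k-2$ or $\ell=4k$, then for some constant $c_k>0$, $$\mathrm{st}(n,C_\ell)\ge\begin{cases} c_k\,n^{1+\frac{2}{6k-6}} & \text{if } \ell=4k-2,\\ c_k\,n^{1+\frac{2}{6k-2}} & \text{if } \ell=4k.\end{cases}$$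
   Context: Graphs are finite and simple; $C_\ell$ is the cycle on $\ell$ vertices. For a non-complete graph $G$ on $r$ vertices and $n\ge r$, $\mathrm{st}(n,G)$ is the largest $m$ for which there is a graph $H$ with $n$ vertices and $m$ edges such that no subgraph $F\subseteq H$ on exactly $r$ vertices contains $G$ as a proper subgraph (subgraphs are not necessarily induced). *)

theory Defs
  imports Complex_Main "HOL-Library.Landau_Symbols"
begin

type_synonym 'a ugraph = "'a set \<times> 'a set set"

abbreviation verts :: "'a ugraph \<Rightarrow> 'a set" where
  "verts G \<equiv> fst G"

abbreviation edges :: "'a ugraph \<Rightarrow> 'a set set" where
  "edges G \<equiv> snd G"

definition simple_graph :: "'a ugraph \<Rightarrow> bool" where
  "simple_graph G \<longleftrightarrow> finite (verts G) \<and> (\<forall>e\<in>edges G. e \<subseteq> verts G \<and> card e = 2)"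

definition subgraph :: "'a ugraph \<Rightarrow> 'a ugraph \<Rightarrow> bool" where
  "subgraph F H \<longleftrightarrow>
     simple_graph F \<and> simple_graph H \<and> verts F \<subseteq> verts H \<and> edges F \<subseteq> edges H"

definition proper_subgraph :: "'a ugraph \<Rightarrow> 'a ugraph \<Rightarrow> bool" where
  "proper_subgraph F H \<longleftrightarrow> subgraph F H \<and> F \<noteq> H"

definition graph_iso :: "'a ugraph \<Rightarrow> 'b ugraph \<Rightarrow> bool" where
  "graph_iso G H \<longleftrightarrow>
     (\<exists>f. bij_betw f (verts G) (verts H) \<and> edges H = (\<lambda>e. f ` e) ` edges G)"

definition contains_properly :: "'b ugraph \<Rightarrow> 'a ugraph \<Rightarrow> bool" where
  "contains_properly F G \<longleftrightarrow> (\<exists>G'. graph_iso G G' \<and> proper_subgraph G' F)"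

definition st_admissible :: "nat \<Rightarrow> 'a ugraph \<Rightarrow> nat ugraph \<Rightarrow> bool" where
  "st_admissible n G H \<longleftrightarrow>
     simple_graph H \<and> card (verts H) = n \<and>
     (\<forall>F. subgraph F H \<and> card (verts F) = card (verts G) \<longrightarrow> \<not> contains_properly F G)"

text \<open>Up to isomorphism every finite graph has vertices in \<open>nat\<close>.  The maximum is taken
  over a finite nonempty set (\<open>finite_st_set\<close>, \<open>st_set_nonempty\<close> below).  The definition is
  total; the values for complete \<open>G\<close> and for \<open>n < card (verts G)\<close> are of no interest.\<close>

definition st :: "nat \<Rightarrow> 'a ugraph \<Rightarrow> nat" where
  "st n G = Max {card (edges H) | H. st_admissible n G H}"

definition cycle_graph :: "nat \<Rightarrow> nat ugraph" where
  "cycle_graph l = ({..<l}, {{i, Suc i mod l} | i. i < l})"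

lemma card_edges_le:
  assumes "simple_graph H"
  shows "card (edges H) \<le> 2 ^ card (verts H)"
proof -
  have "edges H \<subseteq> Pow (verts H)" "finite (verts H)"
    using assms by (auto simp: simple_graph_def)
  then show ?thesis
    by (metis card_Pow card_mono finite_Pow_iff)
qed

lemma finite_st_set: "finite {card (edges H) | H. st_admissible n G H}"
  by (rule finite_subset[of _ "{..2 ^ n}"]) (auto simp: st_admissible_def dest: card_edges_le)

lemma st_admissible_edgeless: "st_admissible n G ({..<n}, {})"
proof -
  have "\<not> contains_properly F G"
    if F: "subgraph F ({..<n}, {})" "card (verts F) = card (verts G)" for F
  proof
    assume "contains_properly F G"
    then obtain G' where G': "graph_iso G G'" "proper_subgraph G' F"
      by (auto simp: contains_properly_def)
    have "card (verts G') = card (verts F)"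
      using G'(1) F(2) by (auto simp: graph_iso_def dest: bij_betw_same_card)
    moreover have "finite (verts F)" "verts G' \<subseteq> verts F" "edges G' \<subseteq> edges F" "edges F = {}"
      using G'(2) F(1) by (auto simp: proper_subgraph_def subgraph_def simple_graph_def)
    ultimately have "G' = F"
      by (simp add: card_subset_eq prod_eq_iff)
    then show False
      using G'(2) by (simp add: proper_subgraph_def)
  qed
  then show ?thesis
    by (auto simp: st_admissible_def simple_graph_def)
qed

lemma st_set_nonempty: "{card (edges H) | H. st_admissible n G H} \<noteq> {}"
  using st_admissible_edgeless by blast

lemma simple_graph_cycle_graph:
  assumes "l \<ge> 3"
  shows "simple_graph (cycle_graph l)"
proof -
  have "i \<noteq> Suc i mod l" if "i < l" for i
    using assms that by (cases "Suc i = l") auto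
  then show ?thesis
    using assms by (auto simp: simple_graph_def cycle_graph_def card_insert_if)
qed

end

theory Submission
  imports Defs "HOL-Algebra.Algebraic_Closure_Type" "HOL-Library.Z2"
begin

text \<open>
  An admissible graph for \<open>C\<^sub>l\<close> is a graph in which no cycle of length \<open>l\<close> has a chord. Write \<open>l = 4k\<close> or
  \<open>l = 4k - 2\<close>, so that \<open>k = \<lceil>l / 4\<rceil>\<close>.

  Upper bound. A graph with at least \<open>C n\<^bsup>1+1/k\<^esup>\<close> edges contains a chorded \<open>l\<close>-cycle
  (\<open>dense_imp_chorded_cycle\<close>). One may pass to a bipartite subgraph whose degrees lie between \<open>d\<close> and
  \<open>Kd\<close> and that has much fewer than \<open>d\<^bsup>k\<^esup>\<close> vertices (\<open>exists_almost_regular_subgraph\<close>). Its breadth-first levels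
  cannot all grow by a factor proportional to \<open>d\<close>, so there are two consecutive levels \<open>i\<close> and \<open>i + 1\<close>, \<open>1 \<le> i < k\<close>, with
  a dense bipartite graph between them. For the vertices of level \<open>i\<close>, being joined to a common
  vertex of level \<open>i + 1\<close> is related to their position in the breadth-first tree: after passing to a positive
  proportion of the edges, there is a height \<open>h\<close> such that the neighbours of a vertex have a common ancestor at height \<open>h\<close> and are
  spread over many of its children. Two paths between the levels, linked by tree paths through a tree vertex \<open>r\<close> and
  a child \<open>c\<close> of \<open>r\<close>, close up to a cycle with the chord \<open>rc\<close> (\<open>chorded_cycle_from_levels\<close>). As one of the paths may have any
  positive even length, all even lengths from \<open>4h + 2\<close> on occur, and \<open>4h + 2 \<le> 4k - 2\<close>.

  Lower bounds. A chord splits an \<open>l\<close>-cycle into two cycles of total length \<open>l + 2\<close>, so a graph without cycles of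
  length at most \<open>2j + 1\<close> is admissible when \<open>l \<le> 4j\<close> (\<open>large_girth_admissible\<close>). For \<open>l > 20\<close> a
  greedy construction provides \<open>n\<^bsup>1+1/(2k)\<^esup>\<close> edges (\<open>st_lower_bound_greedy\<close>), which exceeds the required order of
  magnitude. For \<open>l \<le> 20\<close> the incidence graphs of the affine parts of a projective plane, a generalized
  quadrangle and a generalized hexagon over a field with \<open>q = 2\<^bsup>m\<^esup>\<close> elements have \<open>2 q\<^bsup>s\<^esup>\<close> vertices and \<open>q\<^bsup>s+1\<^esup>\<close> edges for
  \<open>s = 2, 3, 5\<close>, and girth at least 6, 8, 12. The girth is verified in coordinates (\<open>no_incidence_cycle_inc2\<close>,
  \<open>no_incidence_cycle_inc3\<close>, \<open>no_incidence_cycle_inc5\<close>).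
\<close>

section \<open>Chorded cycles and admissible graphs\<close>

abbreviation adj :: "'a set set \<Rightarrow> 'a \<Rightarrow> 'a \<Rightarrow> bool" where
  "adj E u v \<equiv> {u, v} \<in> E"

text \<open>
  A cycle is the list of its vertices in cyclic order; repeating the head at the end takes care
  of the closing edge. A chorded cycle is a cycle \<open>r, as, c, bs\<close> together with the edge \<open>rc\<close>, which is
  a chord because \<open>as\<close> and \<open>bs\<close> are nonempty.
\<close>

definition is_cycle :: "'a set set \<Rightarrow> 'a list \<Rightarrow> bool" where
  "is_cycle E xs \<longleftrightarrow> 3 \<le> length xs \<and> distinct xs \<and> successively (adj E) (xs @ [hd xs])"

definition chorded_cycle :: "'a set set \<Rightarrow> nat \<Rightarrow> bool" where
  "chorded_cycle E l \<longleftrightarrow> (\<exists>r as c bs. length (r # as @ c # bs) = l \<and> distinct (r # as @ c # bs) \<and>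
     successively (adj E) (r # as @ c # bs @ [r]) \<and> as \<noteq> [] \<and> bs \<noteq> [] \<and> adj E r c)"

lemma successively_conv_nth:
  "successively P xs \<longleftrightarrow> (\<forall>i. Suc i < length xs \<longrightarrow> P (xs ! i) (xs ! Suc i))"
proof (induction xs)
  case (Cons x xs)
  show ?case
  proof (cases xs)
    case (Cons y ys)
    then show ?thesis using Cons.IH
      by (auto simp: successively_Cons nth_Cons split: nat.splits)
  qed auto
qed auto

lemma closed_walk_nth:
  assumes "successively P (xs @ [hd xs])" "i < length xs"
  shows "P (xs ! i) (xs ! (Suc i mod length xs))"
proof (cases "Suc i = length xs")
  case True
  have "P ((xs @ [hd xs]) ! i) ((xs @ [hd xs]) ! Suc i)"
    using assms unfolding successively_conv_nth by auto
  then show ?thesis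
    using True assms(2) by (cases "xs = []") (auto simp: nth_append hd_conv_nth)
next
  case False
  have "P ((xs @ [hd xs]) ! i) ((xs @ [hd xs]) ! Suc i)"
    using assms unfolding successively_conv_nth by auto
  then show ?thesis
    using False assms(2) by (auto simp: nth_append)
qed

text \<open>
  The cycle together with its chord is a subgraph on \<open>l\<close> vertices that properly contains \<open>C\<^sub>l\<close>.
\<close>

lemma admissible_not_chorded:
  assumes adm: "st_admissible n (cycle_graph l) H"
  shows "\<not> chorded_cycle (edges H) l"
proof
  assume "chorded_cycle (edges H) l"
  then obtain r as c bs where len: "length (r # as @ c # bs) = l"
    and dist: "distinct (r # as @ c # bs)"
    and succ: "successively (adj (edges H)) (r # as @ c # bs @ [r])"
    and ne: "as \<noteq> []" "bs \<noteq> []" and chord: "adj (edges H) r c"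
    unfolding chorded_cycle_def by blast
  define vs where "vs = r # as @ c # bs"
  define q where "q = Suc (length as)"
  have vs0: "vs ! 0 = r" "vs ! q = c" "hd vs = r"
    by (auto simp: vs_def q_def nth_append)
  have lvs: "length vs = l" "distinct vs" "l > 3"
    using len dist ne by (auto simp: vs_def Suc_le_eq neq_Nil_conv)
  have q: "1 < q" "q < l - 1"
    using ne lvs by (auto simp: q_def vs_def neq_Nil_conv)
  have edge: "{vs ! i, vs ! (Suc i mod l)} \<in> edges H" if "i < l" for i
    using closed_walk_nth[of "adj (edges H)" vs i] succ that lvs(1) by (auto simp: vs_def)
  have H: "simple_graph H" using adm by (simp add: st_admissible_def)
  define C where "C = {{vs ! i, vs ! (Suc i mod l)} |i. i < l}"
  have CH: "C \<subseteq> edges H" using edge by (auto simp: C_def)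
  have inj: "inj_on ((!) vs) {..<l}"
    using lvs by (auto simp: inj_on_def nth_eq_iff_index_eq)
  have im: "(!) vs ` {..<l} = set vs"
    using lvs by (auto simp: set_conv_nth)
  have sub: "set vs \<subseteq> verts H"
  proof
    fix x assume "x \<in> set vs"
    then obtain i where "i < l" "x = vs ! i" using im by auto
    then have "{x, vs ! (Suc i mod l)} \<in> edges H" using edge by auto
    then show "x \<in> verts H" using H by (auto simp: simple_graph_def)
  qed
  have Cin: "e \<subseteq> set vs" if "e \<in> C" for e
    using that lvs(1,3) by (auto simp: C_def intro!: nth_mem mod_less_divisor)
  define F where "F = (set vs, insert {r, c} C)"
  define G' where "G' = (set vs, C)"
  have sgF: "simple_graph F"
    using H CH chord Cin by (auto simp: simple_graph_def F_def vs_def)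
  have sgG: "simple_graph G'"
    using H CH Cin by (auto simp: simple_graph_def G'_def)
  have rc: "{r, c} \<notin> C"
  proof
    assume "{r, c} \<in> C"
    then obtain i where i: "i < l" "{r, c} = {vs ! i, vs ! (Suc i mod l)}" by (auto simp: C_def)
    then have "{0, q} = {i, Suc i mod l}"
    proof -
      have "(!) vs ` {0, q} = (!) vs ` {i, Suc i mod l}"
        using i(2) vs0 by simp
      then show ?thesis
        by (subst (asm) inj_on_image_eq_iff[OF inj]) (use q i lvs in auto)
    qed
    then show False using q i(1) by (cases "Suc i = l") (auto simp: doubleton_eq_iff)
  qed
  have "graph_iso (cycle_graph l) G'"
    unfolding graph_iso_def
  proof (intro exI conjI)
    show "bij_betw ((!) vs) (verts (cycle_graph l)) (verts G')"
      using inj im by (simp add: bij_betw_def cycle_graph_def G'_def)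
    show "edges G' = (\<lambda>e. (!) vs ` e) ` edges (cycle_graph l)"
      by (simp add: G'_def C_def cycle_graph_def setcompr_eq_image image_image)
  qed
  moreover have "proper_subgraph G' F"
    using sgF sgG rc by (auto simp: proper_subgraph_def subgraph_def F_def G'_def)
  ultimately have "contains_properly F (cycle_graph l)"
    unfolding contains_properly_def by blast
  moreover have "subgraph F H" "card (verts F) = card (verts (cycle_graph l))"
    using sgF H sub CH chord lvs by (auto simp: subgraph_def F_def cycle_graph_def distinct_card)
  ultimately show False using adm unfolding st_admissible_def by blast
qed

text \<open>
  Conversely, a subgraph on \<open>l\<close> vertices that properly contains \<open>C\<^sub>l\<close> has a further edge on the same
  vertices, and this chord splits the cycle into two cycles of total length \<open>l + 2\<close>. One of them has
  length at most \<open>(l + 2) / 2\<close>.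
\<close>

lemma large_girth_admissible:
  assumes H: "simple_graph H" "card (verts H) = n" and l: "l \<ge> 3"
    and girth: "\<And>xs. is_cycle (edges H) xs \<Longrightarrow> l + 2 < 2 * length xs"
  shows "st_admissible n (cycle_graph l) H"
  unfolding st_admissible_def
proof (intro conjI allI impI notI)
  fix F :: "nat ugraph"
  assume F: "subgraph F H \<and> card (verts F) = card (verts (cycle_graph l))"
    and "contains_properly F (cycle_graph l)"
  then obtain G' where iso: "graph_iso (cycle_graph l) G'" and psub: "proper_subgraph G' F"
    by (auto simp: contains_properly_def)
  obtain f where bij: "bij_betw f {..<l} (verts G')"
    and eG: "edges G' = (\<lambda>e. f ` e) ` edges (cycle_graph l)"
    using iso by (auto simp: graph_iso_def cycle_graph_def)
  have sF: "simple_graph F" "edges F \<subseteq> edges H" and cF: "card (verts F) = l"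
    using F by (auto simp: subgraph_def cycle_graph_def)
  have sG: "verts G' \<subseteq> verts F" "edges G' \<subseteq> edges F" "G' \<noteq> F"
    using psub by (auto simp: proper_subgraph_def subgraph_def)
  have "card (verts G') = l" using bij_betw_same_card[OF bij] by simp
  then have V: "verts G' = verts F"
    using sG(1) sF(1) cF by (auto simp: simple_graph_def card_subset_eq)
  then obtain e where e: "e \<in> edges F" "e \<notin> edges G'"
    using sG by (auto simp: prod_eq_iff)
  have "card e = 2" "e \<subseteq> verts G'" using sF(1) e(1) V by (auto simp: simple_graph_def)
  then obtain a b where ab: "e = {a, b}" "a \<noteq> b" by (auto simp: card_2_iff)
  then obtain i0 j0 where ij0: "i0 < l" "j0 < l" "a = f i0" "b = f j0"
    using \<open>e \<subseteq> verts G'\<close> bij unfolding bij_betw_def by (metis imageE insert_subset lessThan_iff)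
  obtain i j where ij: "i < j" "j < l" "e = {f i, f j}"
  proof (cases "i0 < j0")
    case True then show ?thesis using that[of i0 j0] ij0 ab by auto
  next
    case False
    then have "j0 < i0" using ij0 ab by (cases "i0 = j0") auto
    then show ?thesis using that[of j0 i0] ij0 ab by auto
  qed
  have cyc: "{f t, f (Suc t mod l)} \<in> edges G'" if "t < l" for t
    using that unfolding eG cycle_graph_def by (auto simp: image_iff)
  have cycS: "{f t, f (Suc t)} \<in> edges G'" if "Suc t < l" for t
    using cyc[of t] that by simp
  have cyc0: "{f (l - 1), f 0} \<in> edges G'"
    using cyc[of "l - 1"] l by simp
  have j1: "j \<noteq> Suc i" using cycS[of i] ij e by auto
  have j2: "\<not> (i = 0 \<and> j = l - 1)" using cyc0 ij e by (auto simp: insert_commute)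
  have inj: "inj_on f {..<l}" using bij by (auto simp: bij_betw_def)
  have GH: "edges G' \<subseteq> edges H" using sG sF by auto
  have eH: "{f i, f j} \<in> edges H" "{f j, f i} \<in> edges H"
    using e ij sF by (auto simp: insert_commute)
  have up: "successively (adj (edges H)) (map f [s..<t])" if "t \<le> l" for s t
    using that cycS GH by (auto simp: successively_conv_nth)
  \<comment> \<open>The two cycles have \<open>j - i + 1\<close> and \<open>l - j + i + 1\<close> vertices.\<close>
  have c1: "is_cycle (edges H) (map f [i..<Suc j])"
    unfolding is_cycle_def
  proof (intro conjI)
    have "inj_on f (set [i..<Suc j])"
      by (rule inj_on_subset[OF inj]) (use ij in auto)
    then show "distinct (map f [i..<Suc j])"
      by (simp add: distinct_map del: upt_Suc)
    have hl: "hd (map f [i..<Suc j]) = f i" "last (map f [i..<Suc j]) = f j"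
      using ij by (auto simp: hd_map last_map)
    show "successively (adj (edges H)) (map f [i..<Suc j] @ [hd (map f [i..<Suc j])])"
      unfolding hl(1) using up[of "Suc j" i] ij eH hl(2)
      by (auto simp: successively_append_iff simp del: upt_Suc)
  qed (use ij j1 in auto)
  have c2: "is_cycle (edges H) (map f [j..<l] @ map f [0..<Suc i])"
    unfolding is_cycle_def
  proof (intro conjI)
    have "inj_on f (set ([j..<l] @ [0..<Suc i]))"
      by (rule inj_on_subset[OF inj]) (use ij in auto)
    moreover have "distinct ([j..<l] @ [0..<Suc i])"
      using ij by auto
    ultimately show "distinct (map f [j..<l] @ map f [0..<Suc i])"
      by (simp only: distinct_map flip: map_append)
    have hl: "hd (map f [j..<l] @ map f [0..<Suc i]) = f j" "last (map f [0..<Suc i]) = f i"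
      "last (map f [j..<l]) = f (l - 1)" "hd (map f [0..<Suc i]) = f 0"
      using ij by (auto simp: hd_map last_map hd_append)
    show "successively (adj (edges H)) ((map f [j..<l] @ map f [0..<Suc i]) @
        [hd (map f [j..<l] @ map f [0..<Suc i])])"
      unfolding hl(1) using up[of l j] up[of "Suc i" 0] ij eH hl cyc0 GH
      by (auto simp: successively_append_iff simp del: upt_Suc)
  qed (use ij j1 j2 in \<open>auto\<close>)
  show False
    using girth[OF c1] girth[OF c2] ij by auto
qed (use H in auto)

lemma st_geI:
  assumes "st_admissible n G H"
  shows "card (edges H) \<le> st n G"
  unfolding st_def by (rule Max_ge[OF finite_st_set]) (use assms in blast)

lemma st_attained:
  obtains H where "st_admissible n G H" "card (edges H) = st n G"
  using Max_in[OF finite_st_set st_set_nonempty, of n G] that unfolding st_def by auto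

section \<open>Chorded cycles through a tree\<close>

text \<open>
  In a tree given by a parent map \<open>par\<close>, \<open>anc par j v\<close> is the ancestor of \<open>v\<close> that lies \<open>j\<close> levels
  above it, and \<open>chain par m v\<close> is the path of \<open>m\<close> vertices that starts in \<open>v\<close> and goes up.
\<close>

abbreviation anc :: "('a \<Rightarrow> 'a) \<Rightarrow> nat \<Rightarrow> 'a \<Rightarrow> 'a" where
  "anc par j v \<equiv> (par ^^ j) v"

definition chain :: "('a \<Rightarrow> 'a) \<Rightarrow> nat \<Rightarrow> 'a \<Rightarrow> 'a list" where
  "chain par m v = map (\<lambda>j. anc par j v) [0..<m]"

lemma chain_Suc: "chain par (Suc m) v = chain par m v @ [anc par m v]"
  by (simp add: chain_def)

lemma length_chain [simp]: "length (chain par m v) = m"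
  by (simp add: chain_def)

lemma hd_chain: "m > 0 \<Longrightarrow> hd (chain par m v) = v"
  by (simp add: chain_def hd_map upt_conv_Cons)

lemma set_chain: "set (chain par m v) = (\<lambda>j. anc par j v) ` {..<m}"
  by (auto simp: chain_def)

text \<open>
  The vertices of level \<open>V i\<close> are the leaves of a tree with parent map \<open>par\<close>, and \<open>P\<close> is a set of edges
  \<open>(v, y)\<close> between the leaves and the next level. All \<open>P\<close>-neighbours of \<open>y\<close> have the same ancestor at
  height \<open>h\<close>, and less than a quarter of them lie below any one child of this ancestor. Hence a walk along
  \<open>P\<close> stays below one tree vertex \<open>r\<close>, and each time it comes back to a leaf it can avoid two prescribed
  children of \<open>r\<close>.

  The chorded cycle is built as follows. Let \<open>c\<close> be the child of \<open>r\<close> above some leaf \<open>v\<^sub>p\<close>. The cycle goes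
  from \<open>r\<close> down to a leaf \<open>v\<^sub>0\<close> not below \<open>c\<close>, in two \<open>P\<close>-steps to \<open>v\<^sub>p\<close>, up to \<open>c\<close>, down to a leaf \<open>v\<^sub>q\<close> below
  another child of \<open>c\<close>, along \<open>P\<close> to a leaf \<open>v\<^sub>e\<close> that is neither below \<open>c\<close> nor below the child of \<open>r\<close>
  above \<open>v\<^sub>0\<close>, and up to \<open>r\<close>. The tree edge \<open>rc\<close> is a chord. The tree edges and the two steps to
  \<open>v\<^sub>p\<close> make up \<open>4h\<close> edges, and the length of the walk from \<open>v\<^sub>q\<close> to \<open>v\<^sub>e\<close> is any positive even number, which gives
  every even length \<open>l \<ge> 4h + 2\<close>. If \<open>h = 1\<close>, then \<open>c\<close> itself is a leaf and \<open>c = v\<^sub>p = v\<^sub>q\<close>.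
\<close>

lemma chorded_cycle_from_levels:
  fixes E :: "'a set set" and V :: "nat \<Rightarrow> 'a set" and par :: "'a \<Rightarrow> 'a" and P :: "('a \<times> 'a) set"
  assumes disj: "\<And>a b x. x \<in> V a \<Longrightarrow> x \<in> V b \<Longrightarrow> a = b"
    and par: "\<And>j x. x \<in> V (Suc j) \<Longrightarrow> j < i \<Longrightarrow> par x \<in> V j \<and> {x, par x} \<in> E"
    and h: "1 \<le> h" "h \<le> i"
    and P: "finite P" "P \<noteq> {}" "\<And>v y. (v, y) \<in> P \<Longrightarrow> v \<in> V i \<and> y \<in> V (Suc i) \<and> {v, y} \<in> E"
    and same: "\<And>v v' y. (v, y) \<in> P \<Longrightarrow> (v', y) \<in> P \<Longrightarrow> anc par h v = anc par h v'"
    and spread: "\<And>v y c. (v, y) \<in> P \<Longrightarrow>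
      4 * card {v'. (v', y) \<in> P \<and> anc par (h - 1) v' = c} < card {v'. (v', y) \<in> P}"
    and big: "\<And>v y. (v, y) \<in> P \<Longrightarrow> 2 * l < card {v'. (v', y) \<in> P}"
    and deg: "\<And>v y. (v, y) \<in> P \<Longrightarrow> l < card {y'. (v, y') \<in> P}"
    and branch: "\<And>v y. (v, y) \<in> P \<Longrightarrow> 2 \<le> h \<Longrightarrow>
      \<exists>v' y'. (v', y') \<in> P \<and> anc par (h - 1) v' = anc par (h - 1) v \<and> anc par (h - 2) v' \<noteq> anc par (h - 2) v"
    and l: "even l" "4 * h + 2 \<le> l"
  shows "chorded_cycle E l"
proof -
  define D where "D = fst ` P"
  have DV: "v \<in> V i" if "v \<in> D" for v
    using that P(3) by (auto simp: D_def)
  have ancV: "anc par j v \<in> V (i - j)" if "v \<in> V i" "j \<le> i" for v j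
    using that(2)
  proof (induction j)
    case (Suc j)
    then have "anc par j v \<in> V (Suc (i - Suc j))"
      by (simp add: Suc_diff_Suc)
    from par[OF this] Suc.prems show ?case by simp
  qed (use that in simp)
  have anc_adj: "{anc par j v, anc par (Suc j) v} \<in> E" if "v \<in> V i" "j < i" for v j
  proof -
    have "anc par j v \<in> V (Suc (i - Suc j))"
      using ancV[of v j] that by (simp add: Suc_diff_Suc)
    from par[OF this] that show ?thesis by simp
  qed
  have anc_inj: "j = j'" if "anc par j v = anc par j' w" "v \<in> V i" "w \<in> V i" "j \<le> i" "j' \<le> i" for v w j j'
    using disj[of "anc par j v" "i - j" "i - j'"] ancV[of v j] ancV[of w j'] that by auto
  have succ_chain: "successively (adj E) (chain par m v)" if "v \<in> V i" "m \<le> Suc i" for v m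
    using that anc_adj by (auto simp: successively_conv_nth chain_def)
  have dist_chain: "distinct (chain par m v)" if "v \<in> V i" "m \<le> Suc i" for v m
    using that anc_inj by (fastforce simp: chain_def distinct_map inj_on_def)
  have disj_chain: "set (chain par m v) \<inter> set (chain par m' w) = {}"
    if vw: "v \<in> V i" "w \<in> V i" "m \<le> Suc t" "m' \<le> Suc t" "t \<le> i" and ne: "anc par t v \<noteq> anc par t w" for v w m m' t
  proof (rule ccontr)
    assume "\<not> ?thesis"
    then obtain j j' where jj: "anc par j v = anc par j' w" "j < m" "j' < m'"
      by (auto simp: set_chain)
    then have "j = j'" using anc_inj[OF jj(1)] vw by auto
    then have "(par ^^ (t - j)) (anc par j v) = (par ^^ (t - j)) (anc par j w)" using jj by simp
    moreover have "(par ^^ (t - j)) (anc par j x) = anc par t x" for x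
      using jj vw funpow_add[of "t - j" j par] by simp
    ultimately have "anc par t v = anc par t w" by simp
    then show False using ne by simp
  qed
  have chain_V: "x \<in> V i \<Longrightarrow> x = v" "x \<notin> V (Suc i)" if xv: "v \<in> V i" "m \<le> Suc i" "x \<in> set (chain par m v)" for x v m
  proof -
    obtain j where j: "x = anc par j v" "j < m" using xv by (auto simp: set_chain)
    have "x \<in> V (i - j)" using ancV[of v j] j xv by auto
    then show "x \<in> V i \<Longrightarrow> x = v" using disj[of x i "i - j"] j xv by (cases "j = 0") auto
    show "x \<notin> V (Suc i)" using disj[of x "Suc i" "i - j"] \<open>x \<in> V (i - j)\<close> by auto
  qed
  have finN: "finite {v'. (v', y) \<in> P}" for y
    by (rule finite_subset[of _ "fst ` P"]) (use P(1) in force)+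
  \<comment> \<open>A walk of \<open>2 s\<close> steps that avoids \<open>W\<close> and ends below neither of the children \<open>c\<close>, \<open>c'\<close> of \<open>r\<close>.\<close>
  have walk: "\<exists>ws. length ws = 2 * s \<and> successively (adj E) (v # ws) \<and> distinct ws \<and> set ws \<inter> W = {} \<and>
        set ws \<subseteq> V i \<union> V (Suc i) \<and> last (v # ws) \<in> D \<and> anc par h (last (v # ws)) = anc par h v \<and>
        (s > 0 \<longrightarrow> anc par (h - 1) (last ws) \<noteq> c \<and> anc par (h - 1) (last ws) \<noteq> c')"
    if "v \<in> D" "finite W" "card W + 2 * s \<le> l" for v W s c c'
    using that(3)
  proof (induction s)
    case 0
    then show ?case using that by (intro exI[of _ "[]"]) auto
  next
    case (Suc s)
    then obtain ws where ws: "length ws = 2 * s" "successively (adj E) (v # ws)" "distinct ws" "set ws \<inter> W = {}"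
        "set ws \<subseteq> V i \<union> V (Suc i)" "last (v # ws) \<in> D" "anc par h (last (v # ws)) = anc par h v"
      by auto
    define u where "u = last (v # ws)"
    define Z where "Z = W \<union> set ws"
    have Z: "finite Z" "card Z + 2 \<le> l"
      using that ws Suc.prems card_Un_le[of W "set ws"] by (auto simp: Z_def distinct_card)
    obtain y0 where "(u, y0) \<in> P" using ws(6) unfolding u_def[symmetric] D_def by auto
    then have "\<not> {y'. (u, y') \<in> P} \<subseteq> Z"
      using deg[of u y0] card_mono[OF Z(1), of "{y'. (u, y') \<in> P}"] Z(2) by linarith
    then obtain y where y: "(u, y) \<in> P" "y \<notin> Z" by auto
    let ?N = "{v'. (v', y) \<in> P}"
    let ?C = "\<lambda>c. {v'. (v', y) \<in> P \<and> anc par (h - 1) v' = c}"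
    have "\<not> ?N \<subseteq> Z \<union> ?C c \<union> ?C c'"
    proof
      assume "?N \<subseteq> Z \<union> ?C c \<union> ?C c'"
      then have "card ?N \<le> card (Z \<union> ?C c \<union> ?C c')"
        using Z finN[of y] by (intro card_mono) (auto intro: finite_subset[OF _ finN[of y]])
      also have "\<dots> \<le> card Z + card (?C c) + card (?C c')"
        using card_Un_le[of "Z \<union> ?C c" "?C c'"] card_Un_le[of Z "?C c"] by linarith
      finally show False
        using spread[OF y(1), of c] spread[OF y(1), of c'] big[OF y(1)] Z(2) by linarith
    qed
    then obtain v' where v': "(v', y) \<in> P" "v' \<notin> Z" "anc par (h - 1) v' \<noteq> c" "anc par (h - 1) v' \<noteq> c'" by auto
    have "v' \<noteq> y" using P(3)[OF v'(1)] disj[of y i "Suc i"] by auto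
    have edges: "{u, y} \<in> E" "{y, v'} \<in> E" using P(3)[OF y(1)] P(3)[OF v'(1)] by (auto simp: insert_commute)
    have "successively (adj E) ((v # ws) @ [y, v'])"
      using ws(2) edges by (simp only: successively_append_iff) (simp add: u_def)
    moreover have "anc par h v' = anc par h v"
      using same[OF v'(1) y(1)] ws(7) by (simp add: u_def)
    ultimately show ?case
      using ws P(3)[OF y(1)] P(3)[OF v'(1)] y v' \<open>v' \<noteq> y\<close>
      by (intro exI[of _ "ws @ [y, v']"]) (auto simp: Z_def D_def rev_image_eqI)
  qed
  obtain vp yp where "(vp, yp) \<in> P" using P(2) by auto
  define c where "c = anc par (h - 1) vp"
  define r where "r = anc par h vp"
  have vpD: "vp \<in> D" "vp \<in> V i" using \<open>(vp, yp) \<in> P\<close> P(3) by (auto simp: D_def rev_image_eqI)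
  have h1: "Suc (h - 1) = h" using h by simp
  have chain_h: "chain par h v = chain par (h - 1) v @ [anc par (h - 1) v]" for v
    using chain_Suc[of par "h - 1" v] unfolding h1 .
  have rc: "{c, r} \<in> E" using anc_adj[of vp "h - 1"] vpD h by (simp add: c_def r_def h1)
  obtain vq where vq: "vq \<in> D" "vq \<in> V i" "anc par (h - 1) vq = c" "h = 1 \<Longrightarrow> vq = vp"
    "h \<ge> 2 \<Longrightarrow> anc par (h - 2) vp \<noteq> anc par (h - 2) vq"
  proof (cases "h \<ge> 2")
    case True
    then obtain v' y' where "(v', y') \<in> P" "anc par (h - 1) v' = c" "anc par (h - 2) v' \<noteq> anc par (h - 2) vp"
      using branch[OF \<open>(vp, yp) \<in> P\<close>] unfolding c_def by blast
    then show ?thesis using True P(3) that[of v'] by (force simp: D_def rev_image_eqI)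
  next
    case False
    then show ?thesis using that[of vp] vpD h by (auto simp: c_def)
  qed
  have rvq: "anc par h vq = r"
  proof -
    have "anc par h x = par (anc par (h - 1) x)" for x by (subst h1[symmetric]) simp
    then show ?thesis using vq(3) by (simp add: r_def c_def)
  qed
  obtain ws0 where ws0: "length ws0 = 2 * 1" "successively (adj E) (vp # ws0)" "distinct ws0" "set ws0 \<inter> {vp, vq} = {}"
     "set ws0 \<subseteq> V i \<union> V (Suc i)" "last (vp # ws0) \<in> D" "anc par h (last (vp # ws0)) = r"
     "anc par (h - 1) (last ws0) \<noteq> c"
  proof -
    have "card {vp, vq} + 2 * 1 \<le> l" using l h by (simp add: card_insert_if)
    from walk[OF vpD(1) _ this, of c c] show ?thesis using that unfolding r_def by auto
  qed
  then obtain y1 v0 where y1: "ws0 = [y1, v0]"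
    by (auto simp: numeral_2_eq_2 length_Suc_conv)
  define c0 where "c0 = anc par (h - 1) v0"
  have v0: "v0 \<in> V i" "y1 \<noteq> v0" "v0 \<noteq> vp" "v0 \<noteq> vq" "anc par h v0 = r" "c0 \<noteq> c" "{vp, y1} \<in> E" "{y1, v0} \<in> E"
    "y1 \<noteq> vp" "y1 \<noteq> vq" "y1 \<in> V i \<union> V (Suc i)"
    using ws0 DV by (auto simp: y1 c0_def)
  define s where "s = (l - 4 * h) div 2"
  have s: "s > 0" "2 * s = l - 4 * h" "4 * h + 2 * s = l" using l by (auto simp: s_def)
  have cX: "card {vp, vq, y1, v0} \<le> 4" by (auto simp: card_insert_if)
  obtain ws where ws: "length ws = 2 * s" "successively (adj E) (vq # ws)" "distinct ws"
     "set ws \<inter> {vp, vq, y1, v0} = {}" "set ws \<subseteq> V i \<union> V (Suc i)" "last (vq # ws) \<in> D"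
     "anc par h (last (vq # ws)) = r" "anc par (h - 1) (last ws) \<noteq> c" "anc par (h - 1) (last ws) \<noteq> c0"
  proof -
    have "card {vp, vq, y1, v0} + 2 * s \<le> l" using cX s h by linarith
    from walk[OF vq(1) _ this, of c c0] show ?thesis using that s(1) rvq by auto
  qed
  define ve where "ve = last ws"
  define zs where "zs = butlast ws"
  have "ws \<noteq> []" using ws(1) s by auto
  then have wsz: "ws = zs @ [ve]" by (simp add: ve_def zs_def)
  have ve: "ve \<in> V i" "anc par h ve = r" "anc par (h - 1) ve \<noteq> c" "anc par (h - 1) ve \<noteq> c0"
    using ws(6-9) DV by (auto simp: wsz)
  \<comment> \<open>\<open>U\<close> is the tree path from \<open>vp\<close> through \<open>c\<close> to \<open>vq\<close>; for \<open>h = 1\<close> it is the single vertex \<open>c\<close>.\<close>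
  define U where "U = chain par h vp @ rev (chain par (h - 1) vq)"
  have Uc: "U = chain par (h - 1) vp @ c # rev (chain par (h - 1) vq)"
    unfolding U_def c_def chain_h[of vp] by simp
  have disjU: "set (chain par h vp) \<inter> set (chain par (h - 1) vq) = {}"
  proof (cases "h \<ge> 2")
    case True
    have "set (chain par (h - 1) vp) \<inter> set (chain par (h - 1) vq) = {}"
      using disj_chain[of vp vq "h - 1" "h - 2" "h - 1"] vpD vq h True by auto
    moreover have "c \<notin> set (chain par (h - 1) vq)"
      using anc_inj[of "h - 1" vq _ vq] vq(2,3) h by (fastforce simp: set_chain)
    ultimately show ?thesis
      unfolding chain_h[of vp] c_def by auto
  next
    case False
    then show ?thesis using h by (simp add: chain_def)
  qed
  have dU: "distinct U"
    using dist_chain[of vp h] dist_chain[of vq "h - 1"] vpD vq(2) h disjU by (auto simp: U_def)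
  have U1: "U \<noteq> []" "hd U = vp" "last U = vq" "successively (adj E) U"
  proof -
    show "U \<noteq> []" by (simp add: Uc)
    have c0: "chain par h x \<noteq> []" for x using h by (simp add: chain_def)
    show "hd U = vp" using c0 h by (simp add: U_def hd_append hd_chain)
    show "last U = vq"
    proof (cases "h \<ge> 2")
      case True
      then have "chain par (h - 1) vq \<noteq> []" by (simp add: chain_def)
      then show ?thesis using True by (simp add: U_def last_append last_rev hd_chain)
    next
      case False
      then have "h = 1" using h by simp
      then show ?thesis using vq(4) by (simp add: U_def chain_def)
    qed
    have "successively (adj E) (rev (chain par h vq))"
      using succ_chain[of vq h] vq(2) h by (auto simp: insert_commute)
    moreover have "rev (chain par h vq) = c # rev (chain par (h - 1) vq)"
      unfolding chain_h[of vq] vq(3) by simp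
    ultimately have "successively (adj E) (c # rev (chain par (h - 1) vq))" by simp
    moreover have "successively (adj E) (chain par (h - 1) vp @ [c])"
      using succ_chain[of vp h] vpD h unfolding chain_h[of vp] c_def by simp
    ultimately show "successively (adj E) U"
      unfolding Uc by (auto simp: successively_append_iff)
  qed
  have setU: "x \<in> set (chain par h vp) \<or> x \<in> set (chain par h vq)" if "x \<in> set U" for x
    using that unfolding U_def chain_h[of vq] by auto
  have Uend: "set U \<inter> set (chain par h v) = {}" if "v \<in> V i" "anc par (h - 1) v \<noteq> c" for v
    using disj_chain[of vp v h "h - 1" h] disj_chain[of vq v h "h - 1" h] that vpD vq(2,3) h setU
    by (force simp: c_def)
  have rnot: "r \<notin> set (chain par h v)" if "v \<in> V i" "anc par h v = r" for v
    using anc_inj[of h v _ v] that h by (fastforce simp: set_chain)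
  have rU: "r \<notin> set U" using rnot[OF vpD(2) r_def[symmetric]] rnot[OF vq(2) rvq] setU by auto
  have low: "x \<in> V i \<Longrightarrow> x = v" "x \<notin> V (Suc i)" if "x \<in> set (chain par h v)" "v \<in> V i" for x v
    using chain_V[of v h x] that h by auto
  have rlow: "r \<notin> V i" "r \<notin> V (Suc i)"
    using ancV[of vp h] vpD h disj[of r "i - h" i] disj[of r "i - h" "Suc i"] by (auto simp: r_def)
  have c00: "anc par (h - 1) ve \<noteq> anc par (h - 1) v0" using ve by (simp add: c0_def)
  have d1: "set (chain par h v0) \<inter> set (chain par h ve) = {}"
    using disj_chain[of v0 ve h "h - 1" h] v0 ve c00 h by auto
  define vs where "vs = r # rev (chain par h v0) @ [y1] @ U @ zs @ chain par h ve"
  have zsV: "set zs \<subseteq> V i \<union> V (Suc i)" "distinct zs" "ve \<notin> set zs" "set zs \<inter> {vp, vq, y1, v0} = {}"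
    "ve \<notin> {vp, vq, y1, v0}"
    using ws(3-5) by (auto simp: wsz)
  have avoid: "S \<inter> set (chain par h v) = {}" if "v \<in> V i" "v \<notin> S" "S \<subseteq> V i \<union> V (Suc i)" for v S
    using low that by blast
  have avoidU: "S \<inter> set U = {}" if "vp \<notin> S" "vq \<notin> S" "S \<subseteq> V i \<union> V (Suc i)" for S
    using avoid[OF vpD(2) that(1,3)] avoid[OF vq(2) that(2,3)] setU by blast
  have dist: "distinct vs"
  proof -
    have "y1 \<notin> set (chain par h v0)" "y1 \<notin> set (chain par h ve)" "y1 \<notin> set U"
      using avoid[of v0 "{y1}"] avoid[of ve "{y1}"] avoidU[of "{y1}"] v0 ve(1) zsV(5) by auto
    moreover have "set zs \<inter> set (chain par h v0) = {}" "set zs \<inter> set (chain par h ve) = {}" "set zs \<inter> set U = {}"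
      using avoid[of v0 "set zs"] avoid[of ve "set zs"] avoidU[of "set zs"] v0(1) ve(1) zsV(1,3,4) by auto
    moreover have "y1 \<notin> set zs" "r \<notin> set zs" "r \<noteq> y1" using zsV rlow v0 by auto
    moreover have "set U \<inter> set (chain par h v0) = {}" "set U \<inter> set (chain par h ve) = {}"
      using Uend v0 ve by (auto simp: c0_def)
    moreover have "r \<notin> set (chain par h v0)" "r \<notin> set (chain par h ve)"
      using rnot v0 ve by auto
    moreover have "distinct (chain par h v0)" "distinct (chain par h ve)"
      using dist_chain v0 ve h by auto
    ultimately show ?thesis
      using d1 dU rU zsV(2) by (auto simp: vs_def)
  qed
  have lenU: "length U = h + (h - 1)" by (simp add: U_def)
  have "length zs = 2 * s - 1" using ws(1) by (simp add: zs_def)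
  then have len: "length vs = l"
    using s h by (simp add: vs_def lenU)
  have ch1: "chain par (Suc h) v0 = chain par h v0 @ [r]" "chain par (Suc h) ve = chain par h ve @ [r]"
    using v0 ve by (simp_all add: chain_Suc)
  have chne: "chain par h x \<noteq> []" "hd (chain par h x) = x" for x using h by (auto simp: chain_def hd_map)
  have "successively (adj E) (rev (chain par (Suc h) v0))" "successively (adj E) (chain par (Suc h) ve)"
    using succ_chain[of v0 "Suc h"] succ_chain[of ve "Suc h"] v0 ve h by (auto simp: insert_commute)
  then have "successively (adj E) (r # rev (chain par h v0))" "successively (adj E) (chain par h ve @ [r])"
    by (simp_all add: ch1)
  moreover have "successively (adj E) (zs @ chain par h ve @ [r])" "adj E vq (hd (zs @ chain par h ve @ [r]))"
    using ws(2) calculation(2) chne by (auto simp: wsz successively_append_iff successively_Cons hd_append split: if_splits)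
  moreover have "last (rev (chain par h v0)) = v0" using chne by (simp add: last_rev)
  ultimately have succ: "successively (adj E) (vs @ [r])"
    using U1 v0 chne by (auto simp: vs_def successively_append_iff successively_Cons insert_commute)
  have "\<exists>as bs. vs = r # as @ c # bs \<and> as \<noteq> [] \<and> bs \<noteq> []"
    by (rule exI[of _ "rev (chain par h v0) @ [y1] @ chain par (h - 1) vp"],
        rule exI[of _ "rev (chain par (h - 1) vq) @ zs @ chain par h ve"])
      (use chne in \<open>auto simp: vs_def Uc\<close>)
  then obtain as bs where "vs = r # as @ c # bs" "as \<noteq> []" "bs \<noteq> []" by blast
  then show ?thesis
    unfolding chorded_cycle_def using len dist succ rc
    by (intro exI[of _ r] exI[of _ as] exI[of _ c] exI[of _ bs]) (auto simp: insert_commute)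
qed

section \<open>Pruning and almost regular subgraphs\<close>

text \<open>
  A pruning principle: each \<open>x \<in> I\<close> demands that \<open>S x\<close> meets the set of survivors in more than \<open>b x\<close>
  elements or not at all. Deleting \<open>S x\<close> when the demand fails costs at most \<open>b x\<close> elements and settles \<open>x\<close>
  for good, so less than the whole of \<open>E\<close> is lost in total.
\<close>

lemma exists_pruned_subset:
  fixes b :: "'i \<Rightarrow> real" and S :: "'i \<Rightarrow> 'e set"
  assumes "finite I" "finite E" "(\<Sum>x\<in>I. b x) < real (card E)" "\<And>x. x \<in> I \<Longrightarrow> 0 \<le> b x"
  shows "\<exists>E'\<subseteq>E. E' \<noteq> {} \<and> (\<forall>x\<in>I. E' \<inter> S x = {} \<or> b x < real (card (E' \<inter> S x)))"
  using assms
proof (induction I arbitrary: E rule: finite_psubset_induct)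
  case (psubset I)
  show ?case
  proof (cases "\<forall>x\<in>I. E \<inter> S x = {} \<or> b x < real (card (E \<inter> S x))")
    case True
    have "0 \<le> (\<Sum>x\<in>I. b x)" using psubset.prems by (intro sum_nonneg) auto
    then have "E \<noteq> {}" using psubset.prems(2) by auto
    then show ?thesis using True by auto
  next
    case False
    then obtain x where x: "x \<in> I" "real (card (E \<inter> S x)) \<le> b x" by force
    have "card (E - S x) + card (E \<inter> S x) = card E"
      using psubset.prems(1) by (subst card_Un_disjoint[symmetric]) (auto intro!: arg_cong[where f = card])
    moreover have "(\<Sum>y\<in>I. b y) = b x + (\<Sum>y\<in>I - {x}. b y)"
      using x psubset.hyps by (simp add: sum.remove)
    ultimately have "(\<Sum>y\<in>I - {x}. b y) < real (card (E - S x))"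
      using x(2) psubset.prems(2) by linarith
    then obtain E' where E': "E' \<subseteq> E - S x" "E' \<noteq> {}"
      "\<forall>y\<in>I - {x}. E' \<inter> S y = {} \<or> b y < real (card (E' \<inter> S y))"
      using psubset.IH[of "I - {x}" "E - S x"] x psubset.prems by auto
    then have "E' \<inter> S x = {}" by auto
    then show ?thesis using E' by (intro exI[of _ E']) auto
  qed
qed

text \<open>
  The edges with exactly one end in \<open>W\<close> form a bipartite graph. In the induction step, one of the two sides for the
  new vertex keeps at least half of its edges.
\<close>

lemma exists_large_cut:
  assumes "finite V" "\<And>e. e \<in> E \<Longrightarrow> e \<subseteq> V \<and> card e = 2"
  shows "\<exists>W. card E \<le> 2 * card {e \<in> E. card (e \<inter> W) = 1}"
  using assms
proof (induction V arbitrary: E rule: finite_induct)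
  case empty
  then have "E = {}" by force
  then show ?case by simp
next
  case (insert v V)
  have fE: "finite E" using insert.prems insert.hyps by (intro finite_subset[of E "Pow (insert v V)"]) auto
  define E0 where "E0 = {e \<in> E. v \<notin> e}"
  define Ev where "Ev = {e \<in> E. v \<in> e}"
  have E: "E = E0 \<union> Ev" "E0 \<inter> Ev = {}" by (auto simp: E0_def Ev_def)
  have fin: "finite E0" "finite Ev" using fE by (auto simp: E0_def Ev_def)
  obtain W0 where W0: "card E0 \<le> 2 * card {e \<in> E0. card (e \<inter> W0) = 1}"
    using insert.IH[of E0] insert.prems by (force simp: E0_def)
  define W where "W = W0 - {v}"
  have W: "{e \<in> E0. card (e \<inter> W0) = 1} = {e \<in> E0. card (e \<inter> W) = 1}"
     "{e \<in> E0. card (e \<inter> W0) = 1} = {e \<in> E0. card (e \<inter> insert v W) = 1}"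
  proof -
    have "e \<inter> W0 = e \<inter> W" "e \<inter> insert v W = e \<inter> W" if "e \<in> E0" for e
      using that by (auto simp: E0_def W_def)
    then show "{e \<in> E0. card (e \<inter> W0) = 1} = {e \<in> E0. card (e \<inter> W) = 1}"
     "{e \<in> E0. card (e \<inter> W0) = 1} = {e \<in> E0. card (e \<inter> insert v W) = 1}" by auto
  qed
  have split: "card {e \<in> E. card (e \<inter> Y) = 1} = card {e \<in> E0. card (e \<inter> Y) = 1} + card {e \<in> Ev. card (e \<inter> Y) = 1}" for Y
    using fin E by (subst card_Un_disjoint[symmetric]) (auto intro!: arg_cong[where f = card])
  have "Ev \<subseteq> {e \<in> Ev. card (e \<inter> W) = 1} \<union> {e \<in> Ev. card (e \<inter> insert v W) = 1}"
  proof
    fix e assume e: "e \<in> Ev"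
    then have "card e = 2" using insert.prems by (auto simp: Ev_def)
    then obtain w where w: "e = {v, w}" "w \<noteq> v"
      using e by (auto simp: Ev_def card_2_iff doubleton_eq_iff)
    have "v \<notin> W" by (simp add: W_def)
    then show "e \<in> {e \<in> Ev. card (e \<inter> W) = 1} \<union> {e \<in> Ev. card (e \<inter> insert v W) = 1}"
      using e w by (cases "w \<in> W") (auto simp: Int_insert_left)
  qed
  then have "card Ev \<le> card ({e \<in> Ev. card (e \<inter> W) = 1} \<union> {e \<in> Ev. card (e \<inter> insert v W) = 1})"
    using fin by (intro card_mono) auto
  then have "card Ev \<le> card {e \<in> Ev. card (e \<inter> W) = 1} + card {e \<in> Ev. card (e \<inter> insert v W) = 1}"
    using card_Un_le order_trans by blast
  moreover have "card E = card E0 + card Ev" using E fin by (simp add: card_Un_disjoint)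
  ultimately have "card E \<le> 2 * card {e \<in> E. card (e \<inter> W) = 1} \<or> card E \<le> 2 * card {e \<in> E. card (e \<inter> insert v W) = 1}"
    using W0[unfolded W(1)] W0[unfolded W(2)] split[of W] split[of "insert v W"] by linarith
  then show ?case by blast
qed

text \<open>
  A variant of the regularization lemma of Erdos and Simonovits. Let \<open>S\<close> maximise \<open>e(S) / |S|\<^bsup>1+1/k\<^esup>\<close>. Then all
  subsets of \<open>S\<close> are at most as dense as \<open>S\<close> in this sense. This limits the number of edges that touch
  the set \<open>B\<close> of vertices of very large degree: cover \<open>S\<close> by at most \<open>2 |S| / |B|\<close> sets of size at most \<open>|B|\<close>; each
  of them spans few edges together with \<open>B\<close>. So \<open>B\<close> may be deleted at the cost of at most half of the
  edges, and pruning the rest makes all degrees large.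
\<close>

lemma exists_almost_regular_subgraph:
  fixes c :: real and k :: nat
  assumes V: "finite V" "\<And>e. e \<in> E \<Longrightarrow> e \<subseteq> V \<and> card e = 2" and E: "E \<noteq> {}" and k: "k \<ge> 1" and c: "c > 0"
    and dense: "c * real (card V) powr (1 + 1 / k) \<le> real (card E)"
  shows "\<exists>E' d. E' \<subseteq> E \<and> E' \<noteq> {} \<and> d > 0 \<and>
    (\<forall>v\<in>\<Union>E'. d < real (card {e\<in>E'. v \<in> e}) \<and> real (card {e\<in>E'. v \<in> e}) \<le> 16 * 8 ^ k * d) \<and>
    real (card (\<Union>E')) \<le> (4 * d / c) ^ k"
proof -
  define a where "a = 1 + 1 / real k"
  define Es where "Es T = {e\<in>E. e \<subseteq> T}" for T
  define \<phi> where "\<phi> T = real (card (Es T)) / real (card T) powr a" for T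
  have fE: "finite E" using V by (intro finite_subset[of E "Pow V"]) auto
  have "Es V = E" using V by (auto simp: Es_def)
  have "V \<noteq> {}" using E V(2) by force
  define A where "A = Pow V - {{}}"
  have A: "finite A" "A \<noteq> {}" using V \<open>V \<noteq> {}\<close> by (auto simp: A_def)
  have "Max (\<phi> ` A) \<in> \<phi> ` A" using A by (intro Max_in) auto
  then obtain S where S: "S \<in> A" "\<phi> S = Max (\<phi> ` A)" by auto
  then have maxS: "\<phi> T \<le> \<phi> S" if "T \<in> A" for T using that A by auto
  have SV: "S \<subseteq> V" "S \<noteq> {}" "finite S" using S(1) V finite_subset by (auto simp: A_def)
  define m where "m = card S"
  define e where "e = card (Es S)"
  have m: "m > 0" using SV by (simp add: m_def card_gt_0_iff)
  have "c \<le> \<phi> V"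
    using dense \<open>V \<noteq> {}\<close> V by (simp add: \<phi>_def \<open>Es V = E\<close> a_def pos_le_divide_eq card_gt_0_iff)
  also have "\<dots> \<le> \<phi> S" using maxS \<open>V \<noteq> {}\<close> by (simp add: A_def)
  finally have phic: "c \<le> \<phi> S" .
  have e: "real e = \<phi> S * real m powr a" using m by (simp add: \<phi>_def e_def m_def)
  then have "e > 0" 
  proof -
    have "0 < \<phi> S * real m powr a" using phic c m by (intro mult_pos_pos) auto
    then show ?thesis using e by simp
  qed
  have a0: "a > 0" by (simp add: a_def add_pos_nonneg)
  have tight: "real (card (Es T)) \<le> \<phi> S * real (card T) powr a" if "T \<subseteq> S" for T
  proof (cases "T = {}")
    case True
    have "Es {} = {}" using V(2) by (force simp: Es_def)
    then show ?thesis using True by simp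
  next
    case False
    then have "T \<in> A" using that SV by (auto simp: A_def)
    from maxS[OF this] show ?thesis
      using False SV that finite_subset[OF that] by (simp add: \<phi>_def[of T] pos_divide_le_eq card_gt_0_iff)
  qed
  have fEs: "finite (Es T)" for T using fE by (simp add: Es_def)
  define deg where "deg v = card {f \<in> Es S. v \<in> f}" for v
  have "sum deg S = 2 * e"
    unfolding deg_def e_def
  proof (rule sum_multicount[OF SV(3) fEs], intro ballI)
    fix f assume f: "f \<in> Es S"
    then have "{i \<in> S. i \<in> f} = f" by (auto simp: Es_def)
    then show "card {i \<in> S. i \<in> f} = 2" using f V(2) by (auto simp: Es_def)
  qed
  define K' :: real where "K' = 4 * 8 ^ k"
  define B where "B = {v\<in>S. deg v > K' * e / m}"
  have BS: "B \<subseteq> S" "finite B" using SV by (auto simp: B_def)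
  have "real (card B) * (K' * e / m) \<le> (\<Sum>v\<in>B. real (deg v))"
    using sum_bounded_below[of B "K' * e / m" "\<lambda>v. real (deg v)"] by (force simp: B_def)
  also have "\<dots> \<le> (\<Sum>v\<in>S. real (deg v))" using BS SV by (intro sum_mono2) auto
  also have "\<dots> = 2 * real e" using \<open>sum deg S = 2 * e\<close> by (simp flip: of_nat_sum)
  finally have cB: "real (card B) * K' \<le> 2 * real m"
    using \<open>e > 0\<close> m by (simp add: field_simps)
  define Touch where "Touch = {f \<in> Es S. f \<inter> B \<noteq> {}}"
  have touch: "2 * real (card Touch) \<le> real e"
  proof (cases "B = {}")
    case True then show ?thesis by (simp add: Touch_def)
  next
    case False
    define b where "b = card B"
    have b: "b > 0" "b \<le> m" using False BS SV by (auto simp: b_def card_gt_0_iff m_def intro: card_mono)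
    obtain f where f: "bij_betw f S {0..<m}" using ex_bij_betw_finite_nat[OF SV(3)] by (auto simp: m_def)
    \<comment> \<open>The sets \<open>Aj 0, \<dots>, Aj (q - 1)\<close> of size at most \<open>b\<close> cover \<open>S\<close>.\<close>
    define Aj where "Aj j = {v\<in>S. f v div b = j}" for j
    have cA: "card (Aj j) \<le> b" for j
    proof -
      have "inj_on f (Aj j)" using f by (auto simp: Aj_def bij_betw_def intro: inj_on_subset)
      moreover have "f ` Aj j \<subseteq> {j * b..<j * b + b}"
      proof
        fix x assume "x \<in> f ` Aj j"
        then have "x div b = j" by (auto simp: Aj_def)
        then show "x \<in> {j * b..<j * b + b}"
          using b div_times_less_eq_dividend[of x b] dividend_less_div_times[of b x] by auto
      qed
      ultimately show ?thesis using card_inj_on_le[of f "Aj j" "{j * b..<j * b + b}"] by simp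
    qed
    define q where "q = m div b + 1"
    have "Touch \<subseteq> (\<Union>j<q. Es (B \<union> Aj j))"
    proof
      fix g assume g: "g \<in> Touch"
      then obtain u where u: "u \<in> g" "u \<in> B" by (auto simp: Touch_def)
      have "card g = 2" "g \<subseteq> S" "g \<in> E" using g V(2) by (auto simp: Touch_def Es_def)
      then obtain v where v: "g = {u, v}" "v \<in> S" using u by (auto simp: card_2_iff doubleton_eq_iff)
      have "f v < m" using v f by (auto simp: bij_betw_def)
      then have "f v div b < q" by (simp add: q_def div_le_mono less_Suc_eq_le)
      moreover have "g \<in> Es (B \<union> Aj (f v div b))"
        using v u \<open>g \<in> E\<close> by (auto simp: Es_def Aj_def)
      ultimately show "g \<in> (\<Union>j<q. Es (B \<union> Aj j))" by auto
    qed
    then have "card Touch \<le> card (\<Union>j<q. Es (B \<union> Aj j))"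
      using fEs by (intro card_mono) auto
    also have "\<dots> \<le> (\<Sum>j<q. card (Es (B \<union> Aj j)))" by (intro card_UN_le) auto
    finally have "real (card Touch) \<le> (\<Sum>j<q. real (card (Es (B \<union> Aj j))))"
      by (simp flip: of_nat_sum)
    also have "\<dots> \<le> (\<Sum>j<q. \<phi> S * real (2 * b) powr a)"
    proof (rule sum_mono)
      fix j
      have "real (card (Es (B \<union> Aj j))) \<le> \<phi> S * real (card (B \<union> Aj j)) powr a"
        using BS by (intro tight) (auto simp: Aj_def)
      also have "\<dots> \<le> \<phi> S * real (2 * b) powr a"
      proof (rule mult_left_mono[OF powr_mono2])
        show "real (card (B \<union> Aj j)) \<le> real (2 * b)"
          using card_Un_le[of B "Aj j"] cA[of j] by (simp add: b_def flip: of_nat_le_iff)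
      qed (use a0 phic c in auto)
      finally show "real (card (Es (B \<union> Aj j))) \<le> \<phi> S * real (2 * b) powr a" .
    qed
    also have "\<dots> = real q * (\<phi> S * real (2 * b) powr a)" by simp
    also have "\<dots> \<le> (2 * m / b) * (\<phi> S * real (2 * b) powr a)"
    proof (rule mult_right_mono)
      have "real (m div b) \<le> real m / real b" 
        using b div_times_less_eq_dividend[of m b] by (simp add: pos_le_divide_eq flip: of_nat_mult)
      moreover have "1 \<le> real m / real b" using b by simp
      ultimately have "real (m div b) + 1 \<le> real m / real b + real m / real b" by (rule add_mono)
      also have "real m / real b + real m / real b = 2 * m / b" by (simp only: add_divide_distrib[symmetric] mult_2 of_nat_add)
      finally show "real q \<le> 2 * m / b" unfolding q_def by (simp only: of_nat_add of_nat_1)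
    qed (use phic c in auto)
    also have "\<dots> = 4 * m * \<phi> S * real (2 * b) powr (1 / k)"
      using b by (simp add: a_def powr_add field_simps)
    also have "\<dots> \<le> 4 * m * \<phi> S * (real m powr (1 / k) / 8)"
    proof (rule mult_left_mono)
      have "real (2 * b) \<le> real m / 8 ^ k"
        using cB by (simp add: b_def K'_def field_simps)
      then have "real (2 * b) powr (1 / k) \<le> (real m / 8 ^ k) powr (1 / k)" by (intro powr_mono2) auto
      also have "\<dots> = real m powr (1 / k) / (8 ^ k) powr (1 / k)" by (simp add: powr_divide)
      also have "((8::real) ^ k) powr (1 / k) = 8" using k by (simp add: powr_powr flip: powr_realpow)
      finally show "real (2 * b) powr (1 / k) \<le> real m powr (1 / k) / 8" .
    qed (use phic c in auto)
    also have "\<dots> = real e / 2" using m by (simp add: e a_def powr_add)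
    finally show ?thesis by simp
  qed
  define E1 where "E1 = Es S - Touch"
  have "Touch \<subseteq> Es S" by (auto simp: Touch_def)
  then have "card E1 + card Touch = e" using fEs[of S] card_mono[OF fEs \<open>Touch \<subseteq> Es S\<close>]
    by (simp add: E1_def e_def card_Diff_subset finite_subset)
  then have E1: "real e \<le> 2 * real (card E1)" using touch by linarith
  define d where "d = real e / (4 * real m)"
  have d: "d > 0" using \<open>e > 0\<close> m by (simp add: d_def)
  have "(\<Sum>x\<in>S. d) = real e / 4" using m by (simp add: d_def flip: m_def)
  also have "\<dots> < real (card E1)" using E1 \<open>e > 0\<close> by linarith
  finally obtain E' where E': "E' \<subseteq> E1" "E' \<noteq> {}" "\<forall>x\<in>S. E' \<inter> {f. x \<in> f} = {} \<or> d < real (card (E' \<inter> {f. x \<in> f}))"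
    using exists_pruned_subset[of S E1 "\<lambda>_. d" "\<lambda>x. {f. x \<in> f}"] SV d fEs by (auto simp: E1_def)
  have E'S: "\<Union>E' \<subseteq> S" "E' \<subseteq> E" "E' \<subseteq> Es S" using E'(1) by (auto simp: E1_def Es_def)
  show ?thesis
  proof (intro exI[of _ E'] exI[of _ d] conjI ballI)
    fix v assume v: "v \<in> \<Union>E'"
    have eq: "E' \<inter> {f. v \<in> f} = {f\<in>E'. v \<in> f}" by auto
    show "d < real (card {f\<in>E'. v \<in> f})"
    proof -
      have "v \<in> S" "E' \<inter> {f. v \<in> f} \<noteq> {}" using v E'S(1) by auto
      then show ?thesis using E'(3) unfolding eq[symmetric] by auto
    qed
    have "v \<notin> B" using v E'(1) by (auto simp: E1_def Touch_def)
    then have "real (deg v) \<le> K' * e / m" using v E'S(1) by (auto simp: B_def)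
    moreover have "card {f\<in>E'. v \<in> f} \<le> deg v"
      unfolding deg_def using fEs E'S(3) by (intro card_mono) auto
    moreover have "K' * e / m = 16 * 8 ^ k * d" using m by (simp add: d_def K'_def field_simps)
    ultimately show "real (card {f\<in>E'. v \<in> f}) \<le> 16 * 8 ^ k * d" by linarith
  next
    have "card (\<Union>E') \<le> m" unfolding m_def using SV(3) E'S(1) by (rule card_mono)
    then have "real (card (\<Union>E')) \<le> real m" by simp
    also have "\<dots> = (real m powr (1 / k)) ^ k"
      using k m by (simp add: powr_powr flip: powr_realpow)
    also have "\<dots> \<le> (4 * d / c) ^ k"
    proof (rule power_mono)
      have "c * real m powr (1 / k) \<le> \<phi> S * real m powr (1 / k)" using phic by (simp add: mult_right_mono)
      also have "\<dots> = 4 * d" using m by (simp add: d_def e a_def powr_add)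
      finally show "real m powr (1 / k) \<le> 4 * d / c" using c by (simp add: field_simps)
    qed simp
    finally show "real (card (\<Union>E')) \<le> (4 * d / c) ^ k" .
  qed (use E' E'S d in auto)
qed

section \<open>Breadth-first levels\<close>

text \<open>
  The neighbourhood of a vertex.
\<close>

definition nbr :: "'a set set \<Rightarrow> 'a \<Rightarrow> 'a set" where
  "nbr E v = {w. {v, w} \<in> E}"

lemma card_nbr:
  assumes "\<And>e. e \<in> E \<Longrightarrow> card e = 2"
  shows "card {e \<in> E. v \<in> e} = card (nbr E v)"
proof -
  have "bij_betw (\<lambda>w. {v, w}) (nbr E v) {e \<in> E. v \<in> e}"
    unfolding bij_betw_def
  proof
    show "inj_on (\<lambda>w. {v, w}) (nbr E v)" by (auto simp: inj_on_def doubleton_eq_iff)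
    show "(\<lambda>w. {v, w}) ` nbr E v = {e \<in> E. v \<in> e}"
    proof
      show "{e \<in> E. v \<in> e} \<subseteq> (\<lambda>w. {v, w}) ` nbr E v"
      proof
        fix e assume e: "e \<in> {e \<in> E. v \<in> e}"
        then obtain w where "e = {v, w}" using assms[of e] by (auto simp: card_2_iff doubleton_eq_iff)
        then show "e \<in> (\<lambda>w. {v, w}) ` nbr E v" using e by (auto simp: nbr_def)
      qed
    qed (auto simp: nbr_def)
  qed
  then show ?thesis by (simp add: bij_betw_same_card)
qed

lemma nbr_subset: "nbr E v \<subseteq> \<Union>E"
  by (auto simp: nbr_def)

lemma finite_Union_edges:
  assumes "finite E" "\<And>e. e \<in> E \<Longrightarrow> card e = 2"
  shows "finite (\<Union>E)"
  using assms by (intro finite_Union) (auto intro: card_ge_0_finite)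

text \<open>
  The ball of radius \<open>j\<close> around \<open>x\<close> and the set of vertices at distance exactly \<open>j\<close> from \<open>x\<close>.
\<close>

fun bfs_ball :: "'a set set \<Rightarrow> 'a \<Rightarrow> nat \<Rightarrow> 'a set" where
  "bfs_ball E x 0 = {x}"
| "bfs_ball E x (Suc j) = bfs_ball E x j \<union> (\<Union>v\<in>bfs_ball E x j. nbr E v)"

fun bfs_level :: "'a set set \<Rightarrow> 'a \<Rightarrow> nat \<Rightarrow> 'a set" where
  "bfs_level E x 0 = {x}"
| "bfs_level E x (Suc j) = bfs_ball E x (Suc j) - bfs_ball E x j"

lemma bfs_ball_mono: "a \<le> b \<Longrightarrow> bfs_ball E x a \<subseteq> bfs_ball E x b"
  by (rule lift_Suc_mono_le) auto

lemma bfs_level_ball: "bfs_level E x j \<subseteq> bfs_ball E x j"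
  by (cases j) auto

lemma bfs_level_disjoint_less:
  assumes "a < b" "v \<in> bfs_level E x a" shows "v \<notin> bfs_level E x b"
proof -
  obtain b' where b: "b = Suc b'" "a \<le> b'" using assms by (cases b) auto
  then show ?thesis using assms bfs_level_ball bfs_ball_mono[OF b(2)] by fastforce
qed

lemma bfs_level_disjoint: "v \<in> bfs_level E x a \<Longrightarrow> v \<in> bfs_level E x b \<Longrightarrow> a = b"
  using bfs_level_disjoint_less[of a b v E x] bfs_level_disjoint_less[of b a v E x] by (cases a b rule: linorder_cases) auto

lemma bfs_ball_level: "v \<in> bfs_ball E x j \<Longrightarrow> \<exists>i\<le>j. v \<in> bfs_level E x i"
proof (induction j)
  case (Suc j)
  show ?case
  proof (cases "v \<in> bfs_ball E x j")
    case True
    then show ?thesis using Suc.IH le_SucI by blast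
  next
    case False
    then have "v \<in> bfs_level E x (Suc j)" using Suc.prems by simp
    then show ?thesis by blast
  qed
qed auto

lemma bfs_level_subset: "bfs_level E x j \<subseteq> insert x (\<Union>E)"
proof -
  have "bfs_ball E x j \<subseteq> insert x (\<Union>E)"
    by (induction j) (auto simp: nbr_def)
  then show ?thesis using bfs_level_ball[of E x j] by (rule subset_trans[rotated])
qed

lemma bfs_level_Suc:
  assumes "w \<in> bfs_level E x (Suc j)" shows "\<exists>v\<in>bfs_level E x j. w \<in> nbr E v"
proof -
  obtain v where v: "v \<in> bfs_ball E x j" "w \<in> nbr E v" using assms by auto
  then obtain i where i: "i \<le> j" "v \<in> bfs_level E x i" using bfs_ball_level by meson
  have "i = j"
  proof (rule ccontr)
    assume "i \<noteq> j"
    then have "Suc i \<le> j" using i by simp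
    have "w \<in> bfs_ball E x (Suc i)" using v i bfs_level_ball by fastforce
    then show False using assms bfs_ball_mono[OF \<open>Suc i \<le> j\<close>, of E x] by (auto simp del: bfs_ball.simps)
  qed
  then show ?thesis using v i by auto
qed

lemma bfs_level_nbr_le:
  assumes "v \<in> bfs_level E x j" "w \<in> nbr E v"
  shows "\<exists>i\<le>Suc j. w \<in> bfs_level E x i \<and> j \<le> Suc i"
proof -
  have "w \<in> bfs_ball E x (Suc j)" using assms bfs_level_ball by fastforce
  then obtain i where i: "i \<le> Suc j" "w \<in> bfs_level E x i" using bfs_ball_level by meson
  have "v \<in> nbr E w" using assms by (simp add: nbr_def insert_commute)
  then have "v \<in> bfs_ball E x (Suc i)" using i bfs_level_ball by fastforce
  then obtain i' where "i' \<le> Suc i" "v \<in> bfs_level E x i'" using bfs_ball_level by meson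
  moreover from this have "i' = j" using assms(1) bfs_level_disjoint by metis
  ultimately show ?thesis using i by auto
qed

lemma bfs_level_parity:
  assumes bip: "\<And>v w. w \<in> nbr E v \<Longrightarrow> v \<in> W \<longleftrightarrow> w \<notin> W" and "v \<in> bfs_level E x j"
  shows "v \<in> W \<longleftrightarrow> (x \<in> W \<longleftrightarrow> even j)"
  using assms(2)
proof (induction j arbitrary: v)
  case (Suc j)
  then show ?case using bfs_level_Suc[OF Suc.prems] bip by auto
qed auto

text \<open>
  In a bipartite graph, given by a set \<open>W\<close> that contains one end of each edge, there are no edges
  inside a level.
\<close>

lemma bfs_level_nbr:
  assumes bip: "\<And>v w. w \<in> nbr E v \<Longrightarrow> v \<in> W \<longleftrightarrow> w \<notin> W"
    and "v \<in> bfs_level E x j" "w \<in> nbr E v"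
  shows "w \<in> bfs_level E x (Suc j) \<or> (\<exists>i. j = Suc i \<and> w \<in> bfs_level E x i)"
proof -
  obtain i where i: "i \<le> Suc j" "w \<in> bfs_level E x i" "j \<le> Suc i"
    using bfs_level_nbr_le[OF assms(2,3)] by auto
  have "i \<noteq> j"
    using bfs_level_parity[where W = W, OF bip i(2)] bfs_level_parity[where W = W, OF bip assms(2)] bip[OF assms(3)]
    by auto
  then have "i = Suc j \<or> j = Suc i" using i by auto
  then show ?thesis using i by auto
qed

lemma card_bfs_ball:
  assumes "\<And>v. finite (nbr E v)" "\<And>v. card (nbr E v) \<le> \<Delta>"
  shows "finite (bfs_ball E x j) \<and> card (bfs_ball E x j) \<le> (\<Delta> + 1) ^ j"
proof (induction j)
  case (Suc j)
  let ?B = "bfs_ball E x j"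
  have "card (bfs_ball E x (Suc j)) \<le> card ?B + card (\<Union>v\<in>?B. nbr E v)"
    using card_Un_le by simp
  also have "card (\<Union>v\<in>?B. nbr E v) \<le> (\<Sum>v\<in>?B. card (nbr E v))" using Suc by (intro card_UN_le) auto
  also have "\<dots> \<le> card ?B * \<Delta>" using sum_bounded_above[of ?B "\<lambda>v. card (nbr E v)" \<Delta>] assms by simp
  also have "card ?B + card ?B * \<Delta> = card ?B * (\<Delta> + 1)" by simp
  also have "\<dots> \<le> (\<Delta> + 1) ^ j * (\<Delta> + 1)" using Suc by (intro mult_right_mono) auto
  finally show ?case using Suc assms by (simp add: mult.commute)
qed auto

text \<open>
  A large set \<open>N\<close> of leaves below one tree vertex contains a proportional part \<open>M\<close> below a vertex \<open>r\<close>, none of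
  whose children lies above more than an eighth of \<open>M\<close>: start at the given vertex and move down
  to a child as long as this child keeps more than an eighth of the leaves. The descent stops before it
  reaches a single leaf, as \<open>N\<close> has more than \<open>8\<^bsup>g\<^esup>\<close> elements.
\<close>

lemma exists_spread_subset:
  fixes par :: "'a \<Rightarrow> 'a"
  assumes "finite N" "8 ^ g < card N" "\<And>v w. v \<in> N \<Longrightarrow> w \<in> N \<Longrightarrow> anc par g v = anc par g w"
  shows "\<exists>h M. 1 \<le> h \<and> h \<le> g \<and> M \<subseteq> N \<and> card N \<le> 8 ^ g * card M \<and>
    (\<forall>v\<in>M. \<forall>w\<in>M. anc par h v = anc par h w) \<and> (\<forall>c. 8 * card {v\<in>M. anc par (h - 1) v = c} \<le> card M)"
  using assms
proof (induction g arbitrary: N)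
  case 0
  then obtain v w where "v \<in> N" "w \<in> N" "v \<noteq> w"
    by (auto simp: card_le_Suc0_iff_eq not_le dest!: leD simp flip: One_nat_def) (metis One_nat_def card_le_Suc0_iff_eq linorder_not_le)
  then show ?case using 0 by auto
next
  case (Suc g)
  show ?case
  proof (cases "\<forall>c. 8 * card {v\<in>N. anc par g v = c} \<le> card N")
    case True
    have "card N \<le> 8 ^ Suc g * card N" by simp
    moreover have "\<forall>v\<in>N. \<forall>w\<in>N. anc par (Suc g) v = anc par (Suc g) w" using Suc.prems(3) by blast
    moreover have "\<forall>c. 8 * card {v\<in>N. anc par (Suc g - 1) v = c} \<le> card N" using True by simp
    moreover have "1 \<le> Suc g" "Suc g \<le> Suc g" "N \<subseteq> N" by simp_all
    ultimately show ?thesis by blast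
  next
    case False
    then obtain c where c: "card N < 8 * card {v\<in>N. anc par g v = c}" by (auto simp: not_le)
    let ?N = "{v\<in>N. anc par g v = c}"
    obtain h M where hM: "1 \<le> h" "h \<le> g" "M \<subseteq> ?N" "card ?N \<le> 8 ^ g * card M"
       "\<forall>v\<in>M. \<forall>w\<in>M. anc par h v = anc par h w" "\<forall>c. 8 * card {v\<in>M. anc par (h - 1) v = c} \<le> card M"
    proof -
      have "finite ?N" "8 ^ g < card ?N" using Suc.prems(1,2) c by auto
      moreover have "anc par g v = anc par g w" if "v \<in> ?N" "w \<in> ?N" for v w using that by simp
      ultimately show ?thesis using Suc.IH[of ?N] that by blast
    qed
    have "card N \<le> 8 ^ Suc g * card M" using c hM(4) by simp
    moreover have "h \<le> Suc g" "M \<subseteq> N" using hM by auto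
    ultimately show ?thesis using hM(1,5,6) by blast
  qed
qed

section \<open>Dense graphs contain chorded cycles\<close>

lemma sum_card_swap:
  assumes "finite A" "finite B"
  shows "(\<Sum>v\<in>A. card {w\<in>B. R v w}) = (\<Sum>w\<in>B. card {v\<in>A. R v w})"
proof -
  have "(\<Sum>v\<in>A. card {w\<in>B. R v w}) = (\<Sum>v\<in>A. \<Sum>w\<in>B. if R v w then 1 else 0)"
    using assms by (intro sum.cong) (auto simp: sum.If_cases Int_def)
  also have "\<dots> = (\<Sum>w\<in>B. \<Sum>v\<in>A. if R v w then 1 else 0)" by (rule sum.swap)
  also have "\<dots> = (\<Sum>w\<in>B. card {v\<in>A. R v w})"
    using assms by (intro sum.cong) (auto simp: sum.If_cases Int_def)
  finally show ?thesis .
qed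

text \<open>
  The main step of the upper bound. Grow a breadth-first tree from a vertex \<open>x\<close>. If each of the first
  \<open>k\<close> levels were larger than the one before by the factor \<open>\<rho> = d / D\<close>, the graph would have too many
  vertices. Let \<open>V (i + 1)\<close> be the first level that is smaller than that; \<open>i \<ge> 1\<close>, as \<open>x\<close> has more than \<open>d\<close>
  neighbours. Few edges lead back from \<open>V i\<close>, so at least \<open>d |V i| / 2\<close> edges lead on to
  the small level \<open>V (i + 1)\<close>, whose vertices thus have many neighbours in \<open>V i\<close> on average. Each such
  vertex \<open>y\<close> with many neighbours keeps a spread set \<open>M y\<close> of them, below a vertex of height \<open>hh y\<close>. One
  height \<open>h\<close> retains a constant proportion of the edges. Pruning these edges
  makes sure that the vertices that keep any edges at all keep many: \<open>y\<close> more than half of \<open>M y\<close>, a leaf more than \<open>l\<close>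
  edges, and a tree vertex of height \<open>h - 1\<close> more than \<open>(Kd)\<^bsup>h-1\<^esup>\<close> edges below it. If \<open>h \<ge> 2\<close>, these last
  edges cannot all lie below one child, because degrees are at most \<open>Kd\<close>. This is the configuration of
  \<open>chorded_cycle_from_levels\<close>, with \<open>h \<le> i < k\<close>.
\<close>

lemma chorded_cycle_in_almost_regular:
  fixes E :: "'a set set" and K d D :: real and k l :: nat
  assumes E: "finite E" "\<And>e. e \<in> E \<Longrightarrow> card e = 2" "E \<noteq> {}"
    and bip: "\<And>v w. w \<in> nbr E v \<Longrightarrow> v \<in> W \<longleftrightarrow> w \<notin> W"
    and deg: "\<And>v. v \<in> \<Union>E \<Longrightarrow> d < real (card (nbr E v)) \<and> real (card (nbr E v)) \<le> K * d"
    and k: "k \<ge> 1" and l: "even l" "l > 0" "4 * k \<le> l + 2"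
    and D: "D = 16 * real l * 8 ^ k"
    and d: "8 * 8 ^ k * real k * (real l + (K * D) ^ k) < d" and d0: "d > 0"
    and size: "real (card (\<Union>E)) < (d / D) ^ k"
  shows "chorded_cycle E l"
proof -
  have finU: "finite (\<Union>E)" using E finite_Union_edges by blast
  have fin_nbr: "finite (nbr E v)" for v using finU nbr_subset by (rule finite_subset[rotated])
  obtain x where x: "x \<in> \<Union>E" using E by (metis Union_empty_conv all_not_in_conv card_0_eq card.empty zero_neq_numeral)
  define V where "V = bfs_level E x"
  have VU: "V j \<subseteq> \<Union>E" for j using bfs_level_subset[of E x j] x by (auto simp: V_def)
  have finV: "finite (V j)" for j using VU finU by (rule finite_subset)
  have V_disj: "v \<in> V a \<Longrightarrow> v \<in> V b \<Longrightarrow> a = b" for v a b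
    unfolding V_def by (rule bfs_level_disjoint)
  have K1: "1 \<le> K" using deg[OF x] d0 by (smt (verit) mult_less_cancel_right1 mult_le_cancel_right1)
  have D1: "1 \<le> D"
  proof -
    have "1 \<le> real l" "(1::real) \<le> 8 ^ k" using l by auto
    then have "1 * 1 \<le> real l * 8 ^ k" by (intro mult_mono) auto
    then show ?thesis by (simp add: D)
  qed
  have nbr_le: "real (card (nbr E v)) \<le> K * d" for v
  proof (cases "v \<in> \<Union>E")
    case False
    then have "nbr E v = {}" by (auto simp: nbr_def)
    then show ?thesis using K1 d0 by simp
  qed (use deg in auto)
  have KD1: "1 \<le> K * D" using mult_mono[OF K1 D1] K1 by simp
  have dKD: "8 * (K * D) \<le> d"
  proof -
    have "1 * (K * D) \<le> (8 ^ k * real k) * (real l + (K * D) ^ k)"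
    proof (rule mult_mono)
      have "(1::real) * 1 \<le> 8 ^ k * real k" using k by (intro mult_mono) auto
      then show "1 \<le> 8 ^ k * real k" by simp
      show "K * D \<le> real l + (K * D) ^ k" using self_le_power[OF KD1, of k] k by simp
    qed (use KD1 in auto)
    then show ?thesis using d by simp
  qed
  define \<rho> where "\<rho> = d / D"
  have dD: "\<rho> > 0" using d0 D1 by (simp add: \<rho>_def)
  have "\<exists>i<k. real (card (V (Suc i))) < \<rho> * real (card (V i))"
  proof (rule ccontr)
    assume "\<not> ?thesis"
    then have grow: "\<rho> * real (card (V i)) \<le> real (card (V (Suc i)))" if "i < k" for i
      using that by (meson not_less)
    have "\<rho> ^ j \<le> real (card (V j))" if "j \<le> k" for j
      using that
    proof (induction j)
      case (Suc j)
      then have "\<rho> * \<rho> ^ j \<le> \<rho> * real (card (V j))" using dD by (intro mult_left_mono) auto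
      then show ?case using grow[of j] Suc.prems by simp
    qed (simp add: V_def)
    from this[of k] have "\<rho> ^ k \<le> real (card (V k))" by simp
    also have "\<dots> \<le> real (card (\<Union>E))" using card_mono[OF finU VU] by simp
    finally show False using size by (simp add: \<rho>_def)
  qed
  then obtain i where i: "i < k" "real (card (V (Suc i))) < \<rho> * real (card (V i))"
     and imin: "\<And>j. j < i \<Longrightarrow> \<rho> * real (card (V j)) \<le> real (card (V (Suc j)))"
    using exists_least_iff[of "\<lambda>i. i < k \<and> real (card (V (Suc i))) < \<rho> * real (card (V i))"]
    by (meson not_less less_trans)
  have Vi: "\<rho> ^ j \<le> real (card (V j))" if "j \<le> i" for j
    using that
  proof (induction j)
    case (Suc j)
    then have "\<rho> * \<rho> ^ j \<le> \<rho> * real (card (V j))" using dD by (intro mult_left_mono) auto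
    then show ?case using imin[of j] Suc.prems by simp
  qed (simp add: V_def)
  have x_nbr: "x \<notin> nbr E x" using E(2)[of "{x}"] by (auto simp: nbr_def)
  have "i \<noteq> 0"
  proof
    assume "i = 0"
    have "V (Suc 0) = nbr E x" using x_nbr by (auto simp: V_def)
    then have "d < real (card (V (Suc 0)))" using deg[OF x] by simp
    also have "\<dots> < d / D" using i \<open>i = 0\<close> by (simp add: V_def \<rho>_def)
    also have "\<dots> \<le> d" using D1 d0 by (simp add: field_simps)
    finally show False by simp
  qed
  then obtain i' where i': "i = Suc i'" by (cases i) auto
  have cVi: "0 < real (card (V i))" using Vi[of i] dD by (meson order.refl order_less_le_trans zero_less_power)
  have nbr_level: "nbr E v \<subseteq> V (Suc i) \<union> V i'" if "v \<in> V i" for v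
    using bfs_level_nbr[where W = W and v = v and x = x and j = i, OF bip] that by (auto simp: V_def i' simp del: bfs_level.simps)
  have backward: "(\<Sum>v\<in>V i. real (card {w\<in>V i'. w \<in> nbr E v})) \<le> d / 2 * real (card (V i))"
  proof -
    have "(\<Sum>v\<in>V i. card {w\<in>V i'. w \<in> nbr E v}) = (\<Sum>w\<in>V i'. card {v\<in>V i. w \<in> nbr E v})"
      by (rule sum_card_swap[OF finV finV])
    then have "(\<Sum>v\<in>V i. real (card {w\<in>V i'. w \<in> nbr E v})) = (\<Sum>w\<in>V i'. real (card {v\<in>V i. w \<in> nbr E v}))"
      by (simp flip: of_nat_sum)
    also have "\<dots> \<le> (\<Sum>w\<in>V i'. K * d)"
    proof (rule sum_mono)
      fix w
      have "card {v\<in>V i. w \<in> nbr E v} \<le> card (nbr E w)"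
        by (rule card_mono[OF fin_nbr]) (auto simp: nbr_def insert_commute)
      then show "real (card {v\<in>V i. w \<in> nbr E v}) \<le> K * d" using nbr_le[of w] by linarith
    qed
    also have "\<dots> = K * D * (\<rho> * real (card (V i')))" using D1 by (simp add: \<rho>_def)
    also have "\<dots> \<le> K * D * real (card (V i))"
      using imin[of i'] KD1 by (intro mult_left_mono) (auto simp: i')
    also have "\<dots> \<le> d / 2 * real (card (V i))" using dKD KD1 by (intro mult_right_mono) auto
    finally show ?thesis .
  qed
  have "d * real (card (V i)) = (\<Sum>v\<in>V i. d)" by simp
  also have "\<dots> \<le> (\<Sum>v\<in>V i. real (card {w\<in>V (Suc i). w \<in> nbr E v}) + real (card {w\<in>V i'. w \<in> nbr E v}))"
  proof (rule sum_mono)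
    fix v assume v: "v \<in> V i"
    have "nbr E v = {w\<in>V (Suc i). w \<in> nbr E v} \<union> {w\<in>V i'. w \<in> nbr E v}"
      using nbr_level[OF v] by auto
    then have "card (nbr E v) \<le> card {w\<in>V (Suc i). w \<in> nbr E v} + card {w\<in>V i'. w \<in> nbr E v}"
      using card_Un_le by metis
    then show "d \<le> real (card {w\<in>V (Suc i). w \<in> nbr E v}) + real (card {w\<in>V i'. w \<in> nbr E v})"
      using deg[of v] v VU by fastforce
  qed
  finally have fwd: "d / 2 * real (card (V i)) \<le> (\<Sum>v\<in>V i. real (card {w\<in>V (Suc i). w \<in> nbr E v}))"
    using backward by (simp add: sum.distrib)
  define N where "N y = {v\<in>V i. y \<in> nbr E v}" for y
  have finN: "finite (N y)" for y using finV by (simp add: N_def)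
  have "(\<Sum>v\<in>V i. card {w\<in>V (Suc i). w \<in> nbr E v}) = (\<Sum>y\<in>V (Suc i). card (N y))"
    unfolding N_def by (rule sum_card_swap[OF finV finV])
  then have "(\<Sum>v\<in>V i. real (card {w\<in>V (Suc i). w \<in> nbr E v})) = (\<Sum>y\<in>V (Suc i). real (card (N y)))"
    by (simp flip: of_nat_sum)
  then have fwd: "d / 2 * real (card (V i)) \<le> (\<Sum>y\<in>V (Suc i). real (card (N y)))"
    using fwd by simp
  \<comment> \<open>Vertices of the next level with fewer than \<open>q\<close> neighbours carry at most half of the forward edges.\<close>
  define q :: nat where "q = 4 * l * 8 ^ k"
  have Dq: "D = 4 * real q" by (simp add: D q_def)
  define Y where "Y = {y\<in>V (Suc i). q \<le> card (N y)}"
  have Y: "Y \<subseteq> V (Suc i)" "finite Y" using finV by (auto simp: Y_def)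
  have "(\<Sum>y\<in>V (Suc i) - Y. real (card (N y))) \<le> (\<Sum>y\<in>V (Suc i) - Y. real q)"
    by (intro sum_mono) (auto simp: Y_def)
  also have "\<dots> \<le> (\<Sum>y\<in>V (Suc i). real q)" using finV by (intro sum_mono2) auto
  also have "\<dots> = real q * real (card (V (Suc i)))" by simp
  also have "\<dots> \<le> real q * (\<rho> * real (card (V i)))" using i by (intro mult_left_mono) auto
  also have "\<dots> = d / 4 * real (card (V i))"
  proof -
    have "real q * \<rho> = d / 4" using D1 by (simp add: \<rho>_def Dq)
    then show ?thesis by (simp flip: mult.assoc)
  qed
  finally have lost: "(\<Sum>y\<in>V (Suc i) - Y. real (card (N y))) \<le> d / 4 * real (card (V i))" .
  have "(\<Sum>y\<in>V (Suc i). real (card (N y))) = (\<Sum>y\<in>V (Suc i) - Y. real (card (N y))) + (\<Sum>y\<in>Y. real (card (N y)))"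
    using finV Y by (intro sum.subset_diff) auto
  then have YN: "d / 4 * real (card (V i)) \<le> (\<Sum>y\<in>Y. real (card (N y)))"
    using lost fwd by linarith
  define par where "par w = (SOME v. v \<in> nbr E w \<and> (\<exists>j. w \<in> V (Suc j) \<and> v \<in> V j))" for w
  have par: "par w \<in> V j \<and> par w \<in> nbr E w" if w: "w \<in> V (Suc j)" for w j
  proof -
    obtain v where "v \<in> V j" "w \<in> nbr E v" using bfs_level_Suc w unfolding V_def by metis
    then have "v \<in> nbr E w \<and> (\<exists>j. w \<in> V (Suc j) \<and> v \<in> V j)" using w by (auto simp: nbr_def insert_commute)
    then have "par w \<in> nbr E w \<and> (\<exists>j. w \<in> V (Suc j) \<and> par w \<in> V j)" unfolding par_def by (rule someI)
    then show ?thesis using V_disj w by blast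
  qed
  have ancV: "anc par j v \<in> V (i - j)" if "v \<in> V i" "j \<le> i" for v j
    using that(2)
  proof (induction j)
    case (Suc j)
    then have "anc par j v \<in> V (Suc (i - Suc j))"
      by (simp add: Suc_diff_Suc)
    from par[OF this] show ?case by simp
  qed (use that in simp)
  have fiber: "real (card {v\<in>V i. anc par t v = c}) \<le> (K * d) ^ t" if "t \<le> i" for t c
    using that
  proof (induction t arbitrary: c)
    case 0
    have "{v\<in>V i. anc par 0 v = c} \<subseteq> {c}" by auto
    then have "card {v\<in>V i. anc par 0 v = c} \<le> 1" using card_mono[of "{c}"] by fastforce
    then show ?case by simp
  next
    case (Suc t)
    have "{v\<in>V i. anc par (Suc t) v = c} \<subseteq> (\<Union>c'\<in>nbr E c. {v\<in>V i. anc par t v = c'})"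
    proof
      fix v assume v: "v \<in> {v\<in>V i. anc par (Suc t) v = c}"
      then have "anc par t v \<in> V (Suc (i - Suc t))"
        using ancV[of v t] Suc.prems by (simp add: Suc_diff_Suc)
      from par[OF this] show "v \<in> (\<Union>c'\<in>nbr E c. {v\<in>V i. anc par t v = c'})"
        using v by (auto simp: nbr_def insert_commute)
    qed
    then have "card {v\<in>V i. anc par (Suc t) v = c} \<le> card (\<Union>c'\<in>nbr E c. {v\<in>V i. anc par t v = c'})"
      using fin_nbr finV by (intro card_mono) auto
    also have "\<dots> \<le> (\<Sum>c'\<in>nbr E c. card {v\<in>V i. anc par t v = c'})" by (intro card_UN_le fin_nbr)
    finally have "real (card {v\<in>V i. anc par (Suc t) v = c}) \<le> (\<Sum>c'\<in>nbr E c. real (card {v\<in>V i. anc par t v = c'}))"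
      by (simp flip: of_nat_sum)
    also have "\<dots> \<le> (\<Sum>c'\<in>nbr E c. (K * d) ^ t)" using Suc by (intro sum_mono) auto
    also have "\<dots> = real (card (nbr E c)) * (K * d) ^ t" by simp
    also have "\<dots> \<le> K * d * (K * d) ^ t" using nbr_le K1 d0 by (intro mult_right_mono) auto
    finally show ?case by simp
  qed
  have Vle: "real (card (V j)) \<le> (K * d) ^ j" for j
  proof (induction j)
    case (Suc j)
    have "V (Suc j) \<subseteq> (\<Union>v\<in>V j. nbr E v)" using bfs_level_Suc unfolding V_def by fast
    then have "card (V (Suc j)) \<le> card (\<Union>v\<in>V j. nbr E v)" using fin_nbr finV by (intro card_mono) auto
    also have "\<dots> \<le> (\<Sum>v\<in>V j. card (nbr E v))" by (intro card_UN_le finV)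
    finally have "real (card (V (Suc j))) \<le> (\<Sum>v\<in>V j. real (card (nbr E v)))" by (simp flip: of_nat_sum)
    also have "\<dots> \<le> (\<Sum>v\<in>V j. K * d)" using nbr_le by (intro sum_mono) auto
    also have "\<dots> = real (card (V j)) * (K * d)" by simp
    also have "\<dots> \<le> (K * d) ^ j * (K * d)" using Suc K1 d0 by (intro mult_right_mono) auto
    finally show ?case by (simp add: mult.commute)
  qed (simp add: V_def)
  have "\<exists>h M. 1 \<le> h \<and> h \<le> i \<and> M \<subseteq> N y \<and> card (N y) \<le> 8 ^ i * card M \<and>
    (\<forall>v\<in>M. \<forall>w\<in>M. anc par h v = anc par h w) \<and> (\<forall>c. 8 * card {v\<in>M. anc par (h - 1) v = c} \<le> card M)"
    if y: "y \<in> Y" for y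
  proof (rule exists_spread_subset[OF finN])
    have "(8::nat) ^ i < 8 ^ k" using i by simp
    also have "\<dots> \<le> q" using l by (simp add: q_def)
    also have "q \<le> card (N y)" using y by (simp add: Y_def)
    finally show "8 ^ i < card (N y)" .
    fix v w assume "v \<in> N y" "w \<in> N y"
    then show "anc par i v = anc par i w"
      using ancV[of v i] ancV[of w i] by (auto simp: N_def V_def)
  qed
  then have "\<forall>y\<in>Y. \<exists>h M. 1 \<le> h \<and> h \<le> i \<and> M \<subseteq> N y \<and> card (N y) \<le> 8 ^ i * card M \<and>
    (\<forall>v\<in>M. \<forall>w\<in>M. anc par h v = anc par h w) \<and> (\<forall>c. 8 * card {v\<in>M. anc par (h - 1) v = c} \<le> card M)"
    by blast
  from bchoice[OF this] obtain hh where "\<forall>y\<in>Y. \<exists>M. 1 \<le> hh y \<and> hh y \<le> i \<and> M \<subseteq> N y \<and> card (N y) \<le> 8 ^ i * card M \<and>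
    (\<forall>v\<in>M. \<forall>w\<in>M. anc par (hh y) v = anc par (hh y) w) \<and> (\<forall>c. 8 * card {v\<in>M. anc par (hh y - 1) v = c} \<le> card M)"
    by (rule exE)
  from bchoice[OF this] obtain M where hM: "\<And>y. y \<in> Y \<Longrightarrow> 1 \<le> hh y \<and> hh y \<le> i \<and> M y \<subseteq> N y \<and> card (N y) \<le> 8 ^ i * card (M y) \<and>
    (\<forall>v\<in>M y. \<forall>w\<in>M y. anc par (hh y) v = anc par (hh y) w) \<and>
    (\<forall>c. 8 * card {v\<in>M y. anc par (hh y - 1) v = c} \<le> card (M y))"
    by (elim exE) blast
  have finM: "finite (M y)" if "y \<in> Y" for y using hM[OF that] finN finite_subset by blast
  have NM: "card (N y) \<le> 8 ^ k * card (M y)" if "y \<in> Y" for y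
  proof -
    have "card (N y) \<le> 8 ^ i * card (M y)" using hM[OF that] by blast
    also have "\<dots> \<le> 8 ^ k * card (M y)" using i by (intro mult_right_mono power_increasing) auto
    finally show ?thesis .
  qed
  have M4: "4 * l \<le> card (M y)" if "y \<in> Y" for y
  proof -
    have "4 * l * 8 ^ k \<le> card (N y)" using that by (simp add: Y_def q_def)
    also have "\<dots> \<le> card (M y) * 8 ^ k" using NM[OF that] by (simp add: mult.commute)
    finally show ?thesis by simp
  qed
  define Yh where "Yh h = {y\<in>Y. hh y = h}" for h
  \<comment> \<open>The average number of kept edges over the possible heights is at least \<open>\<tau>\<close>.\<close>
  define \<tau> where "\<tau> = d * real (card (V i)) / (4 * 8 ^ k * real k)"
  have "\<exists>h\<in>{1..i}. \<tau> \<le> (\<Sum>y\<in>Yh h. real (card (M y)))"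
  proof (rule ccontr)
    assume "\<not> ?thesis"
    then have "(\<Sum>h\<in>{1..i}. \<Sum>y\<in>Yh h. real (card (M y))) < (\<Sum>h\<in>{1..i}. \<tau>)"
      using \<open>i \<noteq> 0\<close> by (intro sum_strict_mono) (auto simp: not_le)
    also have "\<dots> \<le> real k * \<tau>"
    proof -
      have "0 \<le> \<tau>" using d0 by (simp add: \<tau>_def)
      then have "real i * \<tau> \<le> real k * \<tau>" using i by (intro mult_right_mono) auto
      then show ?thesis by simp
    qed
    also have "\<dots> = d / 4 * real (card (V i)) / 8 ^ k" using k by (simp add: \<tau>_def)
    also have "\<dots> \<le> (\<Sum>y\<in>Y. real (card (N y))) / 8 ^ k" using YN by (intro divide_right_mono) auto
    also have "\<dots> = (\<Sum>y\<in>Y. real (card (N y)) / 8 ^ k)" by (rule sum_divide_distrib)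
    also have "\<dots> \<le> (\<Sum>y\<in>Y. real (card (M y)))"
    proof (rule sum_mono)
      fix y assume "y \<in> Y"
      from NM[OF this] have "real (card (N y)) \<le> real (8 ^ k * card (M y))" by (simp only: of_nat_le_iff)
      then show "real (card (N y)) / 8 ^ k \<le> real (card (M y))" by (simp add: field_simps)
    qed
    also have "(\<Sum>y\<in>Y. real (card (M y))) = (\<Sum>h\<in>{1..i}. \<Sum>y\<in>Yh h. real (card (M y)))"
      unfolding Yh_def by (rule sum.group[symmetric]) (use Y hM in auto)
    finally show False by simp
  qed
  then obtain h where h: "1 \<le> h" "h \<le> i" "\<tau> \<le> (\<Sum>y\<in>Yh h. real (card (M y)))" by auto
  define P0 where "P0 = (\<lambda>(y, v). (v, y)) ` (SIGMA y:Yh h. M y)"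
  have Yh: "Yh h \<subseteq> Y" "finite (Yh h)" using Y by (auto simp: Yh_def)
  have P0: "(v, y) \<in> P0 \<longleftrightarrow> y \<in> Y \<and> hh y = h \<and> v \<in> M y" for v y by (auto simp: P0_def Yh_def)
  have "finite P0" using Yh finM by (auto simp: P0_def)
  have "card P0 = card (SIGMA y:Yh h. M y)" unfolding P0_def by (rule card_image) (auto simp: inj_on_def)
  also have "\<dots> = (\<Sum>y\<in>Yh h. card (M y))" using Yh finM by (intro card_SigmaI) auto
  finally have cP0: "real (card P0) = (\<Sum>y\<in>Yh h. real (card (M y)))" by simp
  \<comment> \<open>The demands of the pruning step: upper vertices, leaves, and tree vertices of height \<open>h - 1\<close>.\<close>
  define I where "I = Yh h <+> (V i <+> V (i - (h - 1)))"
  define S where "S = case_sum (\<lambda>y. {p. snd p = y}) (case_sum (\<lambda>v. {p. fst p = v}) (\<lambda>c. {p :: 'a \<times> 'a. anc par (h - 1) (fst p) = c}))"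
  define b where "b = case_sum (\<lambda>y. real (card (M y)) / 2) (case_sum (\<lambda>v::'a. real l) (\<lambda>c::'a. (K * d) ^ (h - 1)))"
  have Kd: "0 < K * d" using K1 d0 by auto
  have Kdi: "(K * d) ^ i \<le> (K * D) ^ k * real (card (V i))"
  proof -
    have "(K * d) ^ i = (K * D) ^ i * \<rho> ^ i" using D1 by (simp add: \<rho>_def flip: power_mult_distrib)
    also have "\<dots> \<le> (K * D) ^ k * real (card (V i))"
      using i KD1 Vi[of i] dD by (intro mult_mono power_increasing) auto
    finally show ?thesis .
  qed
  have "(\<Sum>x\<in>I. b x) = (\<Sum>y\<in>Yh h. real (card (M y)) / 2) + (real l * real (card (V i)) + real (card (V (i - (h - 1)))) * (K * d) ^ (h - 1))"
    using Yh finV by (simp add: I_def b_def sum.Plus o_def)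
  also have "(\<Sum>y\<in>Yh h. real (card (M y)) / 2) = real (card P0) / 2"
    by (simp add: cP0 sum_divide_distrib)
  also have "real (card (V (i - (h - 1)))) * (K * d) ^ (h - 1) \<le> (K * d) ^ (i - (h - 1)) * (K * d) ^ (h - 1)"
    using Vle Kd by (intro mult_right_mono) auto
  also have "\<dots> = (K * d) ^ i" using h by (simp flip: power_add)
  also have "\<dots> \<le> (K * D) ^ k * real (card (V i))" by (rule Kdi)
  also have "real (card P0) / 2 + (real l * real (card (V i)) + (K * D) ^ k * real (card (V i))) < real (card P0)"
  proof -
    have "8 * 8 ^ k * real k * (real l + (K * D) ^ k) * real (card (V i)) < d * real (card (V i))"
      using d cVi by (intro mult_strict_right_mono) auto
    then have "2 * ((real l + (K * D) ^ k) * real (card (V i))) < \<tau>"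
      using k by (simp add: \<tau>_def field_simps)
    then show ?thesis using h(3) cP0 by (simp add: algebra_simps)
  qed
  finally have sumb: "(\<Sum>x\<in>I. b x) < real (card P0)" by simp
  have b0: "0 \<le> b x" for x using Kd by (auto simp: b_def split: sum.splits)
  have "finite I" using Yh finV by (simp add: I_def)
  obtain P where P: "P \<subseteq> P0" "P \<noteq> {}" "\<And>x. x \<in> I \<Longrightarrow> P \<inter> S x = {} \<or> b x < real (card (P \<inter> S x))"
    using exists_pruned_subset[OF \<open>finite I\<close> \<open>finite P0\<close> sumb b0, of S] by blast
  have finP: "finite P" using P(1) \<open>finite P0\<close> finite_subset by blast
  have PV: "v \<in> V i" "y \<in> V (Suc i)" "y \<in> nbr E v" "y \<in> Yh h" "y \<in> Y" "hh y = h" "v \<in> M y" if "(v, y) \<in> P" for v y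
  proof -
    show *: "y \<in> Y" "hh y = h" "v \<in> M y" using that P(1) P0 by blast+
    then show "y \<in> Yh h" "y \<in> V (Suc i)" "v \<in> V i" "y \<in> nbr E v" using hM[of y] by (auto simp: Yh_def Y_def N_def)
  qed
  have half: "real (card (M y)) / 2 < real (card {v'. (v', y) \<in> P})" if vy: "(v, y) \<in> P" for v y
  proof -
    have "Inl y \<in> I" using PV[OF vy] by (auto simp: I_def)
    moreover have "(v, y) \<in> P \<inter> S (Inl y)" using vy by (simp add: S_def)
    ultimately have "b (Inl y) < real (card (P \<inter> S (Inl y)))" using P(3) by blast
    moreover have "P \<inter> S (Inl y) = (\<lambda>v. (v, y)) ` {v'. (v', y) \<in> P}" by (auto simp: S_def)
    moreover have "card ((\<lambda>v. (v, y)) ` {v'. (v', y) \<in> P}) = card {v'. (v', y) \<in> P}"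
      by (rule card_image) (auto simp: inj_on_def)
    ultimately show ?thesis by (simp add: b_def)
  qed
  show ?thesis
  proof (rule chorded_cycle_from_levels[where V = V and par = par and i = i and h = h and P = P])
    show "a = b" if "v \<in> V a" "v \<in> V b" for v a b using V_disj that .
    show "par w \<in> V j \<and> {w, par w} \<in> E" if "w \<in> V (Suc j)" "j < i" for j w
      using par[OF that(1)] by (simp add: nbr_def)
    show "v \<in> V i \<and> y \<in> V (Suc i) \<and> {v, y} \<in> E" if "(v, y) \<in> P" for v y
      using PV[OF that] by (simp add: nbr_def)
    show "anc par h v = anc par h v'" if "(v, y) \<in> P" "(v', y) \<in> P" for v v' y
      using PV[OF that(1)] PV[OF that(2)] hM[of y] by blast
    show "4 * card {v'. (v', y) \<in> P \<and> anc par (h - 1) v' = c} < card {v'. (v', y) \<in> P}" if vy: "(v, y) \<in> P" for v y c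
    proof -
      have "card {v'. (v', y) \<in> P \<and> anc par (h - 1) v' = c} \<le> card {v'\<in>M y. anc par (h - 1) v' = c}"
        using PV finM[of y] PV(5)[OF vy] by (intro card_mono) auto
      moreover have "8 * card {v'\<in>M y. anc par (h - 1) v' = c} \<le> card (M y)"
        using PV[OF vy] hM[of y] by blast
      ultimately show ?thesis using half[OF vy] by linarith
    qed
    show "2 * l < card {v'. (v', y) \<in> P}" if vy: "(v, y) \<in> P" for v y
      using half[OF vy] M4[OF PV(5)[OF vy]] by linarith
    show "l < card {y'. (v, y') \<in> P}" if vy: "(v, y) \<in> P" for v y
    proof -
      have "Inr (Inl v) \<in> I" using PV[OF vy] by (auto simp: I_def)
      moreover have "(v, y) \<in> P \<inter> S (Inr (Inl v))" using vy by (simp add: S_def)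
      ultimately have "b (Inr (Inl v)) < real (card (P \<inter> S (Inr (Inl v))))" using P(3) by blast
      moreover have "P \<inter> S (Inr (Inl v)) = (\<lambda>y. (v, y)) ` {y'. (v, y') \<in> P}" by (auto simp: S_def)
      moreover have "card ((\<lambda>y. (v, y)) ` {y'. (v, y') \<in> P}) = card {y'. (v, y') \<in> P}"
        by (rule card_image) (auto simp: inj_on_def)
      ultimately show ?thesis by (simp add: b_def)
    qed
    show "\<exists>v' y'. (v', y') \<in> P \<and> anc par (h - 1) v' = anc par (h - 1) v \<and> anc par (h - 2) v' \<noteq> anc par (h - 2) v"
      if vy: "(v, y) \<in> P" and h2: "2 \<le> h" for v y
    proof (rule ccontr)
      assume none: "\<not> ?thesis"
      define c where "c = anc par (h - 1) v"
      let ?A = "{v'\<in>V i. anc par (h - 2) v' = anc par (h - 2) v}"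
      have "Inr (Inr c) \<in> I" using ancV[of v "h - 1"] PV[OF vy] h by (auto simp: I_def c_def)
      moreover have "(v, y) \<in> P \<inter> S (Inr (Inr c))" using vy by (simp add: S_def c_def)
      ultimately have "b (Inr (Inr c)) < real (card (P \<inter> S (Inr (Inr c))))" using P(3) by blast
      moreover have "P \<inter> S (Inr (Inr c)) \<subseteq> (SIGMA v':?A. nbr E v')"
        using none PV by (auto simp: S_def c_def)
      then have "card (P \<inter> S (Inr (Inr c))) \<le> card (SIGMA v':?A. nbr E v')"
        using finV fin_nbr by (intro card_mono) auto
      moreover have "card (SIGMA v':?A. nbr E v') = (\<Sum>v'\<in>?A. card (nbr E v'))"
        using finV fin_nbr by (intro card_SigmaI) auto
      moreover have "(\<Sum>v'\<in>?A. real (card (nbr E v'))) \<le> (\<Sum>v'\<in>?A. K * d)"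
        using nbr_le by (intro sum_mono) auto
      moreover have "(\<Sum>v'\<in>?A. K * d) \<le> (K * d) ^ (h - 2) * (K * d)"
      proof -
        have "real (card ?A) \<le> (K * d) ^ (h - 2)" using fiber[of "h - 2" "anc par (h - 2) v"] h by simp
        then have "real (card ?A) * (K * d) \<le> (K * d) ^ (h - 2) * (K * d)" using Kd by (intro mult_right_mono) auto
        then show ?thesis by simp
      qed
      moreover have "(K * d) ^ (h - 2) * (K * d) = (K * d) ^ (h - 1)"
        using h2 by (simp add: numeral_2_eq_2 Suc_diff_Suc flip: power_Suc2)
      ultimately show False by (simp add: b_def flip: of_nat_sum)
    qed
  qed (use h finP P l i in auto)
qed

text \<open>
  Up to a constant factor, \<open>|V|\<^bsup>1+1/k\<^esup>\<close> edges force a chorded cycle of every even length \<open>l \<ge> 4k - 2\<close>.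
\<close>

theorem dense_imp_chorded_cycle:
  fixes k l :: nat
  assumes k: "k \<ge> 1" and l: "even l" "l > 0" "4 * k \<le> l + 2"
  shows "\<exists>C>0. \<forall>(V :: 'a set) E. finite V \<longrightarrow> V \<noteq> {} \<longrightarrow> (\<forall>e\<in>E. e \<subseteq> V \<and> card e = 2) \<longrightarrow>
     C * real (card V) powr (1 + 1 / k) \<le> real (card E) \<longrightarrow> chorded_cycle E l"
proof -
  define D where "D = 16 * real l * 8 ^ k"
  define K :: real where "K = 16 * 8 ^ k"
  define d0 where "d0 = 8 * 8 ^ k * real k * (real l + (K * D) ^ k)"
  define c where "c = 4 * D + 4 * d0 + 1"
  have pos: "D > 0" "d0 \<ge> 0" using l by (auto simp: D_def d0_def K_def)
  then have c: "c > 0" "4 * D < c" "4 * d0 < c" by (auto simp: c_def)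
  have "chorded_cycle E l" if VE: "finite V" "V \<noteq> {}" "\<forall>e\<in>E. e \<subseteq> V \<and> card e = 2"
    "(2 * c) * real (card V) powr (1 + 1 / k) \<le> real (card E)" for V :: "'a set" and E
  proof -
    obtain W where W: "card E \<le> 2 * card {e \<in> E. card (e \<inter> W) = 1}"
      using exists_large_cut[of V E] VE by auto
    define E2 where "E2 = {e \<in> E. card (e \<inter> W) = 1}"
    have cE2: "c * real (card V) powr (1 + 1 / k) \<le> real (card E2)"
      using W VE(4) by (simp add: E2_def)
    moreover have "0 < c * real (card V) powr (1 + 1 / k)" using c VE by auto
    ultimately have "E2 \<noteq> {}" by auto
    obtain E' d where E': "E' \<subseteq> E2" "E' \<noteq> {}" "d > 0"
      "\<forall>v\<in>\<Union>E'. d < real (card {e\<in>E'. v \<in> e}) \<and> real (card {e\<in>E'. v \<in> e}) \<le> 16 * 8 ^ k * d"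
      "real (card (\<Union>E')) \<le> (4 * d / c) ^ k"
      using exists_almost_regular_subgraph[of V E2 k c] VE \<open>E2 \<noteq> {}\<close> k c cE2 by (auto simp: E2_def)
    have E'2: "card e = 2" if "e \<in> E'" for e using that E' VE by (auto simp: E2_def)
    have finE: "finite E'" using E' VE by (intro finite_subset[of E' "Pow V"]) (auto simp: E2_def)
    have chord: "chorded_cycle E' l"
    proof (rule chorded_cycle_in_almost_regular[where W = W and K = K and d = d and D = D and k = k])
      show "v \<in> W \<longleftrightarrow> w \<notin> W" if "w \<in> nbr E' v" for v w
      proof -
        have "{v, w} \<in> E'" using that by (simp add: nbr_def)
        then have "card {v, w} = 2" "card ({v, w} \<inter> W) = 1" using E' E'2 by (auto simp: E2_def)
        then show ?thesis by (auto simp: card_insert_if Int_insert_left split: if_splits)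
      qed
      show "d < real (card (nbr E' v)) \<and> real (card (nbr E' v)) \<le> K * d" if "v \<in> \<Union>E'" for v
        using E'(4) that card_nbr[OF E'2] by (auto simp: K_def)
      have "card (\<Union>E') \<noteq> 0"
        using E'2 E'(2) finite_Union_edges[OF finE E'2] by fastforce
      then have "1 \<le> (4 * d / c) ^ k" using E'(5) by linarith
      then have "1 \<le> 4 * d / c"
        using E'(3) c k by (metis divide_nonneg_pos less_eq_real_def linorder_not_le mult_pos_pos power_less_one_iff zero_less_numeral One_nat_def le_zero_eq nat.distinct(1))
      then have "c \<le> 4 * d" using c by (simp add: pos_le_divide_eq)
      then have "d0 < d" using c by linarith
      then show "8 * 8 ^ k * real k * (real l + (K * D) ^ k) < d" by (simp only: d0_def)
      show "real (card (\<Union>E')) < (d / D) ^ k"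
      proof -
        have "4 * d / c < d / D" using c pos E'(3) by (simp add: field_simps)
        then have "(4 * d / c) ^ k < (d / D) ^ k" using k c E'(3) by (intro power_strict_mono) auto
        then show ?thesis using E'(5) by linarith
      qed
    qed (use finE E'2 E' k l in \<open>auto simp: D_def\<close>)
    moreover have "E' \<subseteq> E" using E' by (auto simp: E2_def)
    ultimately show ?thesis
      unfolding chorded_cycle_def by (blast intro: successively_mono)
  qed
  then show ?thesis using c by (intro exI[of _ "2 * c"]) auto
qed

section \<open>Admissible graphs of large girth\<close>

lemma is_cycle_rotate1:
  assumes "is_cycle E xs" shows "is_cycle E (rotate1 xs)"
proof (cases xs)
  case (Cons a ys)
  then have ne: "ys \<noteq> []" using assms by (auto simp: is_cycle_def)
  have "successively (adj E) (a # ys @ [a])" using assms Cons by (simp add: is_cycle_def)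
  then have "successively (adj E) (ys @ [a])" "adj E a (hd ys)"
    using ne by (auto simp: successively_Cons hd_append)
  then have "successively (adj E) ((ys @ [a]) @ [hd ys])"
    by (subst successively_append_iff) auto
  then show ?thesis using assms Cons ne by (auto simp: is_cycle_def)
qed (use assms in \<open>auto simp: is_cycle_def\<close>)

lemma is_cycle_rotate: "is_cycle E xs \<Longrightarrow> is_cycle E (rotate n xs)"
  unfolding rotate_def by (induction n) (auto intro: is_cycle_rotate1)

lemma is_cycle_edge:
  assumes "is_cycle E xs" "x \<in> set xs" shows "\<exists>e\<in>E. x \<in> e"
proof -
  obtain i where "i < length xs" "x = xs ! i" using assms(2) by (auto simp: in_set_conv_nth)
  then show ?thesis
    using closed_walk_nth[of "adj E" xs i] assms(1) by (auto simp: is_cycle_def)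
qed

lemma is_cycle_map:
  assumes cyc: "is_cycle E xs" and inj: "inj_on f (set xs)"
    and edge: "\<And>x y. x \<in> set xs \<Longrightarrow> y \<in> set xs \<Longrightarrow> {x, y} \<in> E \<Longrightarrow> {f x, f y} \<in> E'"
  shows "is_cycle E' (map f xs)"
proof -
  have ne: "xs \<noteq> []" using cyc by (auto simp: is_cycle_def)
  have "successively (adj E') (map f (xs @ [hd xs]))"
    unfolding successively_map
  proof (rule successively_mono[of "adj E"])
    show "successively (adj E) (xs @ [hd xs])" using cyc by (simp add: is_cycle_def)
    fix x y assume "x \<in> set (xs @ [hd xs])" "y \<in> set (xs @ [hd xs])" "adj E x y"
    moreover have "set (xs @ [hd xs]) = set xs" using ne by auto
    ultimately show "adj E' (f x) (f y)" using edge by metis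
  qed
  then show ?thesis
    using cyc inj ne by (auto simp: is_cycle_def distinct_map hd_map)
qed

text \<open>
  A graph of large girth on at most \<open>n\<close> vertices of any type yields an admissible graph: rename the
  vertices and add isolated ones.
\<close>

lemma st_ge_card_edges:
  fixes G :: "'a ugraph"
  assumes G: "simple_graph G" "card (verts G) \<le> n" and l: "l \<ge> 3"
    and girth: "\<And>xs. is_cycle (edges G) xs \<Longrightarrow> l + 2 < 2 * length xs"
  shows "card (edges G) \<le> st n (cycle_graph l)"
proof -
  have "finite (verts G)" using G by (simp add: simple_graph_def)
  then obtain f where f: "f ` verts G \<subseteq> {..<n}" "inj_on f (verts G)"
    using card_le_inj[of "verts G" "{..<n}"] G(2) by auto
  define g where "g = inv_into (verts G) f"
  have gf: "g (f x) = x" if "x \<in> verts G" for x using f(2) that by (simp add: g_def)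
  have eV: "e \<subseteq> verts G" "card e = 2" if "e \<in> edges G" for e using G(1) that by (auto simp: simple_graph_def)
  define H :: "nat ugraph" where "H = ({..<n}, (`) f ` edges G)"
  have gfe: "g ` f ` e = e" if "e \<in> edges G" for e
    using eV(1)[OF that] gf by (force simp: image_image)
  have "card (f ` e) = 2" if "e \<in> edges G" for e
    using eV[OF that] f(2) by (metis card_image inj_on_subset)
  then have H: "simple_graph H" "card (verts H) = n"
    using eV(1) f(1) by (auto simp: H_def simple_graph_def) blast
  have "inj_on ((`) f) (edges G)" by (rule inj_on_inverseI[where g = "(`) g"]) (rule gfe)
  then have "card (edges H) = card (edges G)" by (simp add: H_def card_image)
  moreover have "st_admissible n (cycle_graph l) H"
  proof (rule large_girth_admissible[OF H l])
    fix xs assume xs: "is_cycle (edges H) xs"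
    have "set xs \<subseteq> f ` verts G" using is_cycle_edge[OF xs] eV by (fastforce simp: H_def)
    then have "inj_on g (set xs)" unfolding g_def by (rule inj_on_subset[OF inj_on_inv_into[OF subset_refl]])
    moreover have "{g x, g y} \<in> edges G" if xy: "{x, y} \<in> edges H" for x y
    proof -
      obtain e where e: "e \<in> edges G" "{x, y} = f ` e" using xy by (auto simp: H_def)
      then have "{g x, g y} = e" using gfe[OF e(1)] by (metis image_empty image_insert)
      then show ?thesis using e by simp
    qed
    ultimately have "is_cycle (edges G) (map g xs)" using is_cycle_map[OF xs] by blast
    from girth[OF this] show "l + 2 < 2 * length xs" by simp
  qed
  ultimately show ?thesis using st_geI by metis
qed

lemma st_cycle_graph_pos:
  assumes "n \<ge> 2" "l \<ge> 3"
  shows "1 \<le> st n (cycle_graph l)"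
proof -
  have "card (edges ({0::nat, 1}, {{0, 1}})) \<le> st n (cycle_graph l)"
  proof (rule st_ge_card_edges)
    fix xs :: "nat list" assume xs: "is_cycle (edges ({0, 1}, {{0, 1}})) xs"
    have "set xs \<subseteq> {0, 1}" using is_cycle_edge[OF xs] by auto
    from card_mono[OF _ this] have "length xs \<le> 2" using xs by (auto simp: is_cycle_def distinct_card)
    then show "l + 2 < 2 * length xs" using xs by (auto simp: is_cycle_def)
  qed (use assms in \<open>auto simp: simple_graph_def\<close>)
  then show ?thesis by simp
qed

lemma walk_in_bfs_ball:
  assumes "successively (adj E) xs" "xs \<noteq> []"
  shows "last xs \<in> bfs_ball E (hd xs) (length xs - 1)"
  using assms
proof (induction xs rule: rev_induct)
  case (snoc y ys)
  show ?case
  proof (cases "ys = []")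
    case False
    then have "last ys \<in> bfs_ball E (hd ys) (length ys - 1)" "adj E (last ys) y"
      using snoc by (auto simp: successively_append_iff)
    then have "y \<in> bfs_ball E (hd ys) (Suc (length ys - 1))" by (auto simp: nbr_def)
    then show ?thesis using False by simp
  qed simp
qed simp

text \<open>
  A short cycle created by a new edge \<open>uv\<close> comes from a short path between \<open>u\<close> and \<open>v\<close>.
\<close>

lemma new_edge_cycle:
  assumes cyc: "is_cycle (insert {u, v} E) xs" and not: "\<not> is_cycle E xs" and len: "length xs \<le> g"
  shows "v \<in> bfs_ball E u (g - 1)"
proof -
  let ?E = "insert {u, v} E"
  let ?m = "length xs"
  have m: "3 \<le> ?m" "distinct xs" using cyc by (auto simp: is_cycle_def)
  have "\<not> successively (adj E) (xs @ [hd xs])" using not m by (simp add: is_cycle_def)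
  then obtain i where i: "i < ?m" "{(xs @ [hd xs]) ! i, (xs @ [hd xs]) ! Suc i} \<notin> E"
    unfolding successively_conv_nth by auto
  define ys where "ys = rotate (Suc i) xs"
  have ys: "is_cycle ?E ys" "length ys = ?m" "distinct ys"
    using is_cycle_rotate[OF cyc, of "Suc i"] m by (simp_all add: ys_def del: rotate_Suc)
  have "ys \<noteq> []" using ys m by auto
  have hy: "hd ys = xs ! (Suc i mod ?m)" unfolding ys_def using m by (intro hd_rotate_conv_nth) auto
  have ly: "last ys = xs ! i"
  proof -
    have "last ys = xs ! ((Suc i + (?m - 1)) mod ?m)"
      using \<open>ys \<noteq> []\<close> ys(2) m by (simp add: last_conv_nth ys_def nth_rotate add.commute del: rotate_Suc)
    also have "Suc i + (?m - 1) = i + ?m" using m by simp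
    also have "(i + ?m) mod ?m = i" using i by simp
    finally show ?thesis .
  qed
  have "{last ys, hd ys} = {(xs @ [hd xs]) ! i, (xs @ [hd xs]) ! Suc i}"
  proof (cases "Suc i = ?m")
    case True
    moreover have "hd xs = xs ! 0" using m by (intro hd_conv_nth) auto
    ultimately show ?thesis using i m hy ly by (auto simp: nth_append)
  next
    case False
    then show ?thesis using i m hy ly by (auto simp: nth_append)
  qed
  moreover have "{last ys, hd ys} \<in> ?E"
    using ys(1) \<open>ys \<noteq> []\<close> by (auto simp: is_cycle_def successively_append_iff)
  ultimately have uv: "{last ys, hd ys} = {u, v}" using i by auto
  have "successively (adj E) ys"
    unfolding successively_conv_nth
  proof (intro allI impI)
    fix j assume j: "Suc j < length ys"
    have "{ys ! j, ys ! Suc j} \<in> ?E"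
      using closed_walk_nth[of "adj ?E" ys j] ys(1) j by (simp add: is_cycle_def)
    moreover have "{ys ! j, ys ! Suc j} \<noteq> {last ys, hd ys}"
    proof
      assume "{ys ! j, ys ! Suc j} = {last ys, hd ys}"
      then have "{ys ! j, ys ! Suc j} = {ys ! (?m - 1), ys ! 0}"
        using \<open>ys \<noteq> []\<close> ys(2) by (simp add: last_conv_nth hd_conv_nth)
      then consider "ys ! Suc j = ys ! 0" | "ys ! j = ys ! 0" "ys ! Suc j = ys ! (?m - 1)"
        by (auto simp: doubleton_eq_iff)
      moreover have inj: "a = b" if "ys ! a = ys ! b" "a < ?m" "b < ?m" for a b
        using that nth_eq_iff_index_eq[OF ys(3)] ys(2) by metis
      moreover have lt: "j < ?m" "0 < ?m" "Suc j < ?m" "?m - 1 < ?m" using j ys(2) m by linarith+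
      ultimately show False
      proof cases
        case 1
        from inj[OF this lt(3,2)] show False by simp
      next
        case 2
        from inj[OF 2(1) lt(1,2)] inj[OF 2(2) lt(3,4)] show False using m by linarith
      qed
    qed
    ultimately show "{ys ! j, ys ! Suc j} \<in> E" using uv by auto
  qed
  then have "last ys \<in> bfs_ball E (hd ys) (?m - 1)" "last (rev ys) \<in> bfs_ball E (hd (rev ys)) (?m - 1)"
    using walk_in_bfs_ball[of E ys] walk_in_bfs_ball[of E "rev ys"] \<open>ys \<noteq> []\<close> ys(2)
    by (simp_all add: insert_commute)
  then have "last ys \<in> bfs_ball E (hd ys) (?m - 1)" "hd ys \<in> bfs_ball E (last ys) (?m - 1)"
    using \<open>ys \<noteq> []\<close> by (simp_all add: last_rev hd_rev)
  moreover have "(u = hd ys \<and> v = last ys) \<or> (u = last ys \<and> v = hd ys)"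
    using uv by (auto simp: doubleton_eq_iff)
  moreover have "bfs_ball E u (?m - 1) \<subseteq> bfs_ball E u (g - 1)" using len by (intro bfs_ball_mono) auto
  ultimately show ?thesis by auto
qed

text \<open>
  Take a graph with the most edges among those of maximum degree at most \<open>\<Delta>\<close> without cycles of length at most
  \<open>g\<close>. Any two vertices of degree less than \<open>\<Delta>\<close> have distance less than \<open>g\<close>, as otherwise they could be
  joined. So these vertices lie in a ball of radius \<open>g - 1\<close>, which has at most \<open>n / 2\<close> elements.
\<close>

lemma exists_dense_graph_of_large_girth:
  fixes n g \<Delta> :: nat
  assumes g: "g \<ge> 2" and n: "2 * (\<Delta> + 1) ^ (g - 1) \<le> n"
  shows "\<exists>E. simple_graph ({..<n}, E) \<and> (\<forall>xs. is_cycle E xs \<longrightarrow> g < length xs) \<and> n * \<Delta> \<le> 4 * card E"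
proof -
  define Fam where "Fam = {E. simple_graph ({..<n}, E) \<and> (\<forall>v. card (nbr E v) \<le> \<Delta>) \<and> (\<forall>xs. is_cycle E xs \<longrightarrow> g < length xs)}"
  have "\<not> is_cycle {} xs" for xs :: "nat list"
    using is_cycle_edge[of "{}" xs "hd xs"] by (cases xs) (auto simp: is_cycle_def)
  then have "{} \<in> Fam" by (auto simp: Fam_def simple_graph_def nbr_def)
  have fin: "finite Fam"
    by (rule finite_subset[of _ "Pow (Pow {..<n})"]) (auto simp: Fam_def simple_graph_def)
  have "Max (card ` Fam) \<in> card ` Fam" using fin \<open>{} \<in> Fam\<close> by (intro Max_in) auto
  then obtain E where E: "E \<in> Fam" "card E = Max (card ` Fam)" by auto
  have maxE: "card E' \<le> card E" if "E' \<in> Fam" for E' using E fin that by simp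
  have e2: "card e = 2" "e \<subseteq> {..<n}" if "e \<in> E" for e using E that by (auto simp: Fam_def simple_graph_def)
  have finE: "finite E" by (rule finite_subset[of _ "Pow {..<n}"]) (use e2 in auto)
  have nbrn: "nbr E v \<subseteq> {..<n}" for v using e2 by (auto simp: nbr_def)
  have finN: "finite (nbr E v)" for v using nbrn by (rule finite_subset) simp
  have degE: "card (nbr E v) \<le> \<Delta>" for v using E by (simp add: Fam_def)
  define L where "L = {v. v < n \<and> card (nbr E v) < \<Delta>}"
  have LB: "L \<subseteq> bfs_ball E u (g - 1)" if u: "u \<in> L" for u
  proof
    fix v assume v: "v \<in> L"
    show "v \<in> bfs_ball E u (g - 1)"
    proof (rule ccontr)
      assume far: "v \<notin> bfs_ball E u (g - 1)"
      have "u \<in> bfs_ball E u (g - 1)" using bfs_ball_mono[of 0 "g - 1" E u] by auto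
      then have "u \<noteq> v" using far by auto
      have "nbr E u \<subseteq> bfs_ball E u 1" by auto
      also have "\<dots> \<subseteq> bfs_ball E u (g - 1)" using g by (intro bfs_ball_mono) auto
      finally have new: "{u, v} \<notin> E" using far by (auto simp: nbr_def)
      let ?E = "insert {u, v} E"
      have "?E \<in> Fam"
        unfolding Fam_def
      proof (intro CollectI conjI allI impI)
        show "simple_graph ({..<n}, ?E)"
          using e2 u v \<open>u \<noteq> v\<close> by (auto simp: simple_graph_def L_def)
        fix w
        have "nbr ?E w \<subseteq> nbr E w \<union> (if w = u then {v} else if w = v then {u} else {})"
          by (auto simp: nbr_def doubleton_eq_iff)
        then have "card (nbr ?E w) \<le> card (nbr E w \<union> (if w = u then {v} else if w = v then {u} else {}))"
          using finN by (intro card_mono) auto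
        also have "\<dots> \<le> card (nbr E w) + card (if w = u then {v} else if w = v then {u} else {})"
          by (rule card_Un_le)
        also have "\<dots> \<le> \<Delta>" using u v degE[of w] by (auto simp: L_def)
        finally show "card (nbr ?E w) \<le> \<Delta>" .
      next
        fix xs assume xs: "is_cycle ?E xs"
        show "g < length xs"
        proof (rule ccontr)
          assume "\<not> g < length xs"
          moreover from this have "\<not> is_cycle E xs" using E by (auto simp: Fam_def)
          ultimately have "v \<in> bfs_ball E u (g - 1)" using new_edge_cycle[OF xs] by simp
          then show False using far by simp
        qed
      qed
      from maxE[OF this] show False using new finE by simp
    qed
  qed
  have "2 * card L \<le> n"
  proof (cases "L = {}")
    case False
    then obtain u where "u \<in> L" by auto
    have "card L \<le> card (bfs_ball E u (g - 1))"
      using LB[OF \<open>u \<in> L\<close>] card_bfs_ball[OF finN degE] by (intro card_mono) auto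
    also have "\<dots> \<le> (\<Delta> + 1) ^ (g - 1)" using card_bfs_ball[OF finN degE] by simp
    finally show ?thesis using n by linarith
  qed simp
  moreover have "card ({..<n} - L) = n - card L"
    by (subst card_Diff_subset) (auto simp: L_def intro: finite_subset[of _ "{..<n}"])
  ultimately have half: "n \<le> 2 * card ({..<n} - L)" by linarith
  have "card ({..<n} - L) * \<Delta> = (\<Sum>v\<in>{..<n} - L. \<Delta>)" by simp
  also have "\<dots> \<le> (\<Sum>v\<in>{..<n} - L. card (nbr E v))" by (intro sum_mono) (auto simp: L_def not_less)
  also have "\<dots> \<le> (\<Sum>v<n. card (nbr E v))" by (intro sum_mono2) auto
  also have "\<dots> = (\<Sum>v<n. card {e\<in>E. v \<in> e})" using card_nbr[OF e2(1)] by simp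
  also have "\<dots> = 2 * card E"
  proof (rule sum_multicount[OF _ finE], simp, intro ballI)
    fix e assume "e \<in> E"
    then have "{i \<in> {..<n}. i \<in> e} = e" using e2 by auto
    then show "card {i \<in> {..<n}. i \<in> e} = 2" using e2 \<open>e \<in> E\<close> by auto
  qed
  finally have "card ({..<n} - L) * \<Delta> \<le> 2 * card E" .
  moreover have "n * \<Delta> \<le> 2 * card ({..<n} - L) * \<Delta>" using half by (intro mult_right_mono) auto
  ultimately have "n * \<Delta> \<le> 4 * card E" by linarith
  then show ?thesis using E by (intro exI[of _ E]) (auto simp: Fam_def)
qed

text \<open>
  A lower bound \<open>c q\<^bsup>s+1\<^esup>\<close> for \<open>n \<ge> 2 q\<^bsup>s\<^esup>\<close>, for the powers \<open>q\<close> of two only, is enough for the order of magnitude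
  \<open>n\<^bsup>1+1/s\<^esup>\<close>, as consecutive powers of two differ by a constant factor. The bound \<open>1 \<le> F n\<close> covers
  the small \<open>n\<close>, for which no power with \<open>m \<ge> 1\<close> is available.
\<close>

lemma lower_bound_from_powers_of_two:
  fixes F :: "nat \<Rightarrow> real" and s :: nat and c :: real
  assumes s: "s \<ge> 1" and c: "c > 0"
    and pow: "\<And>m n. m \<ge> 1 \<Longrightarrow> 2 * (2 ^ m) ^ s \<le> n \<Longrightarrow> c * (2 ^ m) ^ (s + 1) \<le> F n"
    and one: "\<And>n. n \<ge> 2 \<Longrightarrow> 1 \<le> F n"
  shows "\<exists>c'>0. \<forall>n\<ge>2. c' * real n powr (1 + 1 / s) \<le> F n"
proof -
  define c0 where "c0 = min c 1"
  have c0: "c0 > 0" "c0 \<le> c" "c0 \<le> 1" using c by (auto simp: c0_def)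
  define c' where "c' = c0 / (4 * 2 ^ (s + 1))"
  have "c' * real n powr (1 + 1 / s) \<le> F n" if n: "n \<ge> 2" for n
  proof -
    define t where "t = (real n / 2) powr (1 / s)"
    have t1: "t \<ge> 1" using n by (simp add: t_def ge_one_powr_ge_zero)
    have ts: "t ^ s = real n / 2" using n s by (simp add: t_def powr_powr flip: powr_realpow)
    obtain k where "t < 2 ^ k" using real_arch_pow[of 2 t] by auto
    define k0 where "k0 = (LEAST k. t < 2 ^ k)"
    have k0: "t < 2 ^ k0" unfolding k0_def using \<open>t < 2 ^ k\<close> by (rule LeastI)
    have "k0 \<noteq> 0" using k0 t1 by (intro notI) simp
    then obtain m where m: "k0 = Suc m" by (cases k0) auto
    have "\<not> t < 2 ^ m" unfolding k0_def using m k0_def not_less_Least[of m "\<lambda>k. t < 2 ^ k"] by simp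
    then have mt: "2 ^ m \<le> t" "t \<le> 2 * 2 ^ m" using k0 m by auto
    have "c0 * (2 ^ m) ^ (s + 1) \<le> F n"
    proof (cases "m = 0")
      case True
      then show ?thesis using one[OF n] c0 by simp
    next
      case False
      have "2 * (2 ^ m) ^ s \<le> 2 * t ^ s" using mt by (intro mult_left_mono power_mono) auto
      then have "real (2 * (2 ^ m) ^ s) \<le> real n" using ts by simp
      then have "2 * (2 ^ m) ^ s \<le> n" by (simp only: of_nat_le_iff)
      then have "c * (2 ^ m) ^ (s + 1) \<le> F n" using pow[of m n] False by simp
      moreover have "c0 * (2 ^ m) ^ (s + 1) \<le> c * (2 ^ m) ^ (s + 1)" using c0 by (intro mult_right_mono) auto
      ultimately show ?thesis by linarith
    qed
    moreover have "c' * real n powr (1 + 1 / s) \<le> c0 * (2 ^ m) ^ (s + 1)"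
    proof -
      have "real n powr (1 + 1 / s) = (2 * t ^ s) powr (1 + 1 / s)" by (simp add: ts)
      also have "\<dots> = 2 powr (1 + 1 / s) * (t powr s) powr (1 + 1 / s)"
        using t1 by (simp add: powr_mult powr_realpow)
      also have "(t powr s) powr (1 + 1 / s) = t powr (s + 1)" 
      proof -
        have "real s * (1 + 1 / real s) = real (s + 1)" using s by (simp add: distrib_left)
        then show ?thesis by (simp only: powr_powr)
      qed
      also have "t powr (s + 1) = t ^ (s + 1)" using t1 powr_realpow[of t "s + 1"] by simp
      also have "2 powr (1 + 1 / real s) * t ^ (s + 1) \<le> 2 powr 2 * t ^ (s + 1)"
        using s t1 by (intro mult_right_mono powr_mono) auto
      also have "\<dots> \<le> 4 * (2 * 2 ^ m) ^ (s + 1)"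
      proof -
        have "t ^ (s + 1) \<le> (2 * 2 ^ m) ^ (s + 1)" using mt(2) t1 by (intro power_mono) auto
        then show ?thesis by simp
      qed
      finally have "real n powr (1 + 1 / s) \<le> 4 * 2 ^ (s + 1) * (2 ^ m) ^ (s + 1)"
        by (simp only: power_mult_distrib mult.assoc)
      then have "c' * real n powr (1 + 1 / s) \<le> c' * (4 * 2 ^ (s + 1) * (2 ^ m) ^ (s + 1))"
        using c0 by (intro mult_left_mono) (auto simp: c'_def)
      also have "\<dots> = c0 * (2 ^ m) ^ (s + 1)" by (simp add: c'_def)
      finally show ?thesis .
    qed
    ultimately show ?thesis by linarith
  qed
  then show ?thesis using c0 by (intro exI[of _ c']) (auto simp: c'_def)
qed

lemma st_lower_bound_greedy:
  fixes g l :: nat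
  assumes g: "g \<ge> 3" and l: "l \<ge> 3" "l < 2 * g"
  shows "\<exists>c>0. \<forall>n\<ge>2. c * real n powr (1 + 1 / real (g - 1)) \<le> real (st n (cycle_graph l))"
proof (rule lower_bound_from_powers_of_two[where c = "1 / 4"])
  fix m n :: nat assume m: "m \<ge> 1" and n: "2 * (2 ^ m) ^ (g - 1) \<le> n"
  define \<Delta> :: nat where "\<Delta> = 2 ^ m - 1"
  have D: "\<Delta> + 1 = 2 ^ m" "2 ^ m \<le> 2 * \<Delta>"
    using power_increasing[of 1 m "2::nat"] m by (auto simp: \<Delta>_def)
  obtain E where E: "simple_graph ({..<n}, E)" "\<forall>xs. is_cycle E xs \<longrightarrow> g < length xs" "n * \<Delta> \<le> 4 * card E"
    using exists_dense_graph_of_large_girth[of g \<Delta> n] g n D by auto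
  have "card (edges ({..<n}, E)) \<le> st n (cycle_graph l)"
  proof (rule st_ge_card_edges)
    fix xs assume "is_cycle (edges ({..<n}, E)) xs"
    then have "g < length xs" using E by simp
    then show "l + 2 < 2 * length xs" using l by linarith
  qed (use E l in auto)
  then have "n * \<Delta> \<le> 4 * st n (cycle_graph l)" using E(3) by simp
  moreover have "(2 ^ m) ^ (g - 1) * 2 ^ m \<le> n * \<Delta>"
  proof -
    have "(2 ^ m) ^ (g - 1) * 2 ^ m \<le> (2 ^ m) ^ (g - 1) * (2 * \<Delta>)" using D by simp
    also have "\<dots> \<le> n * \<Delta>" using n by (simp add: mult.assoc[symmetric] mult.commute)
    finally show ?thesis .
  qed
  ultimately have "(2 ^ m) ^ (g - 1) * 2 ^ m \<le> 4 * st n (cycle_graph l)" by linarith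
  then have "real ((2 ^ m) ^ (g - 1) * 2 ^ m) \<le> real (4 * st n (cycle_graph l))" by (simp only: of_nat_le_iff)
  then have "(2 ^ m) ^ (g - 1) * 2 ^ m \<le> 4 * real (st n (cycle_graph l))" by simp
  then show "1 / 4 * (2 ^ m) ^ (g - 1 + 1) \<le> real (st n (cycle_graph l))"
    by (simp only: power_add power_one_right)
qed (use g l st_cycle_graph_pos in \<open>auto simp: Suc_le_eq\<close>)

section \<open>Finite fields and Vandermonde systems\<close>

text \<open>
  The field of order \<open>2\<^bsup>m\<^esup>\<close>, as the set of roots of \<open>X\<^bsup>q\<^esup> - X\<close>, \<open>q = 2\<^bsup>m\<^esup>\<close>, in an algebraic closure of the field with two
  elements. The roots are simple because the derivative is \<open>-1\<close>.
\<close>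

lemma exists_field_of_power_of_two_order:
  fixes m :: nat
  assumes "m \<ge> 1"
  shows "\<exists>K :: bit alg_closure set. finite K \<and> card K = 2 ^ m \<and>
    (\<forall>x\<in>K. \<forall>y\<in>K. x + y \<in> K \<and> x - y \<in> K \<and> x * y \<in> K)"
proof -
  define q :: nat where "q = 2 ^ m"
  have q: "q \<ge> 2" using assms power_increasing[of 1 m "2::nat"] by (simp add: q_def)
  define K where "K = {x :: bit alg_closure. x ^ q = x}"
  have two: "(2 :: bit alg_closure) = 0"
  proof -
    have "to_ac (2 :: bit) = to_ac 0" by (simp only: bit_numeral_even)
    then show ?thesis by (simp only: to_ac_numeral to_ac_0)
  qed
  then have dbl: "x + x = 0" for x :: "bit alg_closure" by (simp flip: mult_2)
  have neg: "- x = x" for x :: "bit alg_closure" using dbl[of x] by (simp add: minus_unique)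
  have sq: "(x + y) ^ (2 ^ j) = x ^ (2 ^ j) + y ^ (2 ^ j)" for x y :: "bit alg_closure" and j
  proof (induction j)
    case (Suc j)
    have "(x + y) ^ (2 ^ Suc j) = ((x + y) ^ (2 ^ j))\<^sup>2" by (simp add: mult.commute flip: power_mult)
    also have "\<dots> = (x ^ (2 ^ j))\<^sup>2 + (y ^ (2 ^ j))\<^sup>2" by (simp add: Suc power2_sum two)
    also have "\<dots> = x ^ (2 ^ Suc j) + y ^ (2 ^ Suc j)" by (simp add: mult.commute flip: power_mult)
    finally show ?case .
  qed simp
  have closed: "x + y \<in> K \<and> x - y \<in> K \<and> x * y \<in> K" if "x \<in> K" "y \<in> K" for x y
  proof -
    have "x + y \<in> K" "x * y \<in> K" using that by (auto simp: K_def q_def sq power_mult_distrib)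
    moreover from this have "x - y \<in> K" by (metis diff_conv_add_uminus neg)
    ultimately show ?thesis by blast
  qed
  define p :: "bit alg_closure poly" where "p = monom 1 q - monom 1 1"
  have root: "poly p x = 0 \<longleftrightarrow> x \<in> K" for x by (simp add: p_def K_def poly_monom)
  have deg: "degree p = q"
    unfolding p_def diff_conv_add_uminus using q by (subst degree_add_eq_left) (auto simp: degree_monom_eq)
  then have p0: "p \<noteq> 0" using q by auto
  have "of_nat q = (0 :: bit alg_closure)" using assms two by (simp add: q_def)
  then have der: "poly (pderiv p) x = - 1" for x
    by (simp add: p_def pderiv_diff pderiv_monom poly_monom)
  obtain A where A: "size A = degree p" "p = smult (lead_coeff p) (\<Prod>x\<in>#A. [:-x, 1:])"
    using alg_closed_imp_factorization[OF p0] by blast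
  have "set_mset A = K"
  proof -
    have "poly p x = lead_coeff p * (\<Prod>y\<in>#A. x - y)" for x
      by (subst A(2)) (simp add: poly_prod_mset image_mset.compositionality o_def)
    then have "x \<in> K \<longleftrightarrow> 0 \<in> (-) x ` set_mset A" for x
      unfolding root[symmetric] using p0 by (simp add: prod_mset_zero_iff)
    then show ?thesis by (auto simp: image_iff)
  qed
  have "count A x \<le> 1" for x
  proof (rule ccontr)
    assume "\<not> count A x \<le> 1"
    then obtain B where B: "A = add_mset x (add_mset x B)"
      by (metis One_nat_def count_add_mset count_greater_zero_iff diff_Suc_1 insert_DiffM less_Suc0 linorder_not_less not_gr_zero zero_less_diff diff_is_0_eq le_SucI multi_member_split order.refl nat_le_linear)
    define r where "r = smult (lead_coeff p) (\<Prod>x\<in>#B. [:-x, 1:])"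
    have "p = [:-x, 1:] * ([:-x, 1:] * r)"
      by (subst A(2)) (simp add: B r_def)
    moreover have "poly (pderiv ([:-x, 1:] * g)) x = poly g x" for g
      unfolding pderiv_mult by (simp add: pderiv_pCons)
    ultimately have "poly (pderiv p) x = poly ([:-x, 1:] * r) x" by (simp only:)
    then have "poly (pderiv p) x = 0" by (simp only: poly_mult) simp
    then show False using der by simp
  qed
  then have "count A x = count (mset_set (set_mset A)) x" for x
    by (metis count_mset_set(1,3) finite_set_mset le_less_Suc_eq less_one count_eq_zero_iff One_nat_def le_antisym not_gr_zero Suc_leI)
  then have "A = mset_set (set_mset A)" by (rule multiset_eqI)
  then have "card K = q" using A(1) deg \<open>set_mset A = K\<close> by (metis size_mset_set)
  moreover have "finite K" using \<open>set_mset A = K\<close> by (metis finite_set_mset)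
  ultimately show ?thesis using closed by (intro exI[of _ K]) (auto simp: q_def)
qed

text \<open>
  If as many initial moments vanish as there are weights, then so does the weight at an abscissa that differs
  from all the others. The others need not be distinct.
\<close>

lemma vandermonde_two:
  fixes x0 x1 d0 d1 :: "'a :: idom"
  assumes "d0 + d1 = 0" "x0 * d0 + x1 * d1 = 0" "x0 \<noteq> x1"
  shows "d0 = 0"
proof -
  have "(x0 - x1) * d0 = (x0 * d0 + x1 * d1) - x1 * (d0 + d1)" by (simp add: algebra_simps)
  then show ?thesis using assms by simp
qed

lemma vandermonde_three:
  fixes x0 x1 x2 d0 d1 d2 :: "'a :: idom"
  assumes "d0 + d1 + d2 = 0" "x0 * d0 + x1 * d1 + x2 * d2 = 0" "x0^2 * d0 + x1^2 * d1 + x2^2 * d2 = 0"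
    "x0 \<noteq> x1" "x0 \<noteq> x2"
  shows "d0 = 0"
proof -
  have "(x0 - x1) * (x0 - x2) * d0 = (x0^2 * d0 + x1^2 * d1 + x2^2 * d2)
      - (x1 + x2) * (x0 * d0 + x1 * d1 + x2 * d2) + x1 * x2 * (d0 + d1 + d2)"
    by (simp add: algebra_simps power2_eq_square)
  then show ?thesis using assms by simp
qed

lemma vandermonde_four:
  fixes x0 x1 x2 x3 d0 d1 d2 d3 :: "'a :: idom"
  assumes "d0 + d1 + d2 + d3 = 0" "x0 * d0 + x1 * d1 + x2 * d2 + x3 * d3 = 0"
    "x0^2 * d0 + x1^2 * d1 + x2^2 * d2 + x3^2 * d3 = 0" "x0^3 * d0 + x1^3 * d1 + x2^3 * d2 + x3^3 * d3 = 0"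
    "x0 \<noteq> x1" "x0 \<noteq> x2" "x0 \<noteq> x3"
  shows "d0 = 0"
proof -
  have "(x0 - x1) * (x0 - x2) * (x0 - x3) * d0 = (x0^3 * d0 + x1^3 * d1 + x2^3 * d2 + x3^3 * d3)
      - (x1 + x2 + x3) * (x0^2 * d0 + x1^2 * d1 + x2^2 * d2 + x3^2 * d3)
      + (x1 * x2 + x1 * x3 + x2 * x3) * (x0 * d0 + x1 * d1 + x2 * d2 + x3 * d3) - x1 * x2 * x3 * (d0 + d1 + d2 + d3)"
    by (simp add: algebra_simps power2_eq_square power3_eq_cube)
  then show ?thesis using assms by simp
qed

text \<open>
  Five abscissae in cyclic order, adjacent ones distinct, with nonzero weights whose first four moments vanish.
  If two abscissae that are not adjacent were equal, there would be at most four different ones, and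
  one of them would occur only once; by Vandermonde its weight would vanish.
\<close>

lemma nonadjacent_abscissae_distinct:
  fixes x0 x1 x2 x3 x4 d0 d1 d2 d3 d4 :: "'a :: idom"
  assumes m: "d0 + d1 + d2 + d3 + d4 = 0" "x0 * d0 + x1 * d1 + x2 * d2 + x3 * d3 + x4 * d4 = 0"
    "x0^2 * d0 + x1^2 * d1 + x2^2 * d2 + x3^2 * d3 + x4^2 * d4 = 0"
    "x0^3 * d0 + x1^3 * d1 + x2^3 * d2 + x3^3 * d3 + x4^3 * d4 = 0"
    and ne: "x0 \<noteq> x1" "x1 \<noteq> x2" "x2 \<noteq> x3" "x3 \<noteq> x4" "x4 \<noteq> x0"
    and d: "d1 \<noteq> 0" "d3 \<noteq> 0" "d4 \<noteq> 0"
  shows "x0 \<noteq> x2"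
proof
  assume eq: "x0 = x2"
  show False
  proof (cases "x1 = x3 \<or> x1 = x4")
    case False
    have "d1 = 0"
      by (rule vandermonde_four[of d1 "d0 + d2" d3 d4 x1 x0 x3 x4])
        (use m ne eq False in \<open>auto simp: algebra_simps\<close>)
    then show False using d by simp
  next
    case True
    then show False
    proof
      assume 1: "x1 = x3"
      have "d4 = 0"
        by (rule vandermonde_three[of d4 "d0 + d2" "d1 + d3" x4 x0 x1])
          (use m ne eq 1 in \<open>auto simp: algebra_simps\<close>)
      then show False using d by simp
    next
      assume 1: "x1 = x4"
      have "d3 = 0"
        by (rule vandermonde_three[of d3 "d0 + d2" "d1 + d4" x3 x0 x1])
          (use m ne eq 1 in \<open>auto simp: algebra_simps\<close>)
      then show False using d by simp
    qed
  qed
qed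

text \<open>
  By the equations for the \<open>d\<^sub>i\<close> the left-hand side is \<open>c\<^sup>2\<close> times a sum of six fractions in the \<open>u\<^sub>i\<close> and the
  differences \<open>p\<^sub>i\<^sub>j = u\<^sub>i - u\<^sub>j\<close>, which
  collapses by the Ptolemy relation \<open>p\<^sub>0\<^sub>2 p\<^sub>1\<^sub>3 = p\<^sub>0\<^sub>1 p\<^sub>2\<^sub>3 + p\<^sub>0\<^sub>3 p\<^sub>1\<^sub>2\<close>.
\<close>

lemma pentagon_identity:
  fixes u0 u1 u2 u3 c d0 d1 d2 d3 :: "'a :: field"
  assumes ne: "u0 \<noteq> 0" "u1 \<noteq> 0" "u2 \<noteq> 0" "u3 \<noteq> 0" "u0 \<noteq> u1" "u0 \<noteq> u2" "u0 \<noteq> u3" "u1 \<noteq> u2" "u1 \<noteq> u3" "u2 \<noteq> u3"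
    and d: "d0 * (u0 * (u0 - u1) * (u0 - u2) * (u0 - u3)) = c" "d1 * (u1 * (u1 - u0) * (u1 - u2) * (u1 - u3)) = c"
      "d2 * (u2 * (u2 - u0) * (u2 - u1) * (u2 - u3)) = c" "d3 * (u3 * (u3 - u0) * (u3 - u1) * (u3 - u2)) = c"
  shows "(d0 * d1 * (u0 - u1)^2 * u1 + d0 * d2 * (u0 - u2)^2 * u2 + d0 * d3 * (u0 - u3)^2 * u3 +
     d1 * d2 * (u1 - u2)^2 * u2 + d1 * d3 * (u1 - u3)^2 * u3 + d2 * d3 * (u2 - u3)^2 * u3) *
     ((u0 - u2) * (u0 - u3) * (u1 - u3) * u1 * u2) = - (c^2)"
proof -
  define p01 p02 p03 p12 p13 p23 where p: "p01 = u0 - u1" "p02 = u0 - u2" "p03 = u0 - u3" "p12 = u1 - u2"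
    "p13 = u1 - u3" "p23 = u2 - u3"
  have nz: "p01 \<noteq> 0" "p02 \<noteq> 0" "p03 \<noteq> 0" "p12 \<noteq> 0" "p13 \<noteq> 0" "p23 \<noteq> 0" using ne by (auto simp: p)
  have m: "u1 - u0 = - p01" "u2 - u0 = - p02" "u3 - u0 = - p03" "u2 - u1 = - p12" "u3 - u1 = - p13" "u3 - u2 = - p23"
    by (auto simp: p)
  have "d1 * (u1 * p01 * p12 * p13) = - (d1 * (u1 * - p01 * p12 * p13))"
    "d3 * (u3 * p03 * p13 * p23) = - (d3 * (u3 * - p03 * - p13 * - p23))" by simp_all
  then have d13: "d1 * (u1 * p01 * p12 * p13) = - c" "d3 * (u3 * p03 * p13 * p23) = - c"
    using d(2,4) unfolding m p[symmetric] by (simp_all only:)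
  have d02: "d0 * (u0 * p01 * p02 * p03) = c" "d2 * (u2 * p02 * p12 * p23) = c"
    using d(1,3) unfolding m p[symmetric] by simp_all
  have dd: "d0 = c / (u0 * p01 * p02 * p03)" "d1 = - c / (u1 * p01 * p12 * p13)"
      "d2 = c / (u2 * p02 * p12 * p23)" "d3 = - c / (u3 * p03 * p13 * p23)"
    by (rule eq_divide_imp[OF _ d02(1)] eq_divide_imp[OF _ d13(1)] eq_divide_imp[OF _ d02(2)] eq_divide_imp[OF _ d13(2)],
        use ne nz in simp)+
  define R where "R = p02 * p03 * p13 * u1 * u2"
  note nz' = nz ne(1-4)
  have t: "d0 * d1 * p01^2 * u1 * R = - (c^2 * u1 * u2 / (u0 * p12))"
     "d0 * d2 * p02^2 * u2 * R = c^2 * p02 * p13 * u1 * u2 / (u0 * p01 * p12 * p23)"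
     "d0 * d3 * p03^2 * u3 * R = - (c^2 * p03 * u1 * u2 / (u0 * p01 * p23))"
     "d1 * d2 * p12^2 * u2 * R = - (c^2 * p03 * u2 / (p01 * p23))"
     "d1 * d3 * p13^2 * u3 * R = c^2 * p02 * p13 * u2 / (p01 * p12 * p23)"
     "d2 * d3 * p23^2 * u3 * R = - (c^2 * u1 / p12)"
    using nz' by (simp_all add: dd R_def power2_eq_square divide_simps)
  have "(d0 * d1 * p01^2 * u1 + d0 * d2 * p02^2 * u2 + d0 * d3 * p03^2 * u3 + d1 * d2 * p12^2 * u2 +
      d1 * d3 * p13^2 * u3 + d2 * d3 * p23^2 * u3) * R =
      c^2 * (p02 * p13 * (u1 * u2 + u0 * u2) - u1 * u2 * p01 * p23 - p03 * p12 * (u1 * u2 + u0 * u2) - u0 * u1 * p01 * p23)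
        / (u0 * p01 * p12 * p23)"
    using nz' by (simp only: distrib_right t) (simp add: field_simps)
  also have "p02 * p13 * (u1 * u2 + u0 * u2) - u1 * u2 * p01 * p23 - p03 * p12 * (u1 * u2 + u0 * u2) - u0 * u1 * p01 * p23
      = - (u0 * p01 * p12 * p23)"
    by (simp add: p algebra_simps)
  also have "c^2 * - (u0 * p01 * p12 * p23) / (u0 * p01 * p12 * p23) = - (c^2)" using nz' by simp
  finally show ?thesis by (simp only: p R_def)
qed

section \<open>Incidence graphs\<close>

text \<open>
  The bipartite graph of an incidence relation between points and lines, and the cycles of length \<open>2r\<close> in it:
  \<open>p i\<close> and \<open>p (i + 1)\<close> lie on \<open>l i\<close>, with indices modulo \<open>r\<close>. Only consecutive points and consecutive
  lines are required to be distinct.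
\<close>

definition incidence_graph :: "'p set \<Rightarrow> 'l set \<Rightarrow> ('p \<Rightarrow> 'l \<Rightarrow> bool) \<Rightarrow> ('p + 'l) ugraph" where
  "incidence_graph P L I = (Inl ` P \<union> Inr ` L, {{Inl p, Inr l} |p l. p \<in> P \<and> l \<in> L \<and> I p l})"

definition incidence_cycle :: "('p \<Rightarrow> 'l \<Rightarrow> bool) \<Rightarrow> nat \<Rightarrow> (nat \<Rightarrow> 'p) \<Rightarrow> (nat \<Rightarrow> 'l) \<Rightarrow> bool" where
  "incidence_cycle I r p l \<longleftrightarrow> (\<forall>i<r. I (p i) (l i) \<and> I (p (Suc i mod r)) (l i) \<and>
     p i \<noteq> p (Suc i mod r) \<and> l i \<noteq> l (Suc i mod r))"

lemma edge_incidence_graph: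
  "{Inl p, Inr l} \<in> edges (incidence_graph P L I) \<longleftrightarrow> p \<in> P \<and> l \<in> L \<and> I p l"
  "{Inr l, Inl p} \<in> edges (incidence_graph P L I) \<longleftrightarrow> p \<in> P \<and> l \<in> L \<and> I p l"
  "{Inl p, Inl p'} \<notin> edges (incidence_graph P L I)"
  "{Inr l, Inr l'} \<notin> edges (incidence_graph P L I)"
  by (auto simp: incidence_graph_def doubleton_eq_iff)

lemma cycle_in_incidence_graph:
  assumes "is_cycle (edges (incidence_graph P L I)) xs"
  obtains r p l where "r \<ge> 2" "length xs = 2 * r" "incidence_cycle I r p l"
proof -
  let ?E = "edges (incidence_graph P L I)"
  \<comment> \<open>Rotate the cycle so that it starts with a point.\<close>
  obtain zs where zs: "is_cycle ?E zs" "length zs = length xs" "isl (zs ! 0)"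
  proof (cases "isl (xs ! 0)")
    case True
    then show ?thesis using that assms by blast
  next
    case False
    have "2 < length xs" using assms by (auto simp: is_cycle_def)
    then have "{xs ! 0, xs ! Suc 0} \<in> ?E"
      using closed_walk_nth[of "adj ?E" xs 0] assms by (force simp: is_cycle_def)
    then have "isl (xs ! Suc 0)"
      using False by (cases "xs ! 0"; cases "xs ! Suc 0") (auto simp: edge_incidence_graph)
    moreover have "rotate1 xs ! 0 = xs ! (Suc 0 mod length xs)"
      by (rule nth_rotate1) (use \<open>2 < length xs\<close> in linarith)
    ultimately have "isl (rotate1 xs ! 0)" using \<open>2 < length xs\<close> by simp
    then show ?thesis using that[of "rotate1 xs"] is_cycle_rotate1[OF assms] by simp
  qed
  define m where "m = length zs"
  have m: "3 \<le> m" "distinct zs" using zs(1) by (auto simp: is_cycle_def m_def)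
  have edge: "{zs ! i, zs ! (Suc i mod m)} \<in> ?E" if "i < m" for i
    using closed_walk_nth[of "adj ?E" zs i] zs(1) that by (simp add: is_cycle_def m_def)
  have alt: "isl a \<longleftrightarrow> \<not> isl b" if "{a, b} \<in> ?E" for a b
    using that by (cases a; cases b) (auto simp: edge_incidence_graph)
  have par: "isl (zs ! i) \<longleftrightarrow> even i" if "i < m" for i
    using that
  proof (induction i)
    case (Suc i)
    then show ?case using alt[OF edge[of i]] by (simp, blast)
  qed (use zs in simp)
  have "even m"
  proof -
    have "isl (zs ! (m - 1)) \<longleftrightarrow> \<not> isl (zs ! 0)" using alt[OF edge[of "m - 1"]] m by simp
    then have "odd (m - 1)" using par[of "m - 1"] par[of 0] m by simp
    then show ?thesis using m by simp
  qed
  then obtain r where r: "m = 2 * r" by (elim evenE)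
  define p where "p i = projl (zs ! (2 * i))" for i
  define l where "l i = projr (zs ! Suc (2 * i))" for i
  have zp: "zs ! (2 * i) = Inl (p i)" if "i < r" for i
    using par[of "2 * i"] that r by (simp add: p_def)
  have zl: "zs ! Suc (2 * i) = Inr (l i)" if "i < r" for i
    using par[of "Suc (2 * i)"] that r by (cases "zs ! Suc (2 * i)") (auto simp: l_def)
  have r2: "r \<ge> 2" using m r by simp
  have next_mod: "Suc (Suc (2 * i)) mod m = 2 * (Suc i mod r)" for i
    using mult_mod_right[of 2 "Suc i" r] r by simp
  have "incidence_cycle I r p l"
    unfolding incidence_cycle_def
  proof (intro allI impI)
    fix i assume i: "i < r"
    define i' where "i' = Suc i mod r"
    have i': "i' < r" "i \<noteq> i'" using r2 i by (auto simp: i'_def mod_Suc)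
    have "{Inl (p i), Inr (l i)} \<in> ?E" using edge[of "2 * i"] i r zp[OF i] zl[OF i] by simp
    moreover have "{Inr (l i), Inl (p i')} \<in> ?E"
      using edge[of "Suc (2 * i)"] i r zp[OF i'(1)] zl[OF i] next_mod[of i] by (simp add: i'_def)
    moreover have "zs ! (2 * i) \<noteq> zs ! (2 * i')" "zs ! Suc (2 * i) \<noteq> zs ! Suc (2 * i')"
      using m(2) i i' r by (auto simp: nth_eq_iff_index_eq m_def)
    ultimately show "I (p i) (l i) \<and> I (p (Suc i mod r)) (l i) \<and> p i \<noteq> p (Suc i mod r) \<and> l i \<noteq> l (Suc i mod r)"
      using zp i i' zl by (auto simp: edge_incidence_graph simp flip: i'_def)
  qed
  then show ?thesis using that r2 r zs(2) by (simp add: m_def)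
qed

lemma st_ge_incidences:
  assumes fin: "finite P" "finite L" and n: "card P + card L \<le> n" and l: "l \<ge> 3" "l \<le> 4 * k"
    and no: "\<And>r p q. 2 \<le> r \<Longrightarrow> r \<le> k \<Longrightarrow> \<not> incidence_cycle I r p q"
    and deg: "\<And>p. p \<in> P \<Longrightarrow> card {q\<in>L. I p q} = d"
  shows "card P * d \<le> st n (cycle_graph l)"
proof -
  let ?G = "incidence_graph P L I"
  have "edges ?G = (\<lambda>(p, q). {Inl p, Inr q}) ` (SIGMA p:P. {q\<in>L. I p q})"
    by (auto simp: incidence_graph_def)
  moreover have "inj_on (\<lambda>(p, q). {Inl p, Inr q}) (SIGMA p:P. {q\<in>L. I p q})"
    by (auto simp: inj_on_def doubleton_eq_iff)
  ultimately have "card (edges ?G) = card (SIGMA p:P. {q\<in>L. I p q})" by (simp add: card_image)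
  also have "\<dots> = (\<Sum>p\<in>P. card {q\<in>L. I p q})" using fin by (intro card_SigmaI) auto
  also have "\<dots> = card P * d" using deg by simp
  finally have "card P * d = card (edges ?G)" by simp
  also have "\<dots> \<le> st n (cycle_graph l)"
  proof (rule st_ge_card_edges)
    show "simple_graph ?G" using fin by (auto simp: simple_graph_def incidence_graph_def)
    have "card (verts ?G) \<le> card P + card L"
      using card_Un_le[of "Inl ` P" "Inr ` L"] by (simp add: incidence_graph_def card_image)
    then show "card (verts ?G) \<le> n" using n by simp
  next
    fix xs assume "is_cycle (edges ?G) xs"
    then obtain r p q where "r \<ge> 2" "length xs = 2 * r" "incidence_cycle I r p q"
      by (rule cycle_in_incidence_graph)
    then show "l + 2 < 2 * length xs" using no[of r p q] l by fastforce
  qed (use l in simp)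
  finally show ?thesis .
qed

section \<open>Generalized polygons in coordinates\<close>

text \<open>
  Weights on five abscissae whose first four moments vanish are determined up to a common factor \<open>c\<close>:
  the weight at \<open>x\<^sub>i\<close> times the product of all \<open>x\<^sub>i - x\<^sub>j\<close> with \<open>j \<noteq> i\<close> equals \<open>c\<close>.
\<close>

lemma lagrange_weights:
  fixes x0 x1 x2 x3 x4 d0 d1 d2 d3 d4 :: "'a :: idom"
  assumes m: "d0 + d1 + d2 + d3 + d4 = 0" "x0 * d0 + x1 * d1 + x2 * d2 + x3 * d3 + x4 * d4 = 0"
    "x0^2 * d0 + x1^2 * d1 + x2^2 * d2 + x3^2 * d3 + x4^2 * d4 = 0"
    "x0^3 * d0 + x1^3 * d1 + x2^3 * d2 + x3^3 * d3 + x4^3 * d4 = 0"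
  shows "d0 * ((x0 - x4) * (x0 - x1) * (x0 - x2) * (x0 - x3)) = d4 * ((x4 - x0) * (x4 - x1) * (x4 - x2) * (x4 - x3))"
proof -
  have "d0 * ((x0 - x1) * (x0 - x2) * (x0 - x3)) + d4 * ((x4 - x1) * (x4 - x2) * (x4 - x3)) =
      (x0^3 * d0 + x1^3 * d1 + x2^3 * d2 + x3^3 * d3 + x4^3 * d4)
      - (x1 + x2 + x3) * (x0^2 * d0 + x1^2 * d1 + x2^2 * d2 + x3^2 * d3 + x4^2 * d4)
      + (x1 * x2 + x1 * x3 + x2 * x3) * (x0 * d0 + x1 * d1 + x2 * d2 + x3 * d3 + x4 * d4)
      - x1 * x2 * x3 * (d0 + d1 + d2 + d3 + d4)"
    by (simp add: algebra_simps power2_eq_square power3_eq_cube)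
  then have "d0 * ((x0 - x1) * (x0 - x2) * (x0 - x3)) = - (d4 * ((x4 - x1) * (x4 - x2) * (x4 - x3)))"
    by (simp add: m add_eq_0_iff2)
  then have "(x0 - x4) * (d0 * ((x0 - x1) * (x0 - x2) * (x0 - x3))) = (x4 - x0) * (d4 * ((x4 - x1) * (x4 - x2) * (x4 - x3)))"
    by (simp add: left_diff_distrib)
  then show ?thesis by (simp only: mult_ac)
qed

text \<open>
  Here \<open>y\<^sub>i\<close>, \<open>m\<^sub>i\<close>, \<open>n\<^sub>i\<close> are the partial sums of \<open>d\<^sub>i\<close>, \<open>x\<^sub>i d\<^sub>i\<close>, \<open>x\<^sub>i\<^sup>2 d\<^sub>i\<close>, up to the constants \<open>y\<^sub>4\<close>, \<open>m\<^sub>4\<close>, \<open>n\<^sub>4\<close>. The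
  contribution of these constants vanishes by the moment conditions. Without them, \<open>y\<^sub>i n\<^sub>i - m\<^sub>i\<^sup>2\<close> is the sum
  of \<open>d\<^sub>a d\<^sub>b (x\<^sub>a - x\<^sub>b)\<^sup>2\<close> over \<open>a < b \<le> i\<close> by the identity of Lagrange, and summation by parts gives the
  conclusion.
\<close>

lemma quadratic_condition:
  fixes x0 x1 x2 x3 x4 d0 d1 d2 d3 d4 y0 y1 y2 y3 y4 m0 m1 m2 m3 m4 n0 n1 n2 n3 n4 :: "'a :: comm_ring_1"
  assumes y: "y0 = y4 + d0" "y1 = y0 + d1" "y2 = y1 + d2" "y3 = y2 + d3"
    and m: "m0 = m4 + x0 * d0" "m1 = m0 + x1 * d1" "m2 = m1 + x2 * d2" "m3 = m2 + x3 * d3"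
    and n: "n0 = n4 + x0^2 * d0" "n1 = n0 + x1^2 * d1" "n2 = n1 + x2^2 * d2" "n3 = n2 + x3^2 * d3"
    and mom: "d0 + d1 + d2 + d3 + d4 = 0" "x0 * d0 + x1 * d1 + x2 * d2 + x3 * d3 + x4 * d4 = 0"
      "x0^2 * d0 + x1^2 * d1 + x2^2 * d2 + x3^2 * d3 + x4^2 * d4 = 0"
      "x0^3 * d0 + x1^3 * d1 + x2^3 * d2 + x3^3 * d3 + x4^3 * d4 = 0"
    and E: "(x1 - x0) * (y0 * n0 - m0^2) + (x2 - x1) * (y1 * n1 - m1^2) + (x3 - x2) * (y2 * n2 - m2^2)
      + (x4 - x3) * (y3 * n3 - m3^2) + (x0 - x4) * (y4 * n4 - m4^2) = 0"
  shows "d0 * d1 * (x0 - x1)^2 * (x4 - x1) + d0 * d2 * (x0 - x2)^2 * (x4 - x2) + d0 * d3 * (x0 - x3)^2 * (x4 - x3)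
    + d1 * d2 * (x1 - x2)^2 * (x4 - x2) + d1 * d3 * (x1 - x3)^2 * (x4 - x3) + d2 * d3 * (x2 - x3)^2 * (x4 - x3) = 0"
proof -
  have s: "d0 + d1 + d2 + d3 = - d4" "x0 * d0 + x1 * d1 + x2 * d2 + x3 * d3 = - (x4 * d4)"
      "x0^2 * d0 + x1^2 * d1 + x2^2 * d2 + x3^2 * d3 = - (x4^2 * d4)"
      "x0^3 * d0 + x1^3 * d1 + x2^3 * d2 + x3^3 * d3 = - (x4^3 * d4)"
    using mom by (simp_all add: eq_neg_iff_add_eq_0)
  have A1: "x4 * (d0 + d1 + d2 + d3) - (x0 * d0 + x1 * d1 + x2 * d2 + x3 * d3) = 0"
    unfolding s by simp
  have A2: "x4 * (x0 * d0 + x1 * d1 + x2 * d2 + x3 * d3) - (x0^2 * d0 + x1^2 * d1 + x2^2 * d2 + x3^2 * d3) = 0"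
    unfolding s by (simp add: power2_eq_square)
  have A3: "x4 * (x0^2 * d0 + x1^2 * d1 + x2^2 * d2 + x3^2 * d3) - (x0^3 * d0 + x1^3 * d1 + x2^3 * d2 + x3^3 * d3) = 0"
    unfolding s by (simp add: power2_eq_square power3_eq_cube)
  have "(x1 - x0) * (y0 * n0 - m0^2) + (x2 - x1) * (y1 * n1 - m1^2) + (x3 - x2) * (y2 * n2 - m2^2)
      + (x4 - x3) * (y3 * n3 - m3^2) + (x0 - x4) * (y4 * n4 - m4^2) =
    (d0 * d1 * (x0 - x1)^2 * (x4 - x1) + d0 * d2 * (x0 - x2)^2 * (x4 - x2) + d0 * d3 * (x0 - x3)^2 * (x4 - x3)
    + d1 * d2 * (x1 - x2)^2 * (x4 - x2) + d1 * d3 * (x1 - x3)^2 * (x4 - x3) + d2 * d3 * (x2 - x3)^2 * (x4 - x3))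
    + y4 * (x4 * (x0^2 * d0 + x1^2 * d1 + x2^2 * d2 + x3^2 * d3) - (x0^3 * d0 + x1^3 * d1 + x2^3 * d2 + x3^3 * d3))
    + n4 * (x4 * (d0 + d1 + d2 + d3) - (x0 * d0 + x1 * d1 + x2 * d2 + x3 * d3))
    - 2 * m4 * (x4 * (x0 * d0 + x1 * d1 + x2 * d2 + x3 * d3) - (x0^2 * d0 + x1^2 * d1 + x2^2 * d2 + x3^2 * d3))"
    unfolding y m n by (simp add: algebra_simps power2_eq_square power3_eq_cube)
  then show ?thesis unfolding E A1 A2 A3 by simp
qed

text \<open>
  Incidence relations in coordinates, for the affine parts of a projective plane, a generalized quadrangle and a
  generalized hexagon. Points and lines are tuples of the same length; a point and the first
  coordinate of a line on it determine the line, and dually.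
\<close>

fun inc2 :: "'a :: comm_ring_1 \<times> 'a \<Rightarrow> 'a \<times> 'a \<Rightarrow> bool" where
  "inc2 (x, a) (y, m) \<longleftrightarrow> m = x * y - a"

fun inc3 :: "'a :: comm_ring_1 \<times> 'a \<times> 'a \<Rightarrow> 'a \<times> 'a \<times> 'a \<Rightarrow> bool" where
  "inc3 (x, a, b) (y, m, n) \<longleftrightarrow> m = x * y - a \<and> n = x * m - b"

fun inc5 :: "'a :: comm_ring_1 \<times> 'a \<times> 'a \<times> 'a \<times> 'a \<Rightarrow> 'a \<times> 'a \<times> 'a \<times> 'a \<times> 'a \<Rightarrow> bool" where
  "inc5 (x, a, b, e, f) (y, m, n, k, q) \<longleftrightarrow>
     m = x * y - a \<and> n = x * m - b \<and> k = x * n - e \<and> q = a * n - b * m - f"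

lemma incidence_cycleD:
  assumes "incidence_cycle I r p l" "i < r" "j = Suc i mod r"
  shows "I (p i) (l i)" "I (p j) (l i)" "p i \<noteq> p j" "l i \<noteq> l j" "I (p j) (l j)"
proof -
  have "j < r" using assms(2,3) by simp
  then show "I (p i) (l i)" "I (p j) (l i)" "p i \<noteq> p j" "l i \<noteq> l j" "I (p j) (l j)"
    using assms unfolding incidence_cycle_def by blast+
qed

lemma inc2_lines:
  assumes "inc2 p l" "inc2 p l'"
  shows "snd l' - snd l = fst p * (fst l' - fst l)" and "l \<noteq> l' \<Longrightarrow> fst l \<noteq> fst l'"
proof -
  obtain x a where p: "p = (x, a)" by (cases p)
  obtain y m where l: "l = (y, m)" by (cases l)
  obtain y' m' where l': "l' = (y', m')" by (cases l')
  have e: "m = x * y - a" "m' = x * y' - a" using assms by (simp_all add: p l l')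
  show "snd l' - snd l = fst p * (fst l' - fst l)" by (simp add: p l l' e right_diff_distrib)
  have "l = l'" if "y = y'" unfolding l l' e that by simp
  then show "l \<noteq> l' \<Longrightarrow> fst l \<noteq> fst l'" by (auto simp: l l')
qed

lemma inc2_points:
  assumes "inc2 p l" "inc2 p' l" "p \<noteq> p'"
  shows "fst p \<noteq> fst p'"
  using assms by (cases p; cases p'; cases l) auto

lemma no_incidence_cycle_inc2: "\<not> incidence_cycle inc2 2 p (l :: nat \<Rightarrow> 'a :: idom \<times> 'a)"
proof
  assume cyc: "incidence_cycle inc2 2 p l"
  note c = incidence_cycleD[OF cyc, of 0 1, simplified] incidence_cycleD[OF cyc, of 1 0, simplified]
  define x where "x i = fst (p i)" for i
  define y where "y i = fst (l i)" for i
  define m where "m i = snd (l i)" for i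
  have L: "m 0 - m 1 = x 0 * (y 0 - y 1)" "m 1 - m 0 = x 1 * (y 1 - y 0)"
    using inc2_lines(1)[of "p 0" "l 1" "l 0"] inc2_lines(1)[of "p 1" "l 0" "l 1"] c by (auto simp: x_def y_def m_def)
  have "x 0 \<noteq> x 1" using inc2_points[of "p 0" "l 0" "p 1"] c by (auto simp: x_def)
  moreover have "x 0 * (y 0 - y 1) + x 1 * (y 1 - y 0) = 0" unfolding L[symmetric] by simp
  ultimately have "y 0 - y 1 = 0"
    using vandermonde_two[of "y 0 - y 1" "y 1 - y 0" "x 0" "x 1"] by simp
  then show False using inc2_lines(2)[of "p 1" "l 0" "l 1"] c by (auto simp: y_def)
qed

lemma inc3_lines:
  assumes "inc3 p l" "inc3 p l'"
  shows "fst (snd l') - fst (snd l) = fst p * (fst l' - fst l)"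
    and "snd (snd l') - snd (snd l) = (fst p)^2 * (fst l' - fst l)"
    and "l \<noteq> l' \<Longrightarrow> fst l \<noteq> fst l'"
proof -
  obtain x a b where p: "p = (x, a, b)" by (cases p)
  obtain y m n where l: "l = (y, m, n)" by (cases l)
  obtain y' m' n' where l': "l' = (y', m', n')" by (cases l')
  note v = p l l'
  have e: "m = x * y - a" "m' = x * y' - a" "n = x * m - b" "n' = x * m' - b"
    using assms by (simp_all add: v)
  have "m' - m = x * (y' - y)" unfolding e(1,2) by (simp add: right_diff_distrib)
  moreover have "n' - n = x * (m' - m)" unfolding e(3,4) by (simp add: right_diff_distrib)
  moreover have "l = l'" if "y = y'" unfolding l l' e that by simp
  ultimately show "fst (snd l') - fst (snd l) = fst p * (fst l' - fst l)"
    "snd (snd l') - snd (snd l) = (fst p)^2 * (fst l' - fst l)" "l \<noteq> l' \<Longrightarrow> fst l \<noteq> fst l'"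
    by (simp_all only: v fst_conv snd_conv power2_eq_square mult.assoc) blast+
qed

lemma inc3_points:
  assumes "inc3 p l" "inc3 p' l" "p \<noteq> p'"
  shows "fst p \<noteq> fst p'"
  using assms by (cases p; cases p'; cases l) auto

lemma no_incidence_cycle_inc3:
  assumes "r = 2 \<or> r = 3"
  shows "\<not> incidence_cycle inc3 r p (l :: nat \<Rightarrow> 'a :: idom \<times> 'a \<times> 'a)"
proof
  assume cyc: "incidence_cycle inc3 r p l"
  define x where "x i = fst (p i)" for i
  define y where "y i = fst (l i)" for i
  define m where "m i = fst (snd (l i))" for i
  define n where "n i = snd (snd (l i))" for i
  have pts: "x i \<noteq> x j" if "i < r" "j = Suc i mod r" for i j
    using inc3_points[of "p i" "l i" "p j"] incidence_cycleD[OF cyc that] by (auto simp: x_def)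
  have ln: "m j - m i = x j * (y j - y i)" "n j - n i = (x j)^2 * (y j - y i)" "y j - y i \<noteq> 0"
    if "i < r" "j = Suc i mod r" for i j
    using inc3_lines[of "p j" "l i" "l j"] incidence_cycleD[OF cyc that] by (auto simp: x_def y_def m_def n_def)
  show False
  proof (cases "r = 2")
    case True
    have L: "m 0 - m 1 = x 0 * (y 0 - y 1)" "m 1 - m 0 = x 1 * (y 1 - y 0)" "y 0 - y 1 \<noteq> 0"
      using ln[of 1 0] ln[of 0 1] True by simp_all
    have "x 0 * (y 0 - y 1) + x 1 * (y 1 - y 0) = 0" unfolding L(1,2)[symmetric] by simp
    moreover have "x 0 \<noteq> x 1" using pts[of 0 1] True by simp
    ultimately show False
      using vandermonde_two[of "y 0 - y 1" "y 1 - y 0" "x 0" "x 1"] L(3) by simp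
  next
    case False
    then have r: "r = 3" using assms by simp
    have L: "m 0 - m 2 = x 0 * (y 0 - y 2)" "m 1 - m 0 = x 1 * (y 1 - y 0)" "m 2 - m 1 = x 2 * (y 2 - y 1)"
      "n 0 - n 2 = (x 0)^2 * (y 0 - y 2)" "n 1 - n 0 = (x 1)^2 * (y 1 - y 0)" "n 2 - n 1 = (x 2)^2 * (y 2 - y 1)"
      "y 0 - y 2 \<noteq> 0"
      using ln[of 2 0] ln[of 0 1] ln[of 1 2] r by simp_all
    have "x 0 * (y 0 - y 2) + x 1 * (y 1 - y 0) + x 2 * (y 2 - y 1) = 0" unfolding L(1-3)[symmetric] by simp
    moreover have "(x 0)^2 * (y 0 - y 2) + (x 1)^2 * (y 1 - y 0) + (x 2)^2 * (y 2 - y 1) = 0"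
      unfolding L(4-6)[symmetric] by simp
    moreover have "x 0 \<noteq> x 1" "x 0 \<noteq> x 2" using pts[of 0 1] pts[of 2 0] r by auto
    ultimately show False
      using vandermonde_three[of "y 0 - y 2" "y 1 - y 0" "y 2 - y 1" "x 0" "x 1" "x 2"] L(7) by simp
  qed
qed

text \<open>
  In their first four coordinates, two lines on a common point differ by a multiple of \<open>(1, x, x\<^sup>2, x\<^sup>3)\<close>, where \<open>x\<close> is the first coordinate of
  the point. Going around a cycle, the differences \<open>d\<^sub>i\<close> of the first coordinates of consecutive lines
  therefore satisfy the moment conditions. The last coordinates of the points yield the quadratic condition.
\<close>

lemma inc5_lines:
  assumes "inc5 p l" "inc5 p l'"
  shows "fst (snd l') - fst (snd l) = fst p * (fst l' - fst l)"
    and "fst (snd (snd l')) - fst (snd (snd l)) = (fst p)^2 * (fst l' - fst l)"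
    and "fst (snd (snd (snd l'))) - fst (snd (snd (snd l))) = (fst p)^3 * (fst l' - fst l)"
    and "l \<noteq> l' \<Longrightarrow> fst l \<noteq> fst l'"
proof -
  obtain x a b e f where p: "p = (x, a, b, e, f)" by (cases p)
  obtain y m n k q where l: "l = (y, m, n, k, q)" by (cases l)
  obtain y' m' n' k' q' where l': "l' = (y', m', n', k', q')" by (cases l')
  have e: "m = x * y - a" "m' = x * y' - a" "n = x * m - b" "n' = x * m' - b" "k = x * n - e" "k' = x * n' - e"
      "q = a * n - b * m - f" "q' = a * n' - b * m' - f"
    using assms by (simp_all add: p l l')
  have "m' - m = x * (y' - y)" unfolding e(1,2) by (simp add: right_diff_distrib)
  moreover have "n' - n = x * (m' - m)" unfolding e(3,4) by (simp add: right_diff_distrib)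
  moreover have "k' - k = x * (n' - n)" unfolding e(5,6) by (simp add: right_diff_distrib)
  moreover have "l = l'" if "y = y'" unfolding l l' e that by simp
  ultimately show "fst (snd l') - fst (snd l) = fst p * (fst l' - fst l)"
    "fst (snd (snd l')) - fst (snd (snd l)) = (fst p)^2 * (fst l' - fst l)"
    "fst (snd (snd (snd l'))) - fst (snd (snd (snd l))) = (fst p)^3 * (fst l' - fst l)"
    "l \<noteq> l' \<Longrightarrow> fst l \<noteq> fst l'"
    by (simp_all only: p l l' fst_conv snd_conv power2_eq_square power3_eq_cube mult.assoc) blast+
qed

lemma inc5_points:
  assumes "inc5 p l" "inc5 p' l"
  shows "p \<noteq> p' \<Longrightarrow> fst p \<noteq> fst p'"
    and "snd (snd (snd (snd p'))) - snd (snd (snd (snd p))) =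
      (fst p' - fst p) * (fst l * fst (snd (snd l)) - (fst (snd l))^2)"
proof -
  obtain x a b e f where p: "p = (x, a, b, e, f)" by (cases p)
  obtain x' a' b' e' f' where p': "p' = (x', a', b', e', f')" by (cases p')
  obtain y m n k q where l: "l = (y, m, n, k, q)" by (cases l)
  have i: "m = x * y - a" "n = x * m - b" "k = x * n - e" "q = a * n - b * m - f"
    using assms(1) unfolding p l inc5.simps by blast+
  have i': "m = x' * y - a'" "n = x' * m - b'" "k = x' * n - e'" "q = a' * n - b' * m - f'"
    using assms(2) unfolding p' l inc5.simps by blast+
  have e: "a = x * y - m" "a' = x' * y - m" "b = x * m - n" "b' = x' * m - n" "e = x * n - k" "e' = x' * n - k"
      "f = a * n - b * m - q" "f' = a' * n - b' * m - q"
    by (simp add: i(1), simp add: i'(1), simp add: i(2), simp add: i'(2), simp add: i(3), simp add: i'(3),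
        simp add: i(4), simp add: i'(4))
  have "p = p'" if "x = x'" unfolding p p' e that by simp
  then show "p \<noteq> p' \<Longrightarrow> fst p \<noteq> fst p'" by (auto simp: p p')
  have "a' - a = (x' - x) * y" unfolding e(1,2) by (simp add: left_diff_distrib)
  moreover have "b' - b = (x' - x) * m" unfolding e(3,4) by (simp add: left_diff_distrib)
  moreover have "f' - f = (a' - a) * n - (b' - b) * m" unfolding e(7,8) by (simp add: left_diff_distrib)
  ultimately have "f' - f = (x' - x) * y * n - (x' - x) * m * m" by (simp only:)
  then show "snd (snd (snd (snd p'))) - snd (snd (snd (snd p))) =
      (fst p' - fst p) * (fst l * fst (snd (snd l)) - (fst (snd l))^2)"
    by (simp only: p p' l fst_conv snd_conv right_diff_distrib power2_eq_square mult.assoc)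
qed

text \<open>
  Cycles with two or three points are excluded by Vandermonde. With four points, the moment conditions force
  \<open>x\<^sub>0 = x\<^sub>2\<close> and \<open>x\<^sub>1 = x\<^sub>3\<close>, and the quadratic condition reduces to one nonzero term. With five points, all
  \<open>x\<^sub>i\<close> are distinct, the moment conditions determine the \<open>d\<^sub>i\<close> up to a factor \<open>c \<noteq> 0\<close>, and by
  \<open>pentagon_identity\<close> the quadratic form that ought to vanish is a nonzero multiple of \<open>c\<^sup>2\<close>.
\<close>

lemma no_incidence_cycle_inc5:
  assumes "2 \<le> r" "r \<le> 5"
  shows "\<not> incidence_cycle inc5 r p (l :: nat \<Rightarrow> 'a :: field \<times> 'a \<times> 'a \<times> 'a \<times> 'a)"
proof
  assume cyc: "incidence_cycle inc5 r p l"
  define x where "x i = fst (p i)" for i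
  define f where "f i = snd (snd (snd (snd (p i))))" for i
  define y where "y i = fst (l i)" for i
  define m where "m i = fst (snd (l i))" for i
  define n where "n i = fst (snd (snd (l i)))" for i
  define k where "k i = fst (snd (snd (snd (l i))))" for i
  define w where "w i = y i * n i - (m i)^2" for i
  have pts: "x i \<noteq> x j" "f j - f i = (x j - x i) * w i" if "i < r" "j = Suc i mod r" for i j
    using inc5_points[of "p i" "l i" "p j"] incidence_cycleD[OF cyc that]
    by (auto simp: x_def y_def m_def n_def f_def w_def)
  have ln: "m j - m i = x j * (y j - y i)" "n j - n i = (x j)^2 * (y j - y i)" "k j - k i = (x j)^3 * (y j - y i)"
      "y j - y i \<noteq> 0" if "i < r" "j = Suc i mod r" for i j
    using inc5_lines[of "p j" "l i" "l j"] incidence_cycleD[OF cyc that] by (auto simp: x_def y_def m_def n_def k_def)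
  consider "r = 2" | "r = 3" | "r = 4" | "r = 5" using assms by linarith
  then show False
  proof cases
    case 1
    have L: "m 0 - m 1 = x 0 * (y 0 - y 1)" "m 1 - m 0 = x 1 * (y 1 - y 0)" "y 0 - y 1 \<noteq> 0"
      using ln[of 1 0] ln[of 0 1] 1 by simp_all
    have "x 0 * (y 0 - y 1) + x 1 * (y 1 - y 0) = 0" unfolding L(1,2)[symmetric] by simp
    moreover have "x 0 \<noteq> x 1" using pts[of 0 1] 1 by simp
    ultimately show False
      using vandermonde_two[of "y 0 - y 1" "y 1 - y 0" "x 0" "x 1"] L(3) by simp
  next
    case 2
    have L: "m 0 - m 2 = x 0 * (y 0 - y 2)" "m 1 - m 0 = x 1 * (y 1 - y 0)" "m 2 - m 1 = x 2 * (y 2 - y 1)"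
      "n 0 - n 2 = (x 0)^2 * (y 0 - y 2)" "n 1 - n 0 = (x 1)^2 * (y 1 - y 0)" "n 2 - n 1 = (x 2)^2 * (y 2 - y 1)"
      "y 0 - y 2 \<noteq> 0"
      using ln[of 2 0] ln[of 0 1] ln[of 1 2] 2 by simp_all
    have "x 0 * (y 0 - y 2) + x 1 * (y 1 - y 0) + x 2 * (y 2 - y 1) = 0" unfolding L(1-3)[symmetric] by simp
    moreover have "(x 0)^2 * (y 0 - y 2) + (x 1)^2 * (y 1 - y 0) + (x 2)^2 * (y 2 - y 1) = 0"
      unfolding L(4-6)[symmetric] by simp
    moreover have "x 0 \<noteq> x 1" "x 0 \<noteq> x 2" using pts[of 0 1] pts[of 2 0] 2 by auto
    ultimately show False
      using vandermonde_three[of "y 0 - y 2" "y 1 - y 0" "y 2 - y 1" "x 0" "x 1" "x 2"] L(7) by simp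
  next
    case 3
    define d0 d1 d2 d3 where d: "d0 = y 0 - y 3" "d1 = y 1 - y 0" "d2 = y 2 - y 1" "d3 = y 3 - y 2"
    have L1: "m 0 - m 3 = x 0 * d0" "m 1 - m 0 = x 1 * d1" "m 2 - m 1 = x 2 * d2" "m 3 - m 2 = x 3 * d3"
      and L2: "n 0 - n 3 = (x 0)^2 * d0" "n 1 - n 0 = (x 1)^2 * d1" "n 2 - n 1 = (x 2)^2 * d2" "n 3 - n 2 = (x 3)^2 * d3"
      and L3: "k 0 - k 3 = (x 0)^3 * d0" "k 1 - k 0 = (x 1)^3 * d1" "k 2 - k 1 = (x 2)^3 * d2" "k 3 - k 2 = (x 3)^3 * d3"
      and dn: "d0 \<noteq> 0" "d1 \<noteq> 0" "d2 \<noteq> 0" "d3 \<noteq> 0"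
      using ln[of 3 0] ln[of 0 1] ln[of 1 2] ln[of 2 3] unfolding d 3 by simp_all
    have F: "f 1 - f 0 = (x 1 - x 0) * w 0" "f 2 - f 1 = (x 2 - x 1) * w 1" "f 3 - f 2 = (x 3 - x 2) * w 2"
       "f 0 - f 3 = (x 0 - x 3) * w 3" and xn: "x 0 \<noteq> x 1" "x 1 \<noteq> x 2" "x 2 \<noteq> x 3" "x 3 \<noteq> x 0"
      using pts[of 3 0] pts[of 0 1] pts[of 1 2] pts[of 2 3] unfolding 3 by simp_all
    have M: "d0 + d1 + d2 + d3 = 0" "x 0 * d0 + x 1 * d1 + x 2 * d2 + x 3 * d3 = 0"
      "(x 0)^2 * d0 + (x 1)^2 * d1 + (x 2)^2 * d2 + (x 3)^2 * d3 = 0"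
      "(x 0)^3 * d0 + (x 1)^3 * d1 + (x 2)^3 * d2 + (x 3)^3 * d3 = 0"
      unfolding L1[symmetric] L2[symmetric] L3[symmetric] by (simp_all add: d)
    have x02: "x 0 = x 2"
    proof (rule ccontr)
      assume "x 0 \<noteq> x 2"
      then have "d0 = 0"
        using vandermonde_four[of d0 d1 d2 d3 "x 0" "x 1" "x 2" "x 3"] M xn by simp
      then show False using dn by simp
    qed
    have x13: "x 1 = x 3"
    proof (rule ccontr)
      assume "x 1 \<noteq> x 3"
      then have "d1 = 0"
        using vandermonde_four[of d1 d0 d2 d3 "x 1" "x 0" "x 2" "x 3"] M xn by (simp add: add.commute add.left_commute)
      then show False using dn by simp
    qed
    have "d0 * d1 * (x 0 - x 1)^2 * (x 3 - x 1) + d0 * d2 * (x 0 - x 2)^2 * (x 3 - x 2) + d0 * d3 * (x 0 - x 3)^2 * (x 3 - x 3)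
      + d1 * d2 * (x 1 - x 2)^2 * (x 3 - x 2) + d1 * d3 * (x 1 - x 3)^2 * (x 3 - x 3) + d2 * d3 * (x 2 - x 3)^2 * (x 3 - x 3) = 0"
    proof (rule quadratic_condition[where ?d4.0 = 0 and ?y4.0 = "y 3" and ?m4.0 = "m 3" and ?n4.0 = "n 3"])
      show "y 0 = y 3 + d0" "y 1 = y 0 + d1" "y 2 = y 1 + d2" "y 3 = y 2 + d3" by (simp_all add: d)
      show "m 0 = m 3 + x 0 * d0" "m 1 = m 0 + x 1 * d1" "m 2 = m 1 + x 2 * d2" "m 3 = m 2 + x 3 * d3"
        unfolding L1[symmetric] by simp_all
      show "n 0 = n 3 + (x 0)^2 * d0" "n 1 = n 0 + (x 1)^2 * d1" "n 2 = n 1 + (x 2)^2 * d2" "n 3 = n 2 + (x 3)^2 * d3"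
        unfolding L2[symmetric] by simp_all
      show "(x 1 - x 0) * (y 0 * n 0 - (m 0)^2) + (x 2 - x 1) * (y 1 * n 1 - (m 1)^2) + (x 3 - x 2) * (y 2 * n 2 - (m 2)^2)
        + (x 3 - x 3) * (y 3 * n 3 - (m 3)^2) + (x 0 - x 3) * (y 3 * n 3 - (m 3)^2) = 0"
        unfolding w_def[symmetric] F[symmetric] by simp
    qed (use M in simp_all)
    then show False using x02 x13 dn xn by simp
  next
    case 4
    define d0 d1 d2 d3 d4 where d: "d0 = y 0 - y 4" "d1 = y 1 - y 0" "d2 = y 2 - y 1" "d3 = y 3 - y 2" "d4 = y 4 - y 3"
    have L1: "m 0 - m 4 = x 0 * d0" "m 1 - m 0 = x 1 * d1" "m 2 - m 1 = x 2 * d2" "m 3 - m 2 = x 3 * d3" "m 4 - m 3 = x 4 * d4"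
      and L2: "n 0 - n 4 = (x 0)^2 * d0" "n 1 - n 0 = (x 1)^2 * d1" "n 2 - n 1 = (x 2)^2 * d2" "n 3 - n 2 = (x 3)^2 * d3" "n 4 - n 3 = (x 4)^2 * d4"
      and L3: "k 0 - k 4 = (x 0)^3 * d0" "k 1 - k 0 = (x 1)^3 * d1" "k 2 - k 1 = (x 2)^3 * d2" "k 3 - k 2 = (x 3)^3 * d3" "k 4 - k 3 = (x 4)^3 * d4"
      and dn: "d0 \<noteq> 0" "d1 \<noteq> 0" "d2 \<noteq> 0" "d3 \<noteq> 0" "d4 \<noteq> 0"
      using ln[of 4 0] ln[of 0 1] ln[of 1 2] ln[of 2 3] ln[of 3 4] unfolding d 4 by simp_all
    have F: "f 1 - f 0 = (x 1 - x 0) * w 0" "f 2 - f 1 = (x 2 - x 1) * w 1" "f 3 - f 2 = (x 3 - x 2) * w 2"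
       "f 4 - f 3 = (x 4 - x 3) * w 3" "f 0 - f 4 = (x 0 - x 4) * w 4"
      and xn: "x 0 \<noteq> x 1" "x 1 \<noteq> x 2" "x 2 \<noteq> x 3" "x 3 \<noteq> x 4" "x 4 \<noteq> x 0"
      using pts[of 4 0] pts[of 0 1] pts[of 1 2] pts[of 2 3] pts[of 3 4] unfolding 4 by simp_all
    have M: "d0 + d1 + d2 + d3 + d4 = 0" "x 0 * d0 + x 1 * d1 + x 2 * d2 + x 3 * d3 + x 4 * d4 = 0"
      "(x 0)^2 * d0 + (x 1)^2 * d1 + (x 2)^2 * d2 + (x 3)^2 * d3 + (x 4)^2 * d4 = 0"
      "(x 0)^3 * d0 + (x 1)^3 * d1 + (x 2)^3 * d2 + (x 3)^3 * d3 + (x 4)^3 * d4 = 0"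
      unfolding L1[symmetric] L2[symmetric] L3[symmetric] by (simp_all add: d)
    have M1: "d1 + d2 + d3 + d4 + d0 = 0" "x 1 * d1 + x 2 * d2 + x 3 * d3 + x 4 * d4 + x 0 * d0 = 0"
      "(x 1)^2 * d1 + (x 2)^2 * d2 + (x 3)^2 * d3 + (x 4)^2 * d4 + (x 0)^2 * d0 = 0"
      "(x 1)^3 * d1 + (x 2)^3 * d2 + (x 3)^3 * d3 + (x 4)^3 * d4 + (x 0)^3 * d0 = 0"
      using M by (simp_all only: add_ac)
    have M2: "d2 + d3 + d4 + d0 + d1 = 0" "x 2 * d2 + x 3 * d3 + x 4 * d4 + x 0 * d0 + x 1 * d1 = 0"
      "(x 2)^2 * d2 + (x 3)^2 * d3 + (x 4)^2 * d4 + (x 0)^2 * d0 + (x 1)^2 * d1 = 0"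
      "(x 2)^3 * d2 + (x 3)^3 * d3 + (x 4)^3 * d4 + (x 0)^3 * d0 + (x 1)^3 * d1 = 0"
      using M by (simp_all only: add_ac)
    have M3: "d3 + d4 + d0 + d1 + d2 = 0" "x 3 * d3 + x 4 * d4 + x 0 * d0 + x 1 * d1 + x 2 * d2 = 0"
      "(x 3)^2 * d3 + (x 4)^2 * d4 + (x 0)^2 * d0 + (x 1)^2 * d1 + (x 2)^2 * d2 = 0"
      "(x 3)^3 * d3 + (x 4)^3 * d4 + (x 0)^3 * d0 + (x 1)^3 * d1 + (x 2)^3 * d2 = 0"
      using M by (simp_all only: add_ac)
    have xx: "x 0 \<noteq> x 2" "x 1 \<noteq> x 3" "x 2 \<noteq> x 4" "x 3 \<noteq> x 0"
      using nonadjacent_abscissae_distinct[OF M xn dn(2,4,5)]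
        nonadjacent_abscissae_distinct[OF M1 xn(2-5,1) dn(3,5,1)]
        nonadjacent_abscissae_distinct[OF M2 xn(3-5,1,2) dn(4,1,2)]
        nonadjacent_abscissae_distinct[OF M3 xn(4,5,1-3) dn(5,2,3)] by blast+
    have "d4 + d0 + d1 + d2 + d3 = 0" "x 4 * d4 + x 0 * d0 + x 1 * d1 + x 2 * d2 + x 3 * d3 = 0"
      "(x 4)^2 * d4 + (x 0)^2 * d0 + (x 1)^2 * d1 + (x 2)^2 * d2 + (x 3)^2 * d3 = 0"
      "(x 4)^3 * d4 + (x 0)^3 * d0 + (x 1)^3 * d1 + (x 2)^3 * d2 + (x 3)^3 * d3 = 0"
      using M by (simp_all only: add_ac)
    from nonadjacent_abscissae_distinct[OF this xn(5,1-4) dn(1,3,4)] have xx5: "x 4 \<noteq> x 1" .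
    define c where "c = d4 * ((x 4 - x 0) * (x 4 - x 1) * (x 4 - x 2) * (x 4 - x 3))"
    have c0: "c \<noteq> 0" using dn xn xx xx5 by (auto simp: c_def)
    have W: "d0 * ((x 0 - x 4) * (x 0 - x 1) * (x 0 - x 2) * (x 0 - x 3)) = c"
      "d1 * ((x 1 - x 4) * (x 1 - x 0) * (x 1 - x 2) * (x 1 - x 3)) = c"
      "d2 * ((x 2 - x 4) * (x 2 - x 0) * (x 2 - x 1) * (x 2 - x 3)) = c"
      "d3 * ((x 3 - x 4) * (x 3 - x 0) * (x 3 - x 1) * (x 3 - x 2)) = c"
      using lagrange_weights[OF M]
        lagrange_weights[of d1 d0 d2 d3 d4 "x 1" "x 0" "x 2" "x 3" "x 4"]
        lagrange_weights[of d2 d0 d1 d3 d4 "x 2" "x 0" "x 1" "x 3" "x 4"]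
        lagrange_weights[of d3 d0 d1 d2 d4 "x 3" "x 0" "x 1" "x 2" "x 4"] M
      by (simp_all only: c_def add_ac mult_ac)
    define u where "u i = x i - x 4" for i
    have ud: "x i - x j = u i - u j" for i j by (simp add: u_def)
    have "d0 * d1 * (x 0 - x 1)^2 * (x 4 - x 1) + d0 * d2 * (x 0 - x 2)^2 * (x 4 - x 2) + d0 * d3 * (x 0 - x 3)^2 * (x 4 - x 3)
      + d1 * d2 * (x 1 - x 2)^2 * (x 4 - x 2) + d1 * d3 * (x 1 - x 3)^2 * (x 4 - x 3) + d2 * d3 * (x 2 - x 3)^2 * (x 4 - x 3) = 0"
    proof (rule quadratic_condition[where ?d4.0 = d4 and ?y4.0 = "y 4" and ?m4.0 = "m 4" and ?n4.0 = "n 4"])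
      show "y 0 = y 4 + d0" "y 1 = y 0 + d1" "y 2 = y 1 + d2" "y 3 = y 2 + d3" by (simp_all add: d)
      show "m 0 = m 4 + x 0 * d0" "m 1 = m 0 + x 1 * d1" "m 2 = m 1 + x 2 * d2" "m 3 = m 2 + x 3 * d3"
        unfolding L1[symmetric] by simp_all
      show "n 0 = n 4 + (x 0)^2 * d0" "n 1 = n 0 + (x 1)^2 * d1" "n 2 = n 1 + (x 2)^2 * d2" "n 3 = n 2 + (x 3)^2 * d3"
        unfolding L2[symmetric] by simp_all
      show "(x 1 - x 0) * (y 0 * n 0 - (m 0)^2) + (x 2 - x 1) * (y 1 * n 1 - (m 1)^2) + (x 3 - x 2) * (y 2 * n 2 - (m 2)^2)
        + (x 4 - x 3) * (y 3 * n 3 - (m 3)^2) + (x 0 - x 4) * (y 4 * n 4 - (m 4)^2) = 0"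
        unfolding w_def[symmetric] F[symmetric] by simp
    qed (fact M)+
    then have "d0 * d1 * (u 0 - u 1)^2 * u 1 + d0 * d2 * (u 0 - u 2)^2 * u 2 + d0 * d3 * (u 0 - u 3)^2 * u 3
      + d1 * d2 * (u 1 - u 2)^2 * u 2 + d1 * d3 * (u 1 - u 3)^2 * u 3 + d2 * d3 * (u 2 - u 3)^2 * u 3 = 0"
    proof -
      have neg: "x 4 - x i = - u i" for i by (simp add: u_def)
      assume "d0 * d1 * (x 0 - x 1)^2 * (x 4 - x 1) + d0 * d2 * (x 0 - x 2)^2 * (x 4 - x 2) + d0 * d3 * (x 0 - x 3)^2 * (x 4 - x 3)
      + d1 * d2 * (x 1 - x 2)^2 * (x 4 - x 2) + d1 * d3 * (x 1 - x 3)^2 * (x 4 - x 3) + d2 * d3 * (x 2 - x 3)^2 * (x 4 - x 3) = 0"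
      then have "- (d0 * d1 * (u 0 - u 1)^2 * u 1 + d0 * d2 * (u 0 - u 2)^2 * u 2 + d0 * d3 * (u 0 - u 3)^2 * u 3
        + d1 * d2 * (u 1 - u 2)^2 * u 2 + d1 * d3 * (u 1 - u 3)^2 * u 3 + d2 * d3 * (u 2 - u 3)^2 * u 3) = 0"
        unfolding neg by (simp only: ud[of 0 1] ud[of 0 2] ud[of 0 3] ud[of 1 2] ud[of 1 3] ud[of 2 3]
            mult_minus_right minus_add_distrib)
      then show ?thesis by (simp only: neg_equal_0_iff_equal)
    qed
    moreover have "u 0 \<noteq> 0" "u 1 \<noteq> 0" "u 2 \<noteq> 0" "u 3 \<noteq> 0" "u 0 \<noteq> u 1" "u 0 \<noteq> u 2" "u 0 \<noteq> u 3" "u 1 \<noteq> u 2" "u 1 \<noteq> u 3" "u 2 \<noteq> u 3"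
      using xn xx xx5 by (auto simp: u_def)
    note pentagon_identity[OF this, of d0 c d1 d2 d3]
    moreover have "d0 * (u 0 * (u 0 - u 1) * (u 0 - u 2) * (u 0 - u 3)) = c"
      "d1 * (u 1 * (u 1 - u 0) * (u 1 - u 2) * (u 1 - u 3)) = c"
      "d2 * (u 2 * (u 2 - u 0) * (u 2 - u 1) * (u 2 - u 3)) = c"
      "d3 * (u 3 * (u 3 - u 0) * (u 3 - u 1) * (u 3 - u 2)) = c"
      using W by (simp_all add: u_def)
    ultimately have "c^2 = 0" by simp
    then show False using c0 by simp
  qed
qed

section \<open>The order of magnitude of st for even cycles\<close>

lemma card_inc2_neighbours:
  assumes K: "\<And>x y. x \<in> K \<Longrightarrow> y \<in> K \<Longrightarrow> x - y \<in> K \<and> x * y \<in> K" and p: "p \<in> K \<times> K"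
  shows "card {q \<in> K \<times> K. inc2 p q} = card K"
proof -
  obtain x a where "p = (x, a)" by (cases p)
  then have "{q \<in> K \<times> K. inc2 p q} = (\<lambda>y. (y, x * y - a)) ` K" using p K by auto
  then show ?thesis by (simp add: card_image inj_on_def)
qed

lemma card_inc3_neighbours:
  assumes K: "\<And>x y. x \<in> K \<Longrightarrow> y \<in> K \<Longrightarrow> x - y \<in> K \<and> x * y \<in> K" and p: "p \<in> K \<times> K \<times> K"
  shows "card {q \<in> K \<times> K \<times> K. inc3 p q} = card K"
proof -
  obtain x a b where "p = (x, a, b)" by (cases p)
  then have "{q \<in> K \<times> K \<times> K. inc3 p q} = (\<lambda>y. (y, x * y - a, x * (x * y - a) - b)) ` K"
    using p K by auto
  then show ?thesis by (simp add: card_image inj_on_def)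
qed

lemma card_inc5_neighbours:
  assumes K: "\<And>x y. x \<in> K \<Longrightarrow> y \<in> K \<Longrightarrow> x - y \<in> K \<and> x * y \<in> K" and p: "p \<in> K \<times> K \<times> K \<times> K \<times> K"
  shows "card {q \<in> K \<times> K \<times> K \<times> K \<times> K. inc5 p q} = card K"
proof -
  obtain x a b e f where pe: "p = (x, a, b, e, f)" by (cases p)
  define m where "m y = x * y - a" for y
  define n where "n y = x * m y - b" for y
  define k where "k y = x * n y - e" for y
  define g where "g y = a * n y - b * m y - f" for y
  have "m y \<in> K" "n y \<in> K" "k y \<in> K" "g y \<in> K" if "y \<in> K" for y
    using that p K unfolding pe m_def n_def k_def g_def by simp_all
  then have "{q \<in> K \<times> K \<times> K \<times> K \<times> K. inc5 p q} = (\<lambda>y. (y, m y, n y, k y, g y)) ` K"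
    by (auto simp: pe m_def n_def k_def g_def)
  then show ?thesis by (simp add: card_image inj_on_def)
qed

text \<open>
  If \<open>I\<close> has no cycles with at most \<open>k\<close> points, all cycles of its incidence graph have length at least
  \<open>2k + 2\<close>, and a chorded \<open>l\<close>-cycle with \<open>l \<le> 4k\<close> would contain a cycle of length at most
  \<open>2k + 1\<close>.
\<close>

lemma st_lower_bound_from_incidences:
  fixes I :: "'v \<Rightarrow> 'v \<Rightarrow> bool" and s k l :: nat
  assumes s: "s \<ge> 1" and l: "l \<ge> 3" "l \<le> 4 * k"
    and no: "\<And>r p q. 2 \<le> r \<Longrightarrow> r \<le> k \<Longrightarrow> \<not> incidence_cycle I r p q"
    and P: "\<And>m. m \<ge> 1 \<Longrightarrow> \<exists>P. finite P \<and> card P = (2 ^ m) ^ s \<and> (\<forall>p\<in>P. card {q\<in>P. I p q} = 2 ^ m)"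
  shows "\<exists>c>0. \<forall>n\<ge>2. c * real n powr (1 + 1 / real s) \<le> real (st n (cycle_graph l))"
proof (rule lower_bound_from_powers_of_two[where c = 1])
  fix m n :: nat assume m: "m \<ge> 1" and n: "2 * (2 ^ m) ^ s \<le> n"
  obtain P where P: "finite P" "card P = (2 ^ m) ^ s" "\<forall>p\<in>P. card {q\<in>P. I p q} = 2 ^ m"
    using P[OF m] by blast
  have "card P * 2 ^ m \<le> st n (cycle_graph l)"
    by (rule st_ge_incidences[of P P n l k I]) (use P n l no in auto)
  then have "(2 ^ m) ^ (s + 1) \<le> st n (cycle_graph l)" by (simp add: P(2) mult.commute)
  then have "real ((2 ^ m) ^ (s + 1)) \<le> real (st n (cycle_graph l))" by (simp only: of_nat_le_iff)
  then show "1 * (2 ^ m) ^ (s + 1) \<le> real (st n (cycle_graph l))" by simp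
qed (use s l st_cycle_graph_pos in \<open>auto simp: Suc_le_eq\<close>)

text \<open>
  The exponents \<open>3/2\<close>, \<open>4/3\<close> and \<open>6/5\<close> come from graphs of girth at least 6, 8 and 12.
\<close>

lemma st_lower_bound_three_halves:
  assumes "3 \<le> l" "l \<le> 8"
  shows "\<exists>c>0. \<forall>n\<ge>2. c * real n powr (1 + 1 / real 2) \<le> real (st n (cycle_graph l))"
proof (rule st_lower_bound_from_incidences[where I = "inc2 :: bit alg_closure \<times> _ \<Rightarrow> _" and k = 2])
  fix m :: nat assume "m \<ge> 1"
  then obtain K :: "bit alg_closure set" where K: "finite K" "card K = 2 ^ m"
    "\<forall>x\<in>K. \<forall>y\<in>K. x + y \<in> K \<and> x - y \<in> K \<and> x * y \<in> K"
    using exists_field_of_power_of_two_order by blast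
  show "\<exists>P :: (bit alg_closure \<times> bit alg_closure) set. finite P \<and> card P = (2 ^ m) ^ 2 \<and> (\<forall>p\<in>P. card {q \<in> P. inc2 p q} = 2 ^ m)"
  proof (intro exI[of _ "K \<times> K"] conjI ballI)
    show "card (K \<times> K) = (2 ^ m) ^ 2"
      by (simp add: card_cartesian_product K(2) power2_eq_square)
    fix p assume "p \<in> K \<times> K"
    then show "card {q \<in> K \<times> K. inc2 p q} = 2 ^ m"
      using K card_inc2_neighbours[of K p] by simp
  qed (use K in auto)
next
  fix r :: nat and p q :: "nat \<Rightarrow> bit alg_closure \<times> bit alg_closure"
  assume "2 \<le> r" "r \<le> 2"
  then have "r = 2" by simp
  then show "\<not> incidence_cycle inc2 r p q" using no_incidence_cycle_inc2[of p q] by simp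
qed (use assms in auto)

lemma st_lower_bound_four_thirds:
  assumes "3 \<le> l" "l \<le> 12"
  shows "\<exists>c>0. \<forall>n\<ge>2. c * real n powr (1 + 1 / real 3) \<le> real (st n (cycle_graph l))"
proof (rule st_lower_bound_from_incidences[where I = "inc3 :: bit alg_closure \<times> _ \<Rightarrow> _" and k = 3])
  fix m :: nat assume "m \<ge> 1"
  then obtain K :: "bit alg_closure set" where K: "finite K" "card K = 2 ^ m"
    "\<forall>x\<in>K. \<forall>y\<in>K. x + y \<in> K \<and> x - y \<in> K \<and> x * y \<in> K"
    using exists_field_of_power_of_two_order by blast
  show "\<exists>P :: (bit alg_closure \<times> bit alg_closure \<times> bit alg_closure) set. finite P \<and> card P = (2 ^ m) ^ 3 \<and> (\<forall>p\<in>P. card {q \<in> P. inc3 p q} = 2 ^ m)"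
  proof (intro exI[of _ "K \<times> K \<times> K"] conjI ballI)
    show "card (K \<times> K \<times> K) = (2 ^ m) ^ 3"
      by (simp add: card_cartesian_product K(2) power3_eq_cube)
    fix p assume "p \<in> K \<times> K \<times> K"
    then show "card {q \<in> K \<times> K \<times> K. inc3 p q} = 2 ^ m"
      using K card_inc3_neighbours[of K p] by simp
  qed (use K in auto)
next
  fix r :: nat and p q :: "nat \<Rightarrow> bit alg_closure \<times> bit alg_closure \<times> bit alg_closure"
  assume "2 \<le> r" "r \<le> 3"
  then have "r = 2 \<or> r = 3" by auto
  then show "\<not> incidence_cycle inc3 r p q" by (rule no_incidence_cycle_inc3)
qed (use assms in auto)

lemma st_lower_bound_six_fifths:
  assumes "3 \<le> l" "l \<le> 20"
  shows "\<exists>c>0. \<forall>n\<ge>2. c * real n powr (1 + 1 / real 5) \<le> real (st n (cycle_graph l))"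
proof (rule st_lower_bound_from_incidences[where I = "inc5 :: bit alg_closure \<times> _ \<Rightarrow> _" and k = 5])
  fix m :: nat assume "m \<ge> 1"
  then obtain K :: "bit alg_closure set" where K: "finite K" "card K = 2 ^ m"
    "\<forall>x\<in>K. \<forall>y\<in>K. x + y \<in> K \<and> x - y \<in> K \<and> x * y \<in> K"
    using exists_field_of_power_of_two_order by blast
  show "\<exists>P :: (bit alg_closure \<times> bit alg_closure \<times> bit alg_closure \<times> bit alg_closure \<times> bit alg_closure) set. finite P \<and> card P = (2 ^ m) ^ 5 \<and> (\<forall>p\<in>P. card {q \<in> P. inc5 p q} = 2 ^ m)"
  proof (intro exI[of _ "K \<times> K \<times> K \<times> K \<times> K"] conjI ballI)
    show "card (K \<times> K \<times> K \<times> K \<times> K) = (2 ^ m) ^ 5"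
      by (simp add: card_cartesian_product K(2) eval_nat_numeral)
    fix p assume "p \<in> K \<times> K \<times> K \<times> K \<times> K"
    then show "card {q \<in> K \<times> K \<times> K \<times> K \<times> K. inc5 p q} = 2 ^ m"
      using K card_inc5_neighbours[of K p] by simp
  qed (use K in auto)
qed (use assms no_incidence_cycle_inc5 in auto)

lemma st_upper_bound:
  fixes k l :: nat
  assumes "k \<ge> 1" "even l" "l > 0" "4 * k \<le> l + 2"
  shows "\<exists>C>0. \<forall>n\<ge>1. real (st n (cycle_graph l)) \<le> C * real n powr (1 + 1 / real k)"
proof -
  obtain C where C: "C > 0" "\<And>(V :: nat set) E. finite V \<Longrightarrow> V \<noteq> {} \<Longrightarrow> (\<forall>e\<in>E. e \<subseteq> V \<and> card e = 2) \<Longrightarrow>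
     C * real (card V) powr (1 + 1 / k) \<le> real (card E) \<Longrightarrow> chorded_cycle E l"
    using dense_imp_chorded_cycle[OF assms, where 'a = nat] by blast
  have "real (st n (cycle_graph l)) \<le> C * real n powr (1 + 1 / real k)" if n: "n \<ge> 1" for n
  proof (rule ccontr)
    assume big: "\<not> ?thesis"
    obtain H where H: "st_admissible n (cycle_graph l) H" "card (edges H) = st n (cycle_graph l)"
      by (rule st_attained)
    have "simple_graph H" "card (verts H) = n" using H(1) by (auto simp: st_admissible_def)
    then have "chorded_cycle (edges H) l"
      using C(2)[of "verts H" "edges H"] big n H(2) by (fastforce simp: simple_graph_def)
    then show False using admissible_not_chorded[OF H(1)] by simp
  qed
  then show ?thesis using C(1) by blast
qed

theorem theorem19:
  fixes l :: nat
  assumes "l \<ge> 6" and "even l"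
  shows "(\<lambda>n. real (st n (cycle_graph l))) \<in> O(\<lambda>n. real n powr (1 + 1 / real_of_int \<lceil>real l / 4\<rceil>))
    \<and> (l \<in> {6, 8, 10, 12, 18, 20} \<longrightarrow>
        (\<lambda>n. real (st n (cycle_graph l))) \<in> \<Theta>(\<lambda>n. real n powr (1 + 1 / real_of_int \<lceil>real l / 4\<rceil>)))
    \<and> (l \<in> {14, 16} \<longrightarrow>
        (\<exists>c\<^sub>1>0. \<exists>c\<^sub>2>0. \<forall>n\<ge>l.
          c\<^sub>1 * real n powr (6 / 5) \<le> real (st n (cycle_graph l)) \<and>
          real (st n (cycle_graph l)) \<le> c\<^sub>2 * real n powr (5 / 4)))
    \<and> (\<forall>k::nat. l > 20 \<and> l = 4 * k - 2 \<longrightarrow>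
        (\<exists>c>0. \<forall>n\<ge>l. real (st n (cycle_graph l)) \<ge> c * real n powr (1 + 2 / (6 * real k - 6))))
    \<and> (\<forall>k::nat. l > 20 \<and> l = 4 * k \<longrightarrow>
        (\<exists>c>0. \<forall>n\<ge>l. real (st n (cycle_graph l)) \<ge> c * real n powr (1 + 2 / (6 * real k - 2))))"
proof -
  define F where "F n = real (st n (cycle_graph l))" for n
  define k where "k = (l + 3) div 4"
  have k: "k \<ge> 1" "4 * k \<le> l + 2" "l \<le> 4 * k"
    using assms unfolding k_def by presburger+
  have ceil: "real_of_int \<lceil>real l / 4\<rceil> = real k"
  proof -
    have "real l \<le> real (4 * k)" "real (4 * k) < real (l + 4)" using k by (simp_all only: of_nat_le_iff of_nat_less_iff)
    then have "\<lceil>real l / 4\<rceil> = int k" by (intro ceiling_unique) auto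
    then show ?thesis by simp
  qed
  obtain C where C: "C > 0" "\<And>n. n \<ge> 1 \<Longrightarrow> F n \<le> C * real n powr (1 + 1 / real k)"
    using st_upper_bound[of k l] k assms unfolding F_def by auto
  have F0: "F n \<ge> 0" for n by (simp add: F_def)
  have up: "F \<in> O(\<lambda>n. real n powr (1 + 1 / real k))"
  proof (rule bigoI[where c = C])
    show "\<forall>\<^sub>F n in at_top. norm (F n) \<le> C * norm (real n powr (1 + 1 / real k))"
      using eventually_ge_at_top[of 1] by eventually_elim (use C F0 in auto)
  qed
  have theta: "F \<in> \<Theta>(\<lambda>n. real n powr (1 + 1 / real k))" if lv: "l \<in> {6, 8, 10, 12, 18, 20}"
  proof -
    have "\<exists>c>0. \<forall>n\<ge>2. c * real n powr (1 + 1 / real k) \<le> F n"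
    proof -
      consider "l \<le> 8" "k = 2" | "l \<le> 12" "k = 3" | "l \<le> 20" "k = 5"
        using lv by (auto simp: k_def)
      then show ?thesis
        using st_lower_bound_three_halves[of l] st_lower_bound_four_thirds[of l] st_lower_bound_six_fifths[of l] assms
        unfolding F_def by cases simp_all
    qed
    then obtain c where c: "c > 0" "\<And>n. n \<ge> 2 \<Longrightarrow> c * real n powr (1 + 1 / real k) \<le> F n" by blast
    have "F \<in> \<Omega>(\<lambda>n. real n powr (1 + 1 / real k))"
    proof (rule landau_omega.bigI[OF c(1)])
      show "\<forall>\<^sub>F n in at_top. c * norm (real n powr (1 + 1 / real k)) \<le> norm (F n)"
        using eventually_ge_at_top[of 2] by eventually_elim (use c F0 in auto)
    qed
    then show ?thesis using up by (intro bigthetaI)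
  qed
  have mid: "\<exists>c1>0. \<exists>c2>0. \<forall>n\<ge>l. c1 * real n powr (6 / 5) \<le> F n \<and> F n \<le> c2 * real n powr (5 / 4)"
    if lv: "l \<in> {14, 16}"
  proof -
    have "k = 4" using lv by (auto simp: k_def)
    obtain c where c: "c > 0" "\<And>n. n \<ge> 2 \<Longrightarrow> c * real n powr (1 + 1 / real 5) \<le> F n"
      using st_lower_bound_six_fifths[of l] lv unfolding F_def by auto
    have "c * real n powr (6 / 5) \<le> F n \<and> F n \<le> C * real n powr (5 / 4)" if "n \<ge> l" for n
      using c(2)[of n] C(2)[of n] that assms \<open>k = 4\<close> by simp
    then show ?thesis using c(1) C(1) by blast
  qed
  \<comment> \<open>Girth at least \<open>2 j + 2\<close> excludes chorded \<open>l\<close>-cycles, and greedily it is compatible with \<open>n\<^bsup>1 + 1 / (2 j)\<^esup>\<close> edges.\<close>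
  have low: "\<exists>c>0. \<forall>n\<ge>l. F n \<ge> c * real n powr (1 + a)" if j: "j \<ge> 1" "l \<le> 4 * j" "a \<le> 1 / (2 * real j)" for j a
  proof -
    obtain c where c: "c > 0" "\<And>n. n \<ge> 2 \<Longrightarrow> c * real n powr (1 + 1 / real (2 * j)) \<le> F n"
      using st_lower_bound_greedy[of "2 * j + 1" l] j assms unfolding F_def by auto
    have "c * real n powr (1 + a) \<le> F n" if "n \<ge> l" for n
    proof -
      have "real n powr (1 + a) \<le> real n powr (1 + 1 / real (2 * j))"
        using that assms j by (intro powr_mono) auto
      then have "c * real n powr (1 + a) \<le> c * real n powr (1 + 1 / real (2 * j))" using c by (intro mult_left_mono) auto
      then show ?thesis using c(2)[of n] that assms by linarith
    qed
    then show ?thesis using c(1) by blast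
  qed
  have low1: "\<exists>c>0. \<forall>n\<ge>l. F n \<ge> c * real n powr (1 + 2 / (6 * real j - 6))" if "l > 20" "l = 4 * j - 2" for j
  proof (rule low[of j])
    have "real j \<ge> 6" using that by simp
    then show "2 / (6 * real j - 6) \<le> 1 / (2 * real j)" by (simp add: field_simps)
  qed (use that in auto)
  have low2: "\<exists>c>0. \<forall>n\<ge>l. F n \<ge> c * real n powr (1 + 2 / (6 * real j - 2))" if "l > 20" "l = 4 * j" for j
  proof (rule low[of j])
    have "real j \<ge> 6" using that by simp
    then show "2 / (6 * real j - 2) \<le> 1 / (2 * real j)" by (simp add: field_simps)
  qed (use that in auto)
  show ?thesis
    using up theta mid low1 low2 unfolding ceil F_def[abs_def] by blast
qed

end
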